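(* Let $R>1$ and let $T:L^2(\mathbb S^2)\to L^1(\mathbb S^2)$ be the forward operator of satellite gradiometry, $$(Tf)(x)=\sum_{m=0}^\infty\frac{(m+1)(m+2)}{R^{m+3}}(Q_mf)(x),\qquad x\in\mathbb S^2.$$ Let $f^\dagger\in H^p(\mathbb S^2)$ with some $p>0$. For data $g^{\rm obs}=Tf^\dagger+\xi$ with $\xi\in L^1(\mathbb S^2)$ let $$\hat f_\alpha\in\operatorname*{argmin}_{f\in L^2(\mathbb S^2)}\Big[\tfrac1\alpha\|Tf-g^{\rm obs}\|_{L^1(\mathbb S^2)}+\|f\|_{L^2(\mathbb S^2)}^2\Big].$$ Suppose that $\alpha=\alpha(\eta,\epsilon)$ is chosen such that, for a fixed constant $C_{\rm e}>0$, $$\sqrt{\frac{2\epsilon}{\alpha}}+\frac{2\eta\,\gamma(2\eta)}{\alpha}\le C_{\rm e}\qquad\text{in the limit }\eta,\epsilon,\alpha\searrow0,$$ with $\gamma$ as in the context. Then there exist $\eta_0>0$ and a constant $C=C(R,T,f^\dagger)$ (for fixed $C_{\rm e}$) such that for any noise function $\xi\in L^1(\mathbb S^2)$ satisfying $$\exists\ \mathbb P\subset\mathbb S^2\text{ Borel}:\quad\|\xi\|_{L^1(\mathbb S^2\setminus\mathbb P)}\le\epsilon,\quad|\mathbb P|\le\eta$$ with $0<\eta\le\eta_0$, $\epsilon\ge0$, one has $$\|\hat f_\alpha-f^\dagger\|_{L^2(\mathbb S^2)}^2\le C\Big(\frac\epsilon\alpha+\frac1{\alpha^2}\frac1{R^6}\eta^{-3}R^{-2\sqrt{\pi/\eta}}+(-\ln\alpha)^{-2p}\Big)(1+o(1)),$$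 $$\|T\hat f_\alpha-Tf^\dagger\|_{L^1(\mathbb S^2)}\le C\Big(\epsilon+\frac1{\alpha}\frac1{R^6}\eta^{-3}R^{-2\sqrt{\pi/\eta}}+\alpha(-\ln\alpha)^{-2p}\Big)(1+o(1))$$ as $\eta,\epsilon,\alpha\searrow0$. Moreover, the parameter $\alpha=\bar\alpha(\epsilon,\eta)$ can be chosen such that, as $\epsilon,\eta\searrow0$, $$\|\hat f_{\bar\alpha}-f^\dagger\|_{L^2(\mathbb S^2)}^2=\mathcal O\big(\max\{(-\ln\epsilon)^{-2p},\eta^p\}\big),$$ $$\|T\hat f_{\bar\alpha}-Tf^\dagger\|_{L^1(\mathbb S^2)}=\mathcal O\Big(\max\Big\{\epsilon,\eta^{\frac{2p-3}2}R^{-\sqrt{\pi/\eta}}\Big\}\Big).$$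
   Context: $\mathbb S^2\subset\mathbb R^3$ is the unit sphere with surface measure $|\cdot|$. $Q_m$ is the $L^2(\mathbb S^2)$-orthogonal projection onto the space $\mathcal H_m$ of spherical harmonics of degree $m$ (restrictions to $\mathbb S^2$ of harmonic polynomials homogeneous of degree $m$). $H^p(\mathbb S^2)$ is the $L^2$-based Sobolev space on the sphere, i.e. $\sum_m(1+m)^{2p}\|Q_mf\|_{L^2}^2<\infty$. (Equivalently $T$ maps the boundary values $f$ on $\mathbb S^2$ of the decaying harmonic function $u$ in the exterior of the unit ball to $\partial^2u/\partial r^2$ at radius $R$, as a function on $\mathbb S^2$.) The function $\gamma$ is $$\gamma(\delta)=C_\gamma\,\delta^{-5/2}R^{-\sqrt{4\pi/\delta}-4}$$ for sufficiently small $\delta>0$, with a constant $C_\gamma$ independent of $R$ and $\delta$ such that for some $\delta_0>0$ one has $\|T(f-f^\dagger)\|_{L^\infty(\mathbb S^2)}\le\gamma(\delta)\|f-f^\dagger\|_{L^2(\mathbb S^2)}+\frac1\delta\|T(f-f^\dagger)\|_{L^1(\mathbb S^2)}$ for all $0<\delta\le\delta_0$, $f\in L^2(\mathbb S^2)$ (such $C_\gamma$ and $\delta_0$ exist). Convention: $(-\ln 0)^{-2p}=0$. The estimates and the $\mathcal O$-bounds are uniform over all noise functions $\xi$ satisfying the noise condition with the given $\epsilon,\eta$. *)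

theory Defs
  imports "HOL-Probability.Probability"
begin

type_synonym sphere_fun = "real ^ 3 \<Rightarrow> real"

text \<open>Surface measure on the unit sphere, on its Borel subsets: \<open>A\<close> has three times the volume of
  the cone \<open>{t x | 0 < t \<le> 1, x \<in> A}\<close>, by integration in polar coordinates. The map \<open>sgn\<close> is
  \<open>x \<mapsto> x / |x|\<close>.\<close>

definition S2 :: "(real ^ 3) measure" where
  "S2 = scale_measure 3
     (distr (restrict_space lborel (cball 0 1 - {0})) (restrict_space borel (sphere 0 1)) sgn)"

lemma space_S2: "space S2 = sphere 0 1"
  by (simp add: S2_def space_scale_measure space_restrict_space)

lemma sets_S2: "sets S2 = sets (restrict_space borel (sphere 0 1))"
  by (simp add: S2_def)

lemma sgn_measurable_S2:
  "sgn \<in> restrict_space lborel (cball 0 1 - {0}) \<rightarrow>\<^sub>M restrict_space borel (sphere (0 :: real ^ 3) 1)"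
proof (rule measurable_restrict_space2)
  show "sgn \<in> space (restrict_space lborel (cball 0 1 - {0 :: real ^ 3})) \<rightarrow> sphere 0 1"
    by (auto simp: space_restrict_space norm_sgn)
  have "(\<lambda>x :: real ^ 3. x /\<^sub>R norm x) \<in> borel_measurable lborel"
    by measurable
  then show "sgn \<in> borel_measurable (restrict_space lborel (cball 0 1 - {0 :: real ^ 3}))"
    by (intro measurable_restrict_space1) (simp add: sgn_div_norm[abs_def])
qed

lemma emeasure_S2:
  assumes "A \<in> sets S2"
  shows "emeasure S2 A = 3 * emeasure lborel {x \<in> cball 0 1 - {0}. sgn x \<in> A}"
proof -
  let ?B = "cball 0 1 - {0 :: real ^ 3}"
  have eq: "sgn -` A \<inter> ?B = {x \<in> ?B. sgn x \<in> A}"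
    by auto
  have A: "A \<in> sets (restrict_space borel (sphere 0 1))"
    using assms by (simp only: sets_S2)
  have "emeasure S2 A = 3 * emeasure (restrict_space lborel ?B) (sgn -` A \<inter> ?B)"
    unfolding S2_def using A sgn_measurable_S2
    by (simp only: emeasure_scale_measure emeasure_distr space_restrict_space space_lborel space_borel Int_UNIV_right)
  also have "emeasure (restrict_space lborel ?B) (sgn -` A \<inter> ?B) = emeasure lborel (sgn -` A \<inter> ?B)"
    by (rule emeasure_restrict_space) auto
  finally show ?thesis by (simp only: eq)
qed

lemma emeasure_S2_sphere: "emeasure S2 (sphere 0 1) = ennreal (4 * pi)"
proof -
  have eq: "{x \<in> cball 0 1 - {0 :: real ^ 3}. sgn x \<in> sphere 0 1} = cball 0 1 - {0}"
    by (auto simp: norm_sgn)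
  have "emeasure lborel (cball 0 1 - {0 :: real ^ 3}) = emeasure lborel (cball (0 :: real ^ 3) 1)"
    by (subst emeasure_Diff) auto
  also have "\<dots> = ennreal (4 / 3 * pi)"
    by (simp add: emeasure_cball unit_ball_vol_3)
  finally have "emeasure S2 (sphere 0 1) = 3 * ennreal (4 / 3 * pi)"
    using emeasure_S2[of "sphere 0 1"] sets.top[of S2] by (simp only: eq space_S2)
  also have "\<dots> = ennreal (3 * (4 / 3 * pi))"
    by (subst ennreal_mult) auto
  finally show ?thesis by simp
qed

text \<open>Elements of \<open>L\<^sup>1\<close> and \<open>L\<^sup>2\<close> are represented by measurable functions, not by classes modulo
  equality almost everywhere. Values off the sphere are irrelevant.\<close>

definition L2 :: "sphere_fun set" where
  "L2 = {f \<in> borel_measurable S2. integrable S2 (\<lambda>x. (f x)\<^sup>2)}"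

definition L2_norm :: "sphere_fun \<Rightarrow> real" where
  "L2_norm f = sqrt (LINT x|S2. (f x)\<^sup>2)"

definition L1_norm_on :: "(real ^ 3) set \<Rightarrow> sphere_fun \<Rightarrow> real" where
  "L1_norm_on A f = (LINT x:A|S2. \<bar>f x\<bar>)"

abbreviation L1_norm :: "sphere_fun \<Rightarrow> real" where
  "L1_norm \<equiv> L1_norm_on (sphere 0 1)"

definition Linf_norm :: "sphere_fun \<Rightarrow> ereal" where
  "Linf_norm f = esssup S2 (\<lambda>x. ereal \<bar>f x\<bar>)"

definition laplacian :: "sphere_fun \<Rightarrow> sphere_fun" where
  "laplacian p x = (\<Sum>b\<in>Basis. (deriv ^^ 2) (\<lambda>t. p (x + t *\<^sub>R b)) 0)"

definition spherical_harmonics :: "nat \<Rightarrow> sphere_fun set" where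
  "spherical_harmonics m = {restrict p (sphere 0 1) | p.
     real_polynomial_function p \<and> (\<forall>t x. p (t *\<^sub>R x) = t ^ m * p x) \<and> (\<forall>x. laplacian p x = 0)}"

text \<open>The description is unique among functions, not only almost everywhere: the members of
  \<open>spherical_harmonics m\<close> are continuous on the sphere and \<open>undefined\<close> off it.\<close>

definition harmonic_proj :: "nat \<Rightarrow> sphere_fun \<Rightarrow> sphere_fun" where
  "harmonic_proj m f = (THE h. h \<in> spherical_harmonics m \<and>
     (\<forall>g\<in>spherical_harmonics m. (LINT x|S2. (f x - h x) * g x) = 0))"

definition sobolev :: "real \<Rightarrow> sphere_fun set" where
  "sobolev p = {f \<in> L2. summable (\<lambda>m. (1 + real m) powr (2 * p) * (L2_norm (harmonic_proj m f))\<^sup>2)}"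

definition gradiometry :: "real \<Rightarrow> sphere_fun \<Rightarrow> sphere_fun" where
  "gradiometry R f x =
     (\<Sum>m. (real m + 1) * (real m + 2) / R ^ (m + 3) * harmonic_proj m f x)"

definition tikhonov :: "real \<Rightarrow> real \<Rightarrow> sphere_fun \<Rightarrow> sphere_fun \<Rightarrow> real" where
  "tikhonov R \<alpha> g f = 1 / \<alpha> * L1_norm (\<lambda>x. gradiometry R f x - g x) + (L2_norm f)\<^sup>2"

definition is_minimizer :: "real \<Rightarrow> real \<Rightarrow> sphere_fun \<Rightarrow> sphere_fun \<Rightarrow> bool" where
  "is_minimizer R \<alpha> g f \<longleftrightarrow> is_arg_min (tikhonov R \<alpha> g) (\<lambda>f. f \<in> L2) f"

definition impulsive_noise :: "real \<Rightarrow> real \<Rightarrow> sphere_fun \<Rightarrow> bool" where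
  "impulsive_noise \<epsilon> \<eta> \<xi> \<longleftrightarrow> integrable S2 \<xi> \<and>
     (\<exists>P\<in>sets S2. L1_norm_on (sphere 0 1 - P) \<xi> \<le> \<epsilon> \<and> measure S2 P \<le> \<eta>)"

definition gamma_fun :: "real \<Rightarrow> real \<Rightarrow> real \<Rightarrow> real" where
  "gamma_fun C\<^sub>\<gamma> R \<delta> = C\<^sub>\<gamma> * \<delta> powr (- 5 / 2) * R powr (- sqrt (4 * pi / \<delta>) - 4)"

definition log_rate :: "real \<Rightarrow> real \<Rightarrow> real" where
  "log_rate p t = (if t = 0 then 0 else (- ln t) powr (- 2 * p))"

text \<open>The limit \<open>\<eta>, \<epsilon> \<searrow> 0\<close> for pairs \<open>(\<eta>, \<epsilon>)\<close>, where \<open>\<eta> > 0\<close> but \<open>\<epsilon> = 0\<close> is allowed.\<close>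

definition noise_limit :: "(real \<times> real) filter" where
  "noise_limit = (at (0, 0) within {0<..} \<times> {0..})"

definition admissible_choice ::
  "(real \<Rightarrow> real) \<Rightarrow> real \<Rightarrow> (real \<Rightarrow> real \<Rightarrow> real) \<Rightarrow> bool" where
  "admissible_choice \<gamma> C\<^sub>e \<alpha> \<longleftrightarrow>
     (\<forall>\<eta> \<epsilon>. \<eta> > 0 \<longrightarrow> \<epsilon> \<ge> 0 \<longrightarrow> \<alpha> \<eta> \<epsilon> > 0) \<and>
     ((\<lambda>(\<eta>, \<epsilon>). \<alpha> \<eta> \<epsilon>) \<longlongrightarrow> 0) noise_limit \<and>
     (\<forall>\<^sub>F (\<eta>, \<epsilon>) in noise_limit.
        sqrt (2 * \<epsilon> / \<alpha> \<eta> \<epsilon>) + 2 * \<eta> * \<gamma> (2 * \<eta>) / \<alpha> \<eta> \<epsilon> \<le> C\<^sub>e)"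

end

theory Submission
  imports Defs "HOL-Library.Function_Algebras" "HOL-Real_Asymp.Real_Asymp"
begin

text \<open>Let \<open>h = f - f\<^sub>d\<close> for a minimizer \<open>f\<close>. Comparing the functional at \<open>f\<close> and \<open>f\<^sub>d\<close>, and bounding \<open>T h\<close> on the
  exceptional set by the \<open>L\<^sup>\<infinity>\<close> estimate with \<open>\<delta> = 3 \<eta>\<close>, gives
  \<open>|T h|\<^sub>1 / 3 + \<alpha> (|f|\<^sup>2 - |f\<^sub>d|\<^sup>2) \<le> 2 \<eta> \<gamma>(3 \<eta>) |h| + 2 \<epsilon>\<close>.
  Here \<open>|f|\<^sup>2 - |f\<^sub>d|\<^sup>2 = |h|\<^sup>2 + 2 \<langle>f\<^sub>d, h\<rangle>\<close>, and the inner product is split at a degree \<open>n\<close>: the low degrees are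
  controlled by \<open>|Q\<^sub>m h| \<le> R\<^sup>m\<^sup>+\<^sup>3 |T h|\<^sub>1\<close>, the high ones by the Sobolev tail of \<open>f\<^sub>d\<close>, which is of order
  \<open>n powr (- p)\<close>. With \<open>n\<close> proportional to \<open>- ln \<alpha>\<close> both error bounds follow from Young's inequality.

  The quantity \<open>\<eta> \<gamma>(3 \<eta>)\<close> is smaller, by any power of \<open>\<eta>\<close>, than \<open>s = \<eta> powr (- 3 / 2) * R powr (- sqrt (pi / \<eta>))\<close>.
  Hence \<open>\<alpha> = max s (\<epsilon> * (- ln \<epsilon>) powr (2 * p))\<close> yields the rates of the last part.

  The harmonic analysis rests on one identity for homogeneous polynomials \<open>F\<close>, \<open>G\<close> of degrees \<open>a\<close>, \<open>b\<close>, namely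
  \<open>\<integral> (G \<Delta>F - F \<Delta>G) = (a - b) (a + b + 1) \<integral> F G\<close> over the sphere, which follows from rotation invariance. It
  yields the orthogonality of harmonics of different degrees and, since polynomials restricted to the sphere
  are then sums of harmonics, their completeness in \<open>L\<^sup>2\<close>.\<close>

section \<open>Homogeneous polynomials and directional derivatives\<close>

text \<open>\<open>S2\<close> is defined through volumes of cones, so integration by parts on the
  sphere is obtained by differentiating the invariance under rotations. Functions are not identified
  almost everywhere, so projections must be unique pointwise; harmonics are therefore kept as
  homogeneous polynomials, for which a zero norm forces zero. The choice
  \<open>\<delta> = 3 * \<eta>\<close> meets two constraints. Doubling the integral over the
  exceptional set produces \<open>2 * \<eta> / \<delta>\<close> times the norm of
  \<open>T h\<close>, so absorption requires \<open>\<delta> > 2 * \<eta>\<close>; and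
  \<open>\<delta> < 4 * \<eta>\<close> makes the exponential in \<open>\<gamma>\<close> decay
  strictly faster than that in \<open>s\<close>. Up to polynomial factors \<open>T\<close> damps
  degree \<open>m\<close> like \<open>R powr (- m)\<close>, so recovering low degrees costs
  exponentially in the cutoff, and only a cutoff logarithmic in \<open>\<alpha>\<close> is
  affordable. In the parameter choice, \<open>- ln s\<close> is of order
  \<open>\<eta> powr (- 1 / 2)\<close>, which turns the logarithmic rate at \<open>s\<close> into
  \<open>\<eta> powr p\<close>, while the other entry bounds \<open>\<epsilon> / \<alpha>\<close> by
  the logarithmic rate at \<open>\<epsilon>\<close>.\<close>

definition dirderiv :: "'a::euclidean_space \<Rightarrow> ('a \<Rightarrow> real) \<Rightarrow> 'a \<Rightarrow> real" where
  "dirderiv v p x = frechet_derivative p (at x) v"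

lemma has_derivative_dirderiv:
  assumes "real_polynomial_function p"
  shows "(p has_derivative (\<lambda>v. dirderiv v p x)) (at x)"
  using differentiable_at_real_polynomial_function[OF assms, of x UNIV]
  unfolding dirderiv_def by (simp add: frechet_derivative_works)

lemma dirderiv_eqI: "(p has_derivative p') (at x) \<Longrightarrow> dirderiv v p x = p' v"
  unfolding dirderiv_def by (metis frechet_derivative_at)

lemma dirderiv_linear_comb:
  assumes "real_polynomial_function p"
  shows "dirderiv (a *\<^sub>R v + b *\<^sub>R w) p x = a * dirderiv v p x + b * dirderiv w p x"
proof -
  have l: "linear (\<lambda>v. dirderiv v p x)"
    using has_derivative_linear[OF has_derivative_dirderiv[OF assms]] .
  show ?thesis by (simp add: linear_add[OF l] linear_scale[OF l])
qed

lemma dirderiv_add: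
  assumes "real_polynomial_function p" "real_polynomial_function q"
  shows "dirderiv v (\<lambda>x. p x + q x) x = dirderiv v p x + dirderiv v q x"
  by (rule dirderiv_eqI[OF has_derivative_add[OF assms[THEN has_derivative_dirderiv]]])

lemma dirderiv_diff:
  assumes "real_polynomial_function p" "real_polynomial_function q"
  shows "dirderiv v (\<lambda>x. p x - q x) x = dirderiv v p x - dirderiv v q x"
  by (rule dirderiv_eqI[OF has_derivative_diff[OF assms[THEN has_derivative_dirderiv]]])

lemma dirderiv_mult:
  assumes "real_polynomial_function p" "real_polynomial_function q"
  shows "dirderiv v (\<lambda>x. p x * q x) x = p x * dirderiv v q x + dirderiv v p x * q x"
  by (rule dirderiv_eqI[OF has_derivative_mult[OF assms[THEN has_derivative_dirderiv]]])

lemma dirderiv_const [simp]: "dirderiv v (\<lambda>x. c) x = 0"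
  by (rule dirderiv_eqI) (rule has_derivative_const)

lemma dirderiv_bounded_linear: "bounded_linear f \<Longrightarrow> dirderiv v f x = f v"
  by (rule dirderiv_eqI) (rule bounded_linear_imp_has_derivative)

lemma dirderiv_inner [simp]: "dirderiv v (\<lambda>x. x \<bullet> b) x = v \<bullet> b"
  by (rule dirderiv_bounded_linear) (rule bounded_linear_inner_left)

lemma dirderiv_cmult:
  assumes "real_polynomial_function p"
  shows "dirderiv v (\<lambda>x. c * p x) x = c * dirderiv v p x"
  using dirderiv_mult[OF real_polynomial_function.intros(2) assms, of v c x] by simp

lemma real_polynomial_function_dirderiv [intro]:
  assumes "real_polynomial_function p"
  shows "real_polynomial_function (dirderiv v p)"
  using assms
proof (induction p rule: real_polynomial_function.induct)
  case (linear f)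
  then have "dirderiv v f = (\<lambda>x. f v)" by (simp add: fun_eq_iff dirderiv_bounded_linear)
  then show ?case by auto
next
  case (const c)
  have "dirderiv v (\<lambda>x. c) = (\<lambda>x. 0)" by (simp add: fun_eq_iff)
  then show ?case by auto
next
  case (add f g)
  then have "dirderiv v (\<lambda>x. f x + g x) = (\<lambda>x. dirderiv v f x + dirderiv v g x)"
    by (simp add: fun_eq_iff dirderiv_add)
  then show ?case using add by auto
next
  case (mult f g)
  then have "dirderiv v (\<lambda>x. f x * g x) = (\<lambda>x. f x * dirderiv v g x + dirderiv v f x * g x)"
    by (simp add: fun_eq_iff dirderiv_mult)
  then show ?case using mult by auto
qed

lemma DERIV_along_line:
  assumes "real_polynomial_function p"
  shows "((\<lambda>t. p (x + t *\<^sub>R v)) has_real_derivative dirderiv v p (x + t *\<^sub>R v)) (at t)"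
proof -
  have "((\<lambda>t. x + t *\<^sub>R v) has_derivative (\<lambda>s. s *\<^sub>R v)) (at t)"
    by (auto intro!: derivative_eq_intros)
  from has_derivative_compose[OF this has_derivative_dirderiv[OF assms]]
  have "((\<lambda>t. p (x + t *\<^sub>R v)) has_derivative (\<lambda>s. dirderiv (s *\<^sub>R v) p (x + t *\<^sub>R v))) (at t)" .
  moreover have "dirderiv (s *\<^sub>R v) p y = dirderiv v p y * s" for s y
    using dirderiv_linear_comb[OF assms, of s v 0 0 y] by simp
  ultimately show ?thesis by (simp add: has_field_derivative_def)
qed

text \<open>Built from Frechet derivatives, so that sum and product rules are at hand; on
  polynomials it agrees with the iterated one-variable derivatives in
  \<open>laplacian\<close>.\<close>

definition lap :: "('a::euclidean_space \<Rightarrow> real) \<Rightarrow> 'a \<Rightarrow> real" where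
  "lap p x = (\<Sum>b\<in>Basis. dirderiv b (dirderiv b p) x)"

lemma laplacian_eq_lap:
  assumes "real_polynomial_function p"
  shows "laplacian p x = lap p x"
proof -
  have "(deriv ^^ 2) (\<lambda>t. p (x + t *\<^sub>R b)) 0 = dirderiv b (dirderiv b p) x" for b
  proof -
    have "deriv (\<lambda>t. p (x + t *\<^sub>R b)) = (\<lambda>t. dirderiv b p (x + t *\<^sub>R b))"
      by (rule ext) (rule DERIV_imp_deriv[OF DERIV_along_line[OF assms]])
    moreover have "deriv (\<lambda>t. dirderiv b p (x + t *\<^sub>R b)) 0 = dirderiv b (dirderiv b p) x"
      using DERIV_imp_deriv[OF DERIV_along_line[OF real_polynomial_function_dirderiv[OF assms, of b], of x b 0]]
      by simp
    ultimately show ?thesis by (simp add: numeral_2_eq_2)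
  qed
  then show ?thesis by (simp add: laplacian_def lap_def)
qed

lemma real_polynomial_function_lap [intro]:
  "real_polynomial_function p \<Longrightarrow> real_polynomial_function (lap p)"
  unfolding lap_def[abs_def]
  by (intro real_polynomial_function_sum real_polynomial_function_dirderiv) auto

lemma lap_add:
  assumes "real_polynomial_function p" "real_polynomial_function q"
  shows "lap (\<lambda>x. p x + q x) x = lap p x + lap q x"
proof -
  have "dirderiv b (\<lambda>x. p x + q x) = (\<lambda>x. dirderiv b p x + dirderiv b q x)" for b
    using assms by (simp add: fun_eq_iff dirderiv_add)
  then show ?thesis
    using assms by (simp add: lap_def dirderiv_add real_polynomial_function_dirderiv sum.distrib)
qed

lemma lap_cmult:
  assumes "real_polynomial_function p"
  shows "lap (\<lambda>x. c * p x) x = c * lap p x"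
proof -
  have "dirderiv b (\<lambda>x. c * p x) = (\<lambda>x. c * dirderiv b p x)" for b
    using assms by (simp add: fun_eq_iff dirderiv_cmult)
  then show ?thesis
    using assms by (simp add: lap_def dirderiv_cmult real_polynomial_function_dirderiv sum_distrib_left)
qed

definition hom_poly :: "nat \<Rightarrow> ('a::euclidean_space \<Rightarrow> real) set" where
  "hom_poly m = {p. real_polynomial_function p \<and> (\<forall>t x. p (t *\<^sub>R x) = t ^ m * p x)}"

lemma hom_polyD:
  assumes "p \<in> hom_poly m"
  shows "real_polynomial_function p" "p (t *\<^sub>R x) = t ^ m * p x"
  using assms by (auto simp: hom_poly_def)

lemma hom_poly_zero [simp]: "(\<lambda>x. 0) \<in> hom_poly m"
  by (auto simp: hom_poly_def)

lemma hom_poly_add: "p \<in> hom_poly m \<Longrightarrow> q \<in> hom_poly m \<Longrightarrow> (\<lambda>x. p x + q x) \<in> hom_poly m"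
  by (auto simp: hom_poly_def algebra_simps)

lemma hom_poly_cmult: "p \<in> hom_poly m \<Longrightarrow> (\<lambda>x. c * p x) \<in> hom_poly m"
  by (auto simp: hom_poly_def)

lemma hom_poly_diff: "p \<in> hom_poly m \<Longrightarrow> q \<in> hom_poly m \<Longrightarrow> (\<lambda>x. p x - q x) \<in> hom_poly m"
  by (auto simp: hom_poly_def algebra_simps)

lemma hom_poly_sum:
  "(\<And>i. i \<in> I \<Longrightarrow> p i \<in> hom_poly m) \<Longrightarrow> (\<lambda>x. \<Sum>i\<in>I. p i x) \<in> hom_poly m"
  by (induction I rule: infinite_finite_induct) (auto intro: hom_poly_add)

lemma hom_poly_mult: "p \<in> hom_poly m \<Longrightarrow> q \<in> hom_poly n \<Longrightarrow> (\<lambda>x. p x * q x) \<in> hom_poly (m + n)"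
  by (auto simp: hom_poly_def power_add)

lemma hom_poly_inner: "(\<lambda>x. x \<bullet> b) \<in> hom_poly 1"
  by (auto simp: hom_poly_def intro!: real_polynomial_function.intros(1) bounded_linear_inner_left)

text \<open>Homogeneity also holds at \<open>t = 0\<close>, where \<open>0 ^ 0 = 1\<close>.\<close>

lemma hom_poly_0_const: "p \<in> hom_poly 0 \<Longrightarrow> p = (\<lambda>x. p 0)"
  by (rule ext) (metis hom_polyD(2) mult_1 power_0 scaleR_zero_left)

lemma continuous_on_real_polynomial_function:
  "real_polynomial_function p \<Longrightarrow> continuous_on S p"
  by (simp add: real_polynomial_function_eq continuous_on_polymonial_function)

text \<open>For \<open>m = 0\<close> the derivative vanishes, so the truncated degree \<open>m - 1 = 0\<close> is harmless.\<close>

lemma hom_poly_dirderiv: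
  assumes p: "p \<in> hom_poly m"
  shows "dirderiv v p \<in> hom_poly (m - 1)"
proof (cases m)
  case 0
  then have "p = (\<lambda>x. p 0)" using hom_poly_0_const p by blast
  then have "dirderiv v p = (\<lambda>x. 0)" by (metis dirderiv_const)
  then show ?thesis by simp
next
  case (Suc n)
  note rp = hom_polyD(1)[OF p]
  \<comment> \<open>Base point and direction are scaled together: linearity in the direction takes
    one factor \<open>t\<close> out of \<open>t ^ m\<close>, which lowers the degree by one.\<close>
  have nz: "dirderiv v p (t *\<^sub>R x) = t ^ n * dirderiv v p x" if "t \<noteq> 0" for t x
  proof -
    have "((\<lambda>s. p (t *\<^sub>R x + s *\<^sub>R (t *\<^sub>R v))) has_real_derivative dirderiv (t *\<^sub>R v) p (t *\<^sub>R x)) (at 0)"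
      using DERIV_along_line[OF rp, of "t *\<^sub>R x" "t *\<^sub>R v" 0] by simp
    moreover have "(\<lambda>s. p (t *\<^sub>R x + s *\<^sub>R (t *\<^sub>R v))) = (\<lambda>s. t ^ m * p (x + s *\<^sub>R v))"
    proof
      fix s
      have "t *\<^sub>R x + s *\<^sub>R (t *\<^sub>R v) = t *\<^sub>R (x + s *\<^sub>R v)"
        by (simp add: scaleR_add_right)
      then show "p (t *\<^sub>R x + s *\<^sub>R (t *\<^sub>R v)) = t ^ m * p (x + s *\<^sub>R v)"
        by (simp only: hom_polyD(2)[OF p])
    qed
    moreover have "((\<lambda>s. t ^ m * p (x + s *\<^sub>R v)) has_real_derivative t ^ m * dirderiv v p x) (at 0)"
      using DERIV_cmult[OF DERIV_along_line[OF rp, of x v 0], of "t ^ m"] by simp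
    ultimately have "dirderiv (t *\<^sub>R v) p (t *\<^sub>R x) = t ^ m * dirderiv v p x"
      using DERIV_unique by metis
    moreover have "dirderiv (t *\<^sub>R v) p (t *\<^sub>R x) = t * dirderiv v p (t *\<^sub>R x)"
      using dirderiv_linear_comb[OF rp, of t v 0 0 "t *\<^sub>R x"] by simp
    ultimately show ?thesis using that Suc by simp
  qed
  have "dirderiv v p (t *\<^sub>R x) = t ^ n * dirderiv v p x" for t x
  proof (cases "t = 0")
    case True
    \<comment> \<open>Dividing by \<open>t\<close> is impossible here. Both sides are continuous in
      \<open>t\<close> and agree for \<open>t \<noteq> 0\<close>.\<close>
    have c: "continuous_on UNIV (dirderiv v p)"
      using rp by (intro continuous_on_real_polynomial_function) auto
    have "isCont (\<lambda>t. dirderiv v p (t *\<^sub>R x) - t ^ n * dirderiv v p x) 0"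
      using continuous_on_compose2[OF c, of UNIV "\<lambda>t. t *\<^sub>R x"]
      by (intro continuous_intros) (simp add: continuous_on_eq_continuous_at continuous_intros)
    then have "((\<lambda>t. dirderiv v p (t *\<^sub>R x) - t ^ n * dirderiv v p x) \<longlongrightarrow> dirderiv v p (0 *\<^sub>R x) - 0 ^ n * dirderiv v p x) (at 0)"
      unfolding isCont_def by simp
    moreover have "((\<lambda>t::real. 0::real) \<longlongrightarrow> dirderiv v p (0 *\<^sub>R x) - 0 ^ n * dirderiv v p x) (at 0)"
      by (rule Lim_transform_eventually[OF calculation]) (auto simp: eventually_at_filter nz)
    then have "dirderiv v p (0 *\<^sub>R x) - 0 ^ n * dirderiv v p x = 0"
      by (simp add: tendsto_const_iff)
    then show ?thesis using True by simp
  qed (rule nz)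
  then show ?thesis using rp Suc by (auto simp: hom_poly_def)
qed

lemma euler_homogeneous:
  assumes p: "p \<in> hom_poly m"
  shows "dirderiv x p x = real m * p x"
proof -
  have "((\<lambda>t. p (x + t *\<^sub>R x)) has_real_derivative dirderiv x p x) (at 0)"
    using DERIV_along_line[OF hom_polyD(1)[OF p], of x x 0] by simp
  moreover have "(\<lambda>t. p (x + t *\<^sub>R x)) = (\<lambda>t. (1 + t) ^ m * p x)"
    using hom_polyD(2)[OF p, of _ x] by (metis scaleR_add_left scaleR_one)
  moreover have "((\<lambda>t. (1 + t) ^ m * p x) has_real_derivative real m * p x) (at 0)"
    by (auto intro!: derivative_eq_intros)
  ultimately show ?thesis using DERIV_unique by metis
qed

lemma dirderiv_euclidean:
  assumes "real_polynomial_function p"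
  shows "dirderiv v p x = (\<Sum>b\<in>Basis. (v \<bullet> b) * dirderiv b p x)"
proof -
  have l: "linear (\<lambda>v. dirderiv v p x)"
    using has_derivative_linear[OF has_derivative_dirderiv[OF assms]] .
  have "dirderiv (\<Sum>b\<in>Basis. (v \<bullet> b) *\<^sub>R b) p x = (\<Sum>b\<in>Basis. (v \<bullet> b) * dirderiv b p x)"
    by (simp add: linear_sum[OF l] linear_scale[OF l])
  then show ?thesis by (simp add: euclidean_representation)
qed

text \<open>For \<open>m < 2\<close> the truncated degree \<open>m - 2\<close> is 0, which is
  harmless because \<open>lap p\<close> then vanishes.\<close>

lemma hom_poly_lap: "p \<in> hom_poly m \<Longrightarrow> lap p \<in> hom_poly (m - 2)"
  unfolding lap_def[abs_def] numeral_2_eq_2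
  using hom_poly_dirderiv[of "dirderiv _ p" "m - 1"] hom_poly_dirderiv[of p m]
  by (intro hom_poly_sum) simp

lemma lap_eq_0:
  assumes p: "p \<in> hom_poly m" and "m < 2"
  shows "lap p x = 0"
proof -
  have "dirderiv b p \<in> hom_poly 0" for b
    using hom_poly_dirderiv[OF p, of b] \<open>m < 2\<close> by (cases m) auto
  then have "dirderiv b p = (\<lambda>x. dirderiv b p 0)" for b
    by (rule hom_poly_0_const)
  then have "dirderiv b (dirderiv b p) x = 0" for b
    by (metis dirderiv_const)
  then show ?thesis by (simp add: lap_def)
qed

lemma hom_poly_eq_0_if_sphere:
  assumes p: "p \<in> hom_poly m" and z: "\<And>x. norm x = 1 \<Longrightarrow> p x = 0"
  shows "p x = 0"
proof (cases "x = 0")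
  case False
  have "p x = norm x ^ m * p (sgn x)"
    using hom_polyD(2)[OF p, of "norm x" "sgn x"] False by (simp add: sgn_div_norm)
  then show ?thesis using z[of "sgn x"] False by (simp add: norm_sgn)
next
  case True
  \<comment> \<open>The value at 0 is compared with that at a unit vector:
    \<open>p 0 = 0 ^ m * p b\<close>, which also covers \<open>m = 0\<close>.\<close>
  obtain b :: 'a where "b \<in> Basis" using nonempty_Basis by blast
  then have "p b = 0" using z by simp
  then show ?thesis using hom_polyD(2)[OF p, of 0 b] True by simp
qed

lemma hom_poly_orthogonal:
  assumes p: "p \<in> hom_poly m" and A: "orthogonal_transformation A"
  shows "(\<lambda>x. p (A x)) \<in> hom_poly m"
proof -
  have l: "linear A" using A by (rule orthogonal_transformation_linear)
  have "polynomial_function A" using l by (simp add: linear_conv_bounded_linear polynomial_function_bounded_linear)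
  then have "real_polynomial_function (\<lambda>x. p (A x))"
    using real_polynomial_function_compose[OF _ hom_polyD(1)[OF p]] by (simp add: comp_def)
  then show ?thesis using hom_polyD(2)[OF p] by (simp add: hom_poly_def linear_scale[OF l])
qed

section \<open>Rotation invariance of the surface measure\<close>

text \<open>\<open>lborel\<close> is determined by its values on boxes, and the preimage of a box is
  its image under \<open>inv A\<close>, to which the invariance of Lebesgue measure under orthogonal
  images applies.\<close>

lemma emeasure_lborel_orthogonal_vimage:
  fixes A :: "real ^ 'n::{finite, wellorder} \<Rightarrow> real ^ 'n::_"
  assumes A: "orthogonal_transformation A" and X: "X \<in> sets borel"
  shows "emeasure lborel (A -` X) = emeasure lborel X"
proof -
  have lin: "linear A" using A by (rule orthogonal_transformation_linear)
  have cont: "continuous_on UNIV A" using lin by (simp add: linear_continuous_on linear_conv_bounded_linear)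
  have meas [measurable]: "A \<in> borel \<rightarrow>\<^sub>M borel" using cont by (rule borel_measurable_continuous_onI)
  have "lborel = distr lborel borel A"
  proof (rule lborel_eqI)
    fix l u :: "real ^ 'n::_" assume le: "\<And>b. b \<in> Basis \<Longrightarrow> l \<bullet> b \<le> u \<bullet> b"
    have inv: "orthogonal_transformation (inv A)" using A by (rule orthogonal_transformation_inv)
    have vi: "A -` S = inv A ` S" for S
      using bij_vimage_eq_inv_image[OF orthogonal_transformation_bij[OF A]] .
    have lm: "A -` box l u \<in> lmeasurable"
      unfolding vi by (rule measurable_orthogonal_image[OF inv]) simp
    have "emeasure (distr lborel borel A) (box l u) = emeasure lborel (A -` box l u)"
      by (simp add: emeasure_distr)
    also have "\<dots> = emeasure lebesgue (A -` box l u)"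
      using measurable_sets[OF meas, of "box l u"] by simp
    also have "\<dots> = ennreal (measure lebesgue (A -` box l u))"
      using lm by (simp add: emeasure_eq_measure2)
    also have "measure lebesgue (A -` box l u) = measure lebesgue (box l u)"
      unfolding vi by (rule measure_orthogonal_image[OF inv]) simp
    also have "ennreal \<dots> = emeasure lborel (box l u)"
      using le by (auto simp: emeasure_lborel_box_eq measure_completion emeasure_eq_ennreal_measure)
    finally show "emeasure (distr lborel borel A) (box l u) = (\<Prod>b\<in>Basis. (u - l) \<bullet> b)"
      using le by (simp add: emeasure_lborel_box)
  qed simp
  then have "emeasure lborel X = emeasure (distr lborel borel A) X" by simp
  then show ?thesis using X by (simp add: emeasure_distr)
qed

lemma orthogonal_measurable_S2:
  assumes A: "orthogonal_transformation A"
  shows "A \<in> S2 \<rightarrow>\<^sub>M S2"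
proof -
  have lin: "linear A" using A by (rule orthogonal_transformation_linear)
  have "A \<in> borel \<rightarrow>\<^sub>M borel"
    using lin by (intro borel_measurable_continuous_onI) (simp add: linear_continuous_on linear_conv_bounded_linear)
  then have "A \<in> restrict_space borel (sphere 0 1) \<rightarrow>\<^sub>M restrict_space borel (sphere 0 1)"
    by (intro measurable_restrict_space3) (auto simp: orthogonal_transformation_norm[OF A])
  then show ?thesis
    by (simp cong: measurable_cong_sets add: sets_S2)
qed

text \<open>Since \<open>sgn\<close> commutes with \<open>A\<close>, the cone over a preimage is the
  preimage of the cone, so the invariance of volume carries over to \<open>S2\<close>.\<close>

lemma distr_S2_orthogonal:
  assumes A: "orthogonal_transformation A"
  shows "distr S2 S2 A = S2"
proof (rule measure_eqI)
  fix E assume E: "E \<in> sets (distr S2 S2 A)"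
  then have E: "E \<in> sets S2" by simp
  note AM = orthogonal_measurable_S2[OF A]
  have sg: "sgn (A x) = A (sgn x)" for x
    using A by (simp add: sgn_div_norm orthogonal_transformation_norm orthogonal_transformation_scaleR)
  have A0: "A x = 0 \<longleftrightarrow> x = 0" for x
    using orthogonal_transformation_norm[OF A, of x] by auto
  have vim: "A -` E \<inter> space S2 \<in> sets S2" using AM E by (rule measurable_sets)
  have EB: "E \<in> sets borel" and Es: "E \<subseteq> sphere 0 1"
    using E by (auto simp: sets_S2 sets_restrict_space)
  have [measurable]: "(sgn :: real ^ 3 \<Rightarrow> real ^ 3) \<in> borel_measurable borel"
    by (simp add: sgn_div_norm[abs_def])
  have B: "{x \<in> cball 0 1 - {0}. sgn x \<in> E} \<in> sets borel"
    using EB by measurable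
  have "emeasure (distr S2 S2 A) E = emeasure S2 (A -` E \<inter> space S2)"
    using AM E by (simp add: emeasure_distr)
  also have "\<dots> = 3 * emeasure lborel {x \<in> cball 0 1 - {0}. sgn x \<in> A -` E \<inter> space S2}"
    using vim by (rule emeasure_S2)
  also have "{x \<in> cball 0 1 - {0}. sgn x \<in> A -` E \<inter> space S2} = A -` {x \<in> cball 0 1 - {0}. sgn x \<in> E}"
    by (auto simp: sg A0 orthogonal_transformation_norm[OF A] space_S2 norm_sgn)
  also have "emeasure lborel \<dots> = emeasure lborel {x \<in> cball 0 1 - {0}. sgn x \<in> E}"
    using A B by (rule emeasure_lborel_orthogonal_vimage)
  also have "3 * \<dots> = emeasure S2 E" using E by (simp add: emeasure_S2)
  finally show "emeasure (distr S2 S2 A) E = emeasure S2 E" .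
qed simp

lemma integral_S2_orthogonal:
  fixes f :: "real ^ 3 \<Rightarrow> real"
  assumes A: "orthogonal_transformation A" and f: "f \<in> borel_measurable S2"
  shows "(LINT x|S2. f (A x)) = (LINT x|S2. f x)"
  using integral_distr[OF orthogonal_measurable_S2[OF A] f] by (simp add: distr_S2_orthogonal[OF A])

interpretation S2: finite_measure S2
  by standard (simp add: space_S2 emeasure_S2_sphere)

lemma measure_S2_sphere: "measure S2 (sphere 0 1) = 4 * pi"
  by (simp add: measure_def emeasure_S2_sphere)

lemma borel_measurable_S2_continuous:
  fixes f :: "real ^ 3 \<Rightarrow> real"
  assumes "continuous_on (sphere 0 1) f"
  shows "f \<in> borel_measurable S2"
  using borel_measurable_continuous_on_restrict[OF assms]
  by (simp cong: measurable_cong_sets add: sets_S2)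

lemma continuous_bounded_on_sphere:
  fixes f :: "real ^ 3 \<Rightarrow> real"
  assumes "continuous_on (sphere 0 1) f"
  obtains K where "K \<ge> 0" "\<And>x. norm x = 1 \<Longrightarrow> \<bar>f x\<bar> \<le> K"
proof -
  have "compact (f ` sphere 0 1)" by (rule compact_continuous_image[OF assms compact_sphere])
  then have "bounded (f ` sphere 0 1)" by (rule compact_imp_bounded)
  then obtain K where "K > 0" "\<forall>y \<in> f ` sphere 0 1. norm y \<le> K" unfolding bounded_pos by blast
  then show ?thesis by (intro that[of K]) auto
qed

lemma integrable_S2_continuous:
  fixes f :: "real ^ 3 \<Rightarrow> real"
  assumes "continuous_on (sphere 0 1) f"
  shows "integrable S2 f"
proof -
  obtain K where "\<And>x. norm x = 1 \<Longrightarrow> \<bar>f x\<bar> \<le> K" using continuous_bounded_on_sphere[OF assms] by blast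
  then show ?thesis
    by (intro S2.integrable_const_bound[where B = K] borel_measurable_S2_continuous assms)
      (auto intro!: AE_I2 simp: space_S2)
qed

lemma integrable_S2_polynomial: "real_polynomial_function p \<Longrightarrow> integrable S2 p"
  by (intro integrable_S2_continuous continuous_on_real_polynomial_function)

section \<open>Infinitesimal rotations and Green's formula on the sphere\<close>

text \<open>Rotation by the angle \<open>t\<close> in the plane of \<open>b\<close> and
  \<open>c\<close>, written as the identity plus a correction so that the third axis need not be
  named.\<close>

definition plane_rot :: "real ^ 3 \<Rightarrow> real ^ 3 \<Rightarrow> real \<Rightarrow> real ^ 3 \<Rightarrow> real ^ 3" where
  "plane_rot b c t x = x + ((x \<bullet> b) * (cos t - 1) - (x \<bullet> c) * sin t) *\<^sub>R b
     + ((x \<bullet> b) * sin t + (x \<bullet> c) * (cos t - 1)) *\<^sub>R c"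

lemma plane_rot_0 [simp]: "plane_rot b c 0 x = x"
  by (simp add: plane_rot_def)

lemma
  assumes "b \<in> Basis" "c \<in> Basis" "b \<noteq> c"
  shows inner_plane_rot_1: "plane_rot b c t x \<bullet> b = (x \<bullet> b) * cos t - (x \<bullet> c) * sin t"
    and inner_plane_rot_2: "plane_rot b c t x \<bullet> c = (x \<bullet> b) * sin t + (x \<bullet> c) * cos t"
  using assms by (simp_all add: plane_rot_def inner_add_left inner_Basis algebra_simps)

lemma orthogonal_plane_rot:
  assumes "b \<in> Basis" "c \<in> Basis" "b \<noteq> c"
  shows "orthogonal_transformation (plane_rot b c t)"
  unfolding orthogonal_transformation
proof (intro conjI allI)
  show "linear (plane_rot b c t)"
    by (rule linearI) (simp_all add: plane_rot_def inner_add_left algebra_simps)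
  fix x
  define p q where "p = (x \<bullet> b) * (cos t - 1) - (x \<bullet> c) * sin t"
    and "q = (x \<bullet> b) * sin t + (x \<bullet> c) * (cos t - 1)"
  have bc: "b \<bullet> b = 1" "c \<bullet> c = 1" "b \<bullet> c = 0" "c \<bullet> b = 0" using assms by (auto simp: inner_Basis)
  have "plane_rot b c t x \<bullet> plane_rot b c t x = x \<bullet> x + (p\<^sup>2 + q\<^sup>2 + 2 * p * (x \<bullet> b) + 2 * q * (x \<bullet> c))"
    unfolding plane_rot_def p_def[symmetric] q_def[symmetric]
    by (simp add: inner_add_left inner_add_right bc inner_commute power2_eq_square algebra_simps)
  also have "p\<^sup>2 + q\<^sup>2 + 2 * p * (x \<bullet> b) + 2 * q * (x \<bullet> c) = ((x \<bullet> b)\<^sup>2 + (x \<bullet> c)\<^sup>2) * ((sin t)\<^sup>2 + (cos t)\<^sup>2 - 1)"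
    unfolding p_def q_def power2_eq_square by algebra
  finally show "norm (plane_rot b c t x) = norm x" by (simp add: norm_eq_sqrt_inner)
qed

text \<open>The generator of \<open>plane_rot b c\<close>, i.e. the angular momentum operator
  without its imaginary factor. It differentiates tangentially to the sphere.\<close>

definition ang_deriv :: "'a::euclidean_space \<Rightarrow> 'a \<Rightarrow> ('a \<Rightarrow> real) \<Rightarrow> 'a \<Rightarrow> real" where
  "ang_deriv b c p x = (x \<bullet> b) * dirderiv c p x - (x \<bullet> c) * dirderiv b p x"

lemma real_polynomial_function_inner [intro]: "real_polynomial_function (\<lambda>x. x \<bullet> b)"
  by (intro real_polynomial_function.intros(1) bounded_linear_inner_left)

lemma real_polynomial_function_ang_deriv [intro]:
  "real_polynomial_function p \<Longrightarrow> real_polynomial_function (ang_deriv b c p)"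
  unfolding ang_deriv_def[abs_def]
  by (intro real_polynomial_function_diff real_polynomial_function.intros(4)
      real_polynomial_function_inner real_polynomial_function_dirderiv)

text \<open>The derivative is wanted at every angle and not only at 0, since the mean value theorem
  is applied between 0 and a positive angle.\<close>

lemma DERIV_plane_rot:
  assumes "b \<in> Basis" "c \<in> Basis" "b \<noteq> c" and p: "real_polynomial_function p"
  shows "((\<lambda>t. p (plane_rot b c t x)) has_real_derivative ang_deriv b c p (plane_rot b c t x)) (at t)"
proof -
  let ?y = "plane_rot b c t x"
  have "((\<lambda>t. plane_rot b c t x) has_derivative (\<lambda>s. (s * (?y \<bullet> b)) *\<^sub>R c + (- (s * (?y \<bullet> c))) *\<^sub>R b)) (at t)"
    unfolding inner_plane_rot_1[OF assms(1-3)] inner_plane_rot_2[OF assms(1-3)] unfolding plane_rot_def[abs_def]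
    by (auto intro!: derivative_eq_intros simp: algebra_simps)
  from has_derivative_compose[OF this has_derivative_dirderiv[OF p]]
  have "((\<lambda>t. p (plane_rot b c t x)) has_derivative
      (\<lambda>s. dirderiv ((s * (?y \<bullet> b)) *\<^sub>R c + (- (s * (?y \<bullet> c))) *\<^sub>R b) p ?y)) (at t)" .
  moreover have "(\<lambda>s. dirderiv ((s * (?y \<bullet> b)) *\<^sub>R c + (- (s * (?y \<bullet> c))) *\<^sub>R b) p ?y) = (*) (ang_deriv b c p ?y)"
    by (rule ext) (simp only: dirderiv_linear_comb[OF p], simp add: ang_deriv_def algebra_simps)
  ultimately show ?thesis by (simp add: has_field_derivative_def)
qed

text \<open>The integral of \<open>p\<close> composed with a rotation does not depend on the angle,
  and its derivative at angle 0 is the integral in question. Dominated convergence justifies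
  differentiating under the integral.\<close>

lemma integral_ang_deriv:
  assumes bc: "b \<in> Basis" "c \<in> Basis" and p: "real_polynomial_function p"
  shows "(LINT x|S2. ang_deriv b c p x) = 0"
proof (cases "b = c")
  case True
  then show ?thesis by (simp add: ang_deriv_def)
next
  case False
  note bc = bc False
  let ?L = "ang_deriv b c p"
  define t where "t n = 1 / real (Suc n)" for n
  have t: "t n > 0" for n by (simp add: t_def)
  have rL: "real_polynomial_function ?L" using p by auto
  obtain K where K: "\<And>x. norm x = 1 \<Longrightarrow> \<bar>?L x\<bar> \<le> K"
    using continuous_bounded_on_sphere[OF continuous_on_real_polynomial_function[OF rL]] by blast
  note rot = orthogonal_plane_rot[OF bc]
  define s where "s n x = (p (plane_rot b c (t n) x) - p x) / t n" for n x
  have mp: "p \<in> borel_measurable S2" "?L \<in> borel_measurable S2"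
    using p rL by (auto intro: borel_measurable_S2_continuous continuous_on_real_polynomial_function)
  have mr: "(\<lambda>x. p (plane_rot b c \<tau> x)) \<in> borel_measurable S2" for \<tau>
    using measurable_compose[OF orthogonal_measurable_S2[OF rot] mp(1)] .
  have ip: "integrable S2 p" using p by (rule integrable_S2_polynomial)
  have ir: "integrable S2 (\<lambda>x. p (plane_rot b c \<tau> x))" for \<tau>
    using ip integrable_distr[OF orthogonal_measurable_S2[OF rot]] by (metis distr_S2_orthogonal[OF rot])
  have "(\<lambda>n. LINT x|S2. s n x) \<longlonglongrightarrow> (LINT x|S2. ?L x)"
  proof (rule integral_dominated_convergence[where w = "\<lambda>_. K"])
    show "?L \<in> borel_measurable S2" by (rule mp)
    show "s n \<in> borel_measurable S2" for n
      unfolding s_def[abs_def] using mp(1) mr[of "t n"] by measurable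
    show "integrable S2 (\<lambda>_. K)" by simp
    show "AE x in S2. (\<lambda>n. s n x) \<longlonglongrightarrow> ?L x"
    proof (rule AE_I2)
      fix x
      have "((\<lambda>h. (p (plane_rot b c h x) - p x) / h) \<longlongrightarrow> ?L x) (at 0)"
        using DERIV_plane_rot[OF bc p, of x 0] by (simp add: DERIV_def)
      moreover have "filterlim t (at 0) sequentially"
        unfolding filterlim_at t_def using LIMSEQ_inverse_real_of_nat
        by (auto simp: inverse_eq_divide)
      ultimately show "(\<lambda>n. s n x) \<longlonglongrightarrow> ?L x"
        unfolding s_def by (rule filterlim_compose)
    qed
    show "AE x in S2. norm (s n x) \<le> K" for n
    proof (rule AE_I2)
      fix x assume x: "x \<in> space S2"
      \<comment> \<open>A difference quotient equals \<open>?L\<close> at a rotated point, which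
        lies again on the sphere; so the bound \<open>K\<close> of \<open>?L\<close> there dominates
        all quotients.\<close>
      obtain z where "p (plane_rot b c (t n) x) - p (plane_rot b c 0 x) = (t n - 0) * ?L (plane_rot b c z x)"
        using MVT2[OF t, of n "\<lambda>t. p (plane_rot b c t x)" "\<lambda>t. ?L (plane_rot b c t x)"]
          DERIV_plane_rot[OF bc p] by blast
      then have "s n x = ?L (plane_rot b c z x)" using t[of n] by (simp add: s_def)
      then show "norm (s n x) \<le> K"
        using K x by (simp add: space_S2 orthogonal_transformation_norm[OF rot])
    qed
  qed
  moreover have "(LINT x|S2. s n x) = 0" for n
    unfolding s_def using ir ip integral_S2_orthogonal[OF rot mp(1)] by simp
  ultimately show ?thesis by (simp add: LIMSEQ_const_iff)
qed

text \<open>The divergence theorem on the ball for the field \<open>\<lambda>x. V x *\<^sub>R b\<close>, with the radial integration carried out.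
  It is obtained by summing \<open>ang_deriv b c (\<lambda>x. (x \<bullet> c) * V x)\<close> over \<open>c\<close>.\<close>

lemma integral_dirderiv_S2:
  assumes b: "b \<in> Basis" and V: "V \<in> hom_poly k"
  shows "(LINT x|S2. dirderiv b V x) = (real k + 2) * (LINT x|S2. (x \<bullet> b) * V x)"
proof -
  note rV = hom_polyD(1)[OF V]
  have rc: "real_polynomial_function (\<lambda>x. (x \<bullet> c) * V x)" for c using rV by auto
  \<comment> \<open>In the factor \<open>k + 2\<close>, Euler's identity contributes
    \<open>k\<close>, the three summands \<open>(x \<bullet> b) * V x\<close> contribute 3, and the
    Kronecker delta \<open>b \<bullet> c\<close> removes 1.\<close>
  have eq: "(\<Sum>c\<in>Basis. ang_deriv b c (\<lambda>x. (x \<bullet> c) * V x) x) = (real k + 2) * ((x \<bullet> b) * V x) - dirderiv b V x"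
    if "norm x = 1" for x :: "real ^ 3"
  proof -
    have "ang_deriv b c (\<lambda>x. (x \<bullet> c) * V x) x = (x \<bullet> b) * ((x \<bullet> c) * dirderiv c V x) + (x \<bullet> b) * V x
        - (x \<bullet> c)\<^sup>2 * dirderiv b V x - (x \<bullet> c) * (b \<bullet> c) * V x" if "c \<in> Basis" for c
      unfolding ang_deriv_def using rV that
      by (subst (1 2) dirderiv_mult) (auto simp: inner_Basis power2_eq_square algebra_simps)
    then have "(\<Sum>c\<in>Basis. ang_deriv b c (\<lambda>x. (x \<bullet> c) * V x) x) =
       (x \<bullet> b) * (\<Sum>c\<in>Basis. (x \<bullet> c) * dirderiv c V x) + (\<Sum>c\<in>(Basis :: (real ^ 3) set). (x \<bullet> b) * V x)
        - (\<Sum>c\<in>Basis. (x \<bullet> c)\<^sup>2) * dirderiv b V x - (\<Sum>c\<in>Basis. (x \<bullet> c) * (b \<bullet> c)) * V x"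
      by (simp add: sum.distrib sum_subtractf sum_distrib_left sum_distrib_right)
    also have "(\<Sum>c\<in>Basis. (x \<bullet> c) * dirderiv c V x) = real k * V x"
      using euler_homogeneous[OF V, of x] by (simp add: dirderiv_euclidean[OF rV, of x])
    also have "(\<Sum>c\<in>Basis. (x \<bullet> c)\<^sup>2) = 1"
      using that by (simp add: norm_eq_1 euclidean_inner[of x x] power2_eq_square)
    also have "(\<Sum>c\<in>Basis. (x \<bullet> c) * (b \<bullet> c)) = x \<bullet> b"
      by (simp add: euclidean_inner[of x b])
    finally show ?thesis by (simp add: algebra_simps)
  qed
  have i1: "integrable S2 (dirderiv b V)" "integrable S2 (\<lambda>x. (x \<bullet> b) * V x)"
    using rV rc by (auto intro!: integrable_S2_polynomial)
  have "(LINT x|S2. (\<Sum>c\<in>Basis. ang_deriv b c (\<lambda>x. (x \<bullet> c) * V x) x)) = 0"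
    using rc b by (subst Bochner_Integration.integral_sum)
      (auto intro!: integrable_S2_polynomial simp: integral_ang_deriv)
  moreover have "(LINT x|S2. (\<Sum>c\<in>Basis. ang_deriv b c (\<lambda>x. (x \<bullet> c) * V x) x))
      = (LINT x|S2. (real k + 2) * ((x \<bullet> b) * V x) - dirderiv b V x)"
    by (rule Bochner_Integration.integral_cong) (auto simp: space_S2 eq)
  ultimately show ?thesis using i1 by simp
qed

text \<open>This is \<open>integral_dirderiv_S2\<close> for the components of the field
  \<open>G * grad F - F * grad G\<close>. The mixed products cancel in its divergence, Euler's
  identity gives its radial part, and its degree \<open>a + b - 1\<close> yields the factor
  \<open>a + b + 1\<close>. The case \<open>a + b = 0\<close> is separate because there the degree
  would be truncated.\<close>

lemma green_S2:
  assumes F: "F \<in> hom_poly a" and G: "G \<in> hom_poly b"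
  shows "(LINT x|S2. G x * lap F x) - (LINT x|S2. F x * lap G x)
    = (real a - real b) * (real a + real b + 1) * (LINT x|S2. F x * G x)"
proof (cases "a + b = 0")
  case True
  then have "lap F x = 0" "lap G x = 0" for x using lap_eq_0[OF F] lap_eq_0[OF G] by auto
  then show ?thesis using True by simp
next
  case False
  note rF = hom_polyD(1)[OF F] and rG = hom_polyD(1)[OF G]
  define V where "V c x = G x * dirderiv c F x - F x * dirderiv c G x" for c x
  \<comment> \<open>For constant \<open>p\<close> the product rule for degrees would only give
    degree \<open>b'\<close>; the derivative is then zero, and zero belongs to every degree.\<close>
  have aux: "(\<lambda>x. q x * dirderiv c p x) \<in> hom_poly (a' + b' - 1)"
    if "p \<in> hom_poly a'" "q \<in> hom_poly b'" "a' + b' \<noteq> 0" for p q :: sphere_fun and a' b' c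
  proof (cases a')
    case 0
    then have "p = (\<lambda>x. p 0)" using that hom_poly_0_const by blast
    then have "dirderiv c p = (\<lambda>x. 0)" by (metis dirderiv_const)
    then show ?thesis by simp
  next
    case (Suc n)
    then show ?thesis
      using hom_poly_mult[OF that(2) hom_poly_dirderiv[OF that(1), of c]] by (simp add: add.commute)
  qed
  have V: "V c \<in> hom_poly (a + b - 1)" for c
    unfolding V_def[abs_def] using aux[OF F G False] aux[OF G F] False
    by (intro hom_poly_diff) (simp_all add: add.commute)
  have divV: "(\<Sum>c\<in>Basis. dirderiv c (V c) x) = G x * lap F x - F x * lap G x" for x
  proof -
    have "dirderiv c (V c) x = G x * dirderiv c (dirderiv c F) x - F x * dirderiv c (dirderiv c G) x" for c
      unfolding V_def[abs_def] using rF rG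
      by (subst dirderiv_diff, auto) (subst (1 2) dirderiv_mult, auto)
    then show ?thesis by (simp add: lap_def sum_subtractf sum_distrib_left)
  qed
  have radV: "(\<Sum>c\<in>Basis. (x \<bullet> c) * V c x) = (real a - real b) * (F x * G x)" for x
  proof -
    have "(\<Sum>c\<in>Basis. (x \<bullet> c) * V c x)
        = G x * (\<Sum>c\<in>Basis. (x \<bullet> c) * dirderiv c F x) - F x * (\<Sum>c\<in>Basis. (x \<bullet> c) * dirderiv c G x)"
      by (simp add: V_def sum_subtractf sum_distrib_left algebra_simps)
    also have "(\<Sum>c\<in>Basis. (x \<bullet> c) * dirderiv c F x) = real a * F x"
      using euler_homogeneous[OF F, of x] by (simp add: dirderiv_euclidean[OF rF, of x])
    also have "(\<Sum>c\<in>Basis. (x \<bullet> c) * dirderiv c G x) = real b * G x"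
      using euler_homogeneous[OF G, of x] by (simp add: dirderiv_euclidean[OF rG, of x])
    finally show ?thesis by (simp add: algebra_simps)
  qed
  have iV: "integrable S2 (dirderiv c (V c))" "integrable S2 (\<lambda>x. (x \<bullet> c) * V c x)" for c
    using hom_polyD(1)[OF V] by (auto intro!: integrable_S2_polynomial)
  have iFG: "integrable S2 (\<lambda>x. G x * lap F x)" "integrable S2 (\<lambda>x. F x * lap G x)" "integrable S2 (\<lambda>x. F x * G x)"
    using rF rG by (auto intro!: integrable_S2_polynomial)
  have "(LINT x|S2. G x * lap F x) - (LINT x|S2. F x * lap G x) = (LINT x|S2. (\<Sum>c\<in>Basis. dirderiv c (V c) x))"
    using iFG by (simp add: divV)
  also have "\<dots> = (\<Sum>c\<in>Basis. (real (a + b - 1) + 2) * (LINT x|S2. (x \<bullet> c) * V c x))"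
    using iV by (simp add: Bochner_Integration.integral_sum integral_dirderiv_S2[OF _ V])
  also have "\<dots> = (real (a + b - 1) + 2) * (LINT x|S2. (\<Sum>c\<in>Basis. (x \<bullet> c) * V c x))"
    using iV by (simp add: Bochner_Integration.integral_sum sum_distrib_left)
  also have "\<dots> = (real a + real b + 1) * ((real a - real b) * (LINT x|S2. F x * G x))"
  proof -
    have "real (a + b - 1) + 2 = real a + real b + 1" using False by linarith
    then show ?thesis by (simp only: radV integral_mult_right_zero)
  qed
  finally show ?thesis by simp
qed

section \<open>The space \<open>L\<^sup>2\<close> of the sphere\<close>

definition L2_inner :: "sphere_fun \<Rightarrow> sphere_fun \<Rightarrow> real" where
  "L2_inner f g = (LINT x|S2. f x * g x)"

lemma borel_measurable_S2_borel: "f \<in> borel_measurable borel \<Longrightarrow> f \<in> borel_measurable S2"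
  using measurable_restrict_space1 measurable_cong_sets[OF sets_S2 refl] by blast

lemma LIMSEQ_0_less:
  fixes X :: "nat \<Rightarrow> real"
  assumes "X \<longlonglongrightarrow> 0" "e > 0"
  shows "\<exists>n. X n < e"
  using order_tendstoD(2)[OF assms] eventually_happens'[OF sequentially_bot] by blast

lemma L2D:
  assumes "f \<in> L2"
  shows "f \<in> borel_measurable S2" "integrable S2 (\<lambda>x. (f x)\<^sup>2)"
  using assms by (auto simp: L2_def)

lemma integrable_mult_L2:
  assumes "f \<in> L2" "g \<in> L2"
  shows "integrable S2 (\<lambda>x. f x * g x)"
proof (rule Bochner_Integration.integrable_bound)
  show "integrable S2 (\<lambda>x. (f x)\<^sup>2 + (g x)\<^sup>2)" using assms by (auto dest: L2D)
  show "(\<lambda>x. f x * g x) \<in> borel_measurable S2" using assms[THEN L2D(1)] by measurable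
  have "\<bar>a * b\<bar> \<le> a\<^sup>2 + b\<^sup>2" for a b :: real
    using sum_squares_bound[of "\<bar>a\<bar>" "\<bar>b\<bar>"] mult_nonneg_nonneg[of "\<bar>a\<bar>" "\<bar>b\<bar>"]
    by (simp only: abs_mult power2_abs) linarith
  then show "AE x in S2. norm (f x * g x) \<le> norm ((f x)\<^sup>2 + (g x)\<^sup>2)"
    by (intro AE_I2) simp
qed

lemma L2_add:
  assumes "f \<in> L2" "g \<in> L2"
  shows "(\<lambda>x. f x + g x) \<in> L2"
proof -
  have "integrable S2 (\<lambda>x. (f x)\<^sup>2 + (g x)\<^sup>2 + 2 * (f x * g x))"
    using assms[THEN L2D(2)] integrable_mult_L2[OF assms] by simp
  moreover have "(\<lambda>x. (f x)\<^sup>2 + (g x)\<^sup>2 + 2 * (f x * g x)) = (\<lambda>x. (f x + g x)\<^sup>2)"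
    by (auto simp: fun_eq_iff power2_eq_square algebra_simps)
  ultimately show ?thesis using assms by (auto simp: L2_def)
qed

lemma L2_cmult: "f \<in> L2 \<Longrightarrow> (\<lambda>x. c * f x) \<in> L2"
  by (auto simp: L2_def power_mult_distrib)

lemma L2_diff: "f \<in> L2 \<Longrightarrow> g \<in> L2 \<Longrightarrow> (\<lambda>x. f x - g x) \<in> L2"
  using L2_add[of f "\<lambda>x. - 1 * g x"] L2_cmult[of g "- 1"] by simp

lemma L2_zero [simp]: "(\<lambda>x. 0) \<in> L2"
  by (simp add: L2_def)

lemma L2_sum: "(\<And>i. i \<in> I \<Longrightarrow> f i \<in> L2) \<Longrightarrow> (\<lambda>x. \<Sum>i\<in>I. f i x) \<in> L2"
  by (induction I rule: infinite_finite_induct) (auto intro: L2_add)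

lemma L2_bounded:
  assumes f: "f \<in> borel_measurable S2" and K: "\<And>x. norm x = 1 \<Longrightarrow> \<bar>f x\<bar> \<le> K"
  shows "f \<in> L2"
proof -
  have "(f x)\<^sup>2 \<le> K\<^sup>2" if "norm x = 1" for x
    using K[OF that] by (metis abs_le_square_iff abs_ge_self order_trans abs_abs)
  then have "integrable S2 (\<lambda>x. (f x)\<^sup>2)"
    using f by (intro S2.integrable_const_bound[where B = "K\<^sup>2"]) (auto intro!: AE_I2 simp: space_S2)
  then show ?thesis using f by (simp add: L2_def)
qed

lemma L2_indicator: "A \<in> sets S2 \<Longrightarrow> indicator A \<in> L2"
  by (rule L2_bounded[where K = 1], rule borel_measurable_indicator) (auto simp: indicator_def)

lemma L2_continuous: "continuous_on (sphere 0 1) f \<Longrightarrow> f \<in> L2"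
  using continuous_bounded_on_sphere[of f] L2_bounded borel_measurable_S2_continuous by metis

lemma L2_polynomial: "real_polynomial_function p \<Longrightarrow> p \<in> L2"
  by (intro L2_continuous continuous_on_real_polynomial_function)

lemma L2_inner_cong:
  assumes "\<And>x. norm x = 1 \<Longrightarrow> f x = f' x" "\<And>x. norm x = 1 \<Longrightarrow> g x = g' x"
  shows "L2_inner f g = L2_inner f' g'"
  unfolding L2_inner_def by (rule Bochner_Integration.integral_cong) (auto simp: space_S2 assms)

lemma L2_norm_cong:
  assumes "\<And>x. norm x = 1 \<Longrightarrow> f x = f' x"
  shows "L2_norm f = L2_norm f'"
  unfolding L2_norm_def by (rule arg_cong[where f = sqrt], rule Bochner_Integration.integral_cong)
    (auto simp: space_S2 assms)

lemma L2_inner_commute: "L2_inner f g = L2_inner g f"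
  by (simp add: L2_inner_def mult.commute)

lemma L2_norm_nonneg [simp]: "0 \<le> L2_norm f"
  by (simp add: L2_norm_def)

lemma L2_norm_sq: "(L2_norm f)\<^sup>2 = L2_inner f f"
  by (simp add: L2_norm_def L2_inner_def power2_eq_square)

lemma L2_inner_add_left:
  "f \<in> L2 \<Longrightarrow> g \<in> L2 \<Longrightarrow> h \<in> L2 \<Longrightarrow> L2_inner (\<lambda>x. f x + g x) h = L2_inner f h + L2_inner g h"
  by (simp add: L2_inner_def distrib_right integrable_mult_L2)

lemma L2_inner_diff_left:
  "f \<in> L2 \<Longrightarrow> g \<in> L2 \<Longrightarrow> h \<in> L2 \<Longrightarrow> L2_inner (\<lambda>x. f x - g x) h = L2_inner f h - L2_inner g h"
  by (simp add: L2_inner_def left_diff_distrib integrable_mult_L2)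

lemma L2_inner_cmult_left: "L2_inner (\<lambda>x. c * f x) g = c * L2_inner f g"
  by (simp add: L2_inner_def mult.assoc)

lemma L2_inner_zero_left [simp]: "L2_inner (\<lambda>x. 0) g = 0"
  by (simp add: L2_inner_def)

lemma L2_inner_sum_left:
  "(\<And>i. i \<in> I \<Longrightarrow> f i \<in> L2) \<Longrightarrow> g \<in> L2 \<Longrightarrow> L2_inner (\<lambda>x. \<Sum>i\<in>I. f i x) g = (\<Sum>i\<in>I. L2_inner (f i) g)"
  by (induction I rule: infinite_finite_induct) (auto simp: L2_inner_add_left L2_sum)

lemma L2_inner_add_right:
  "f \<in> L2 \<Longrightarrow> g \<in> L2 \<Longrightarrow> h \<in> L2 \<Longrightarrow> L2_inner h (\<lambda>x. f x + g x) = L2_inner h f + L2_inner h g"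
  by (simp add: L2_inner_add_left L2_inner_commute[of h])

lemma L2_inner_cmult_right: "L2_inner g (\<lambda>x. c * f x) = c * L2_inner g f"
  by (simp add: L2_inner_cmult_left L2_inner_commute[of g])

lemma L2_inner_sum_right:
  "(\<And>i. i \<in> I \<Longrightarrow> f i \<in> L2) \<Longrightarrow> g \<in> L2 \<Longrightarrow> L2_inner g (\<lambda>x. \<Sum>i\<in>I. f i x) = (\<Sum>i\<in>I. L2_inner g (f i))"
  by (simp add: L2_inner_sum_left L2_inner_commute[of g])

lemma L2_norm_sq_add:
  assumes "f \<in> L2" "g \<in> L2"
  shows "(L2_norm (\<lambda>x. f x + g x))\<^sup>2 = (L2_norm f)\<^sup>2 + 2 * L2_inner f g + (L2_norm g)\<^sup>2"
  using assms by (simp add: L2_norm_sq L2_inner_add_left L2_inner_add_right L2_add L2_inner_commute[of g f])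

lemma L2_norm_cmult: "L2_norm (\<lambda>x. c * f x) = \<bar>c\<bar> * L2_norm f"
  by (simp add: L2_norm_def power_mult_distrib real_sqrt_mult)

lemma L2_Cauchy_Schwarz:
  assumes f: "f \<in> L2" and g: "g \<in> L2"
  shows "\<bar>L2_inner f g\<bar> \<le> L2_norm f * L2_norm g"
proof -
  have q: "0 \<le> (L2_norm f)\<^sup>2 + 2 * t * L2_inner f g + t\<^sup>2 * (L2_norm g)\<^sup>2" for t
    using L2_norm_sq_add[OF f L2_cmult[OF g, of t]] zero_le_power2[of "L2_norm (\<lambda>x. f x + t * g x)"]
    by (simp add: L2_norm_cmult L2_inner_cmult_right power_mult_distrib mult.assoc)
  have "(L2_inner f g)\<^sup>2 \<le> (L2_norm f)\<^sup>2 * (L2_norm g)\<^sup>2"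
  proof (cases "L2_norm g = 0")
    case True
    \<comment> \<open>Elements are functions, so a vanishing norm does not make \<open>g\<close>
      zero. An affine function of \<open>t\<close> that stays nonnegative must be constant; the
      \<open>t\<close> chosen below would give the value -1.\<close>
    have "L2_inner f g = 0"
    proof (rule ccontr)
      assume nz: "L2_inner f g \<noteq> 0"
      then have "2 * (- ((L2_norm f)\<^sup>2 + 1) / (2 * L2_inner f g)) * L2_inner f g = - ((L2_norm f)\<^sup>2 + 1)"
        by (simp add: field_simps)
      then show False using q[of "- ((L2_norm f)\<^sup>2 + 1) / (2 * L2_inner f g)"] True by simp
    qed
    then show ?thesis by simp
  next
    case False
    then have pos: "(L2_norm g)\<^sup>2 > 0" by simp
    \<comment> \<open>The \<open>t\<close> inserted here minimizes the quadratic.\<close>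
    have "(L2_norm f)\<^sup>2 + 2 * (- L2_inner f g / (L2_norm g)\<^sup>2) * L2_inner f g
        + (- L2_inner f g / (L2_norm g)\<^sup>2)\<^sup>2 * (L2_norm g)\<^sup>2 = (L2_norm f)\<^sup>2 - (L2_inner f g)\<^sup>2 / (L2_norm g)\<^sup>2"
      using False by (simp add: field_simps power2_eq_square)
    then have "(L2_inner f g)\<^sup>2 / (L2_norm g)\<^sup>2 \<le> (L2_norm f)\<^sup>2"
      using q[of "- L2_inner f g / (L2_norm g)\<^sup>2"] by linarith
    then show ?thesis using pos by (simp add: divide_le_eq)
  qed
  then have "\<bar>L2_inner f g\<bar>\<^sup>2 \<le> (L2_norm f * L2_norm g)\<^sup>2" by (simp add: power_mult_distrib)
  then show ?thesis by (rule power2_le_imp_le) simp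
qed

lemma L2_norm_triangle:
  assumes f: "f \<in> L2" and g: "g \<in> L2"
  shows "L2_norm (\<lambda>x. f x + g x) \<le> L2_norm f + L2_norm g"
proof (rule power2_le_imp_le)
  show "(L2_norm (\<lambda>x. f x + g x))\<^sup>2 \<le> (L2_norm f + L2_norm g)\<^sup>2"
    using L2_Cauchy_Schwarz[OF f g] by (simp add: L2_norm_sq_add[OF f g] power2_sum)
qed simp

lemma L2_norm_le_sup:
  assumes f: "f \<in> borel_measurable S2" and K: "\<And>x. norm x = 1 \<Longrightarrow> \<bar>f x\<bar> \<le> K" and "K \<ge> 0"
  shows "L2_norm f \<le> K * sqrt (4 * pi)"
proof -
  have "(LINT x|S2. (f x)\<^sup>2) \<le> (LINT x|S2. K\<^sup>2)"
  proof (rule integral_mono)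
    show "integrable S2 (\<lambda>x. (f x)\<^sup>2)" using L2D(2)[OF L2_bounded[OF f K]] .
    show "(f x)\<^sup>2 \<le> K\<^sup>2" if "x \<in> space S2" for x
      using K[of x] that \<open>K \<ge> 0\<close> by (simp add: space_S2 abs_le_square_iff[symmetric])
  qed simp
  also have "\<dots> = K\<^sup>2 * (4 * pi)" by (simp add: measure_S2_sphere space_S2)
  finally show ?thesis
    unfolding L2_norm_def using \<open>K \<ge> 0\<close> by (metis real_sqrt_abs abs_of_nonneg real_sqrt_le_iff real_sqrt_mult)
qed

lemma L2_dominated_convergence:
  assumes s: "\<And>n. s n \<in> borel_measurable S2" and f: "f \<in> borel_measurable S2" and w: "w \<in> L2"
    and lim: "\<And>x. norm x = 1 \<Longrightarrow> (\<lambda>n. s n x) \<longlonglongrightarrow> f x"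
    and bd: "\<And>n x. norm x = 1 \<Longrightarrow> \<bar>f x - s n x\<bar> \<le> w x"
  shows "(\<lambda>n. L2_norm (\<lambda>x. f x - s n x)) \<longlonglongrightarrow> 0"
proof -
  have "(\<lambda>n. LINT x|S2. (f x - s n x)\<^sup>2) \<longlonglongrightarrow> (LINT x|S2. 0)"
  proof (rule integral_dominated_convergence[where w = "\<lambda>x. (w x)\<^sup>2"])
    show "integrable S2 (\<lambda>x. (w x)\<^sup>2)" using w by (rule L2D)
    show "(\<lambda>x. (f x - s n x)\<^sup>2) \<in> borel_measurable S2" for n using s f by measurable
    show "AE x in S2. (\<lambda>n. (f x - s n x)\<^sup>2) \<longlonglongrightarrow> 0"
    proof (rule AE_I2)
      fix x :: "real ^ 3" assume "x \<in> space S2"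
      then have "(\<lambda>n. (f x - s n x)\<^sup>2) \<longlonglongrightarrow> (f x - f x)\<^sup>2"
        by (intro tendsto_intros lim) (simp add: space_S2)
      then show "(\<lambda>n. (f x - s n x)\<^sup>2) \<longlonglongrightarrow> 0" by simp
    qed
    show "AE x in S2. norm ((f x - s n x)\<^sup>2) \<le> (w x)\<^sup>2" for n
    proof (rule AE_I2)
      fix x :: "real ^ 3" assume "x \<in> space S2"
      then have "\<bar>f x - s n x\<bar> \<le> \<bar>w x\<bar>" using bd[of x n] by (simp add: space_S2)
      then show "norm ((f x - s n x)\<^sup>2) \<le> (w x)\<^sup>2" by (simp add: abs_le_square_iff)
    qed
  qed simp
  then show ?thesis using tendsto_real_sqrt unfolding L2_norm_def by fastforce
qed

section \<open>Density of polynomials: from continuous functions over indicators and simple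
  functions to \<open>L2\<close>\<close>

definition poly_approx :: "sphere_fun \<Rightarrow> bool" where
  "poly_approx f \<longleftrightarrow> (\<forall>e>0. \<exists>q. real_polynomial_function q \<and> L2_norm (\<lambda>x. f x - q x) < e)"

lemma poly_approx_cong:
  assumes "\<And>x. norm x = 1 \<Longrightarrow> f x = g x" and "poly_approx g"
  shows "poly_approx f"
proof -
  have "L2_norm (\<lambda>x. f x - q x) = L2_norm (\<lambda>x. g x - q x)" for q
    by (rule L2_norm_cong) (simp add: assms)
  then show ?thesis using assms(2) by (simp add: poly_approx_def)
qed

lemma poly_approx_closed:
  assumes f: "f \<in> L2" and ap: "\<And>e. e > 0 \<Longrightarrow> \<exists>g. g \<in> L2 \<and> poly_approx g \<and> L2_norm (\<lambda>x. f x - g x) < e"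
  shows "poly_approx f"
  unfolding poly_approx_def
proof (intro allI impI)
  fix e :: real assume e: "e > 0"
  obtain g where g: "g \<in> L2" "poly_approx g" "L2_norm (\<lambda>x. f x - g x) < e / 2"
    using ap[of "e / 2"] e by auto
  obtain q where q: "real_polynomial_function q" "L2_norm (\<lambda>x. g x - q x) < e / 2"
    using g(2) e unfolding poly_approx_def by (metis half_gt_zero)
  have "L2_norm (\<lambda>x. (f x - g x) + (g x - q x)) \<le> L2_norm (\<lambda>x. f x - g x) + L2_norm (\<lambda>x. g x - q x)"
    using f g(1) L2_polynomial[OF q(1)] by (intro L2_norm_triangle L2_diff)
  then have "L2_norm (\<lambda>x. f x - q x) < e" using g q by simp
  then show "\<exists>q. real_polynomial_function q \<and> L2_norm (\<lambda>x. f x - q x) < e" using q by blast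
qed

lemma poly_approx_add:
  assumes "f \<in> L2" "g \<in> L2" "poly_approx f" "poly_approx g"
  shows "poly_approx (\<lambda>x. f x + g x)"
  unfolding poly_approx_def
proof (intro allI impI)
  fix e :: real assume e: "e > 0"
  obtain q where q: "real_polynomial_function q" "L2_norm (\<lambda>x. f x - q x) < e / 2"
    using assms(3) e unfolding poly_approx_def by (metis half_gt_zero)
  obtain r where r: "real_polynomial_function r" "L2_norm (\<lambda>x. g x - r x) < e / 2"
    using assms(4) e unfolding poly_approx_def by (metis half_gt_zero)
  have "L2_norm (\<lambda>x. (f x - q x) + (g x - r x)) \<le> L2_norm (\<lambda>x. f x - q x) + L2_norm (\<lambda>x. g x - r x)"
    using assms(1,2) L2_polynomial[OF q(1)] L2_polynomial[OF r(1)] by (intro L2_norm_triangle L2_diff)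
  then have "L2_norm (\<lambda>x. (f x + g x) - (q x + r x)) < e" using q r by (simp add: algebra_simps)
  then show "\<exists>q. real_polynomial_function q \<and> L2_norm (\<lambda>x. f x + g x - q x) < e"
    using q r real_polynomial_function.intros(3) by blast
qed

lemma poly_approx_zero: "poly_approx (\<lambda>x. 0)"
  unfolding poly_approx_def using real_polynomial_function.intros(2)[of 0]
  by (auto intro!: exI[of _ "\<lambda>x. 0"] simp: L2_norm_def)

lemma poly_approx_cmult:
  assumes "poly_approx f"
  shows "poly_approx (\<lambda>x. c * f x)"
  unfolding poly_approx_def
proof (intro allI impI)
  fix e :: real assume e: "e > 0"
  have "e / (\<bar>c\<bar> + 1) > 0" using e by simp
  then obtain q where q: "real_polynomial_function q" "L2_norm (\<lambda>x. f x - q x) < e / (\<bar>c\<bar> + 1)"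
    using assms unfolding poly_approx_def by blast
  have "L2_norm (\<lambda>x. c * f x - c * q x) = \<bar>c\<bar> * L2_norm (\<lambda>x. f x - q x)"
    by (simp add: L2_norm_cmult flip: right_diff_distrib)
  also have "\<dots> \<le> \<bar>c\<bar> * (e / (\<bar>c\<bar> + 1))" using q by (intro mult_left_mono) auto
  also have "\<dots> < e" using e by (simp add: field_simps)
  finally show "\<exists>q. real_polynomial_function q \<and> L2_norm (\<lambda>x. c * f x - q x) < e"
    using q real_polynomial_function.intros(4)[OF real_polynomial_function.intros(2)] by blast
qed

lemma poly_approx_sum:
  "(\<And>i. i \<in> I \<Longrightarrow> f i \<in> L2 \<and> poly_approx (f i)) \<Longrightarrow> poly_approx (\<lambda>x. \<Sum>i\<in>I. f i x)"
  by (induction I rule: infinite_finite_induct) (auto intro!: poly_approx_add poly_approx_zero L2_sum)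

lemma poly_approx_continuous:
  fixes f :: sphere_fun
  assumes f: "continuous_on (sphere 0 1) f"
  shows "poly_approx f"
  unfolding poly_approx_def
proof (intro allI impI)
  fix e :: real assume e: "e > 0"
  \<comment> \<open>The added 1 turns the bound \<open>d * sqrt (4 * pi)\<close> into a strict
    inequality.\<close>
  define d where "d = e / (sqrt (4 * pi) + 1)"
  have s: "sqrt (4 * pi) > 0" by simp
  then have d: "d > 0" using e unfolding d_def by (intro divide_pos_pos) linarith+
  obtain q where q: "real_polynomial_function q" "\<And>x. x \<in> sphere 0 1 \<Longrightarrow> \<bar>f x - q x\<bar> < d"
    using Stone_Weierstrass_real_polynomial_function[OF compact_sphere f d] by blast
  have "L2_norm (\<lambda>x. f x - q x) \<le> d * sqrt (4 * pi)"
    using q(2) d continuous_on_diff[OF f continuous_on_real_polynomial_function[OF q(1)]]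
    by (intro L2_norm_le_sup borel_measurable_S2_continuous) (auto intro: less_imp_le)
  also have "\<dots> < d * (sqrt (4 * pi) + 1)" using d by simp
  also have "\<dots> = e" using s unfolding d_def by (metis add_pos_pos less_irrefl nonzero_eq_divide_eq zero_less_one)
  finally show "\<exists>q. real_polynomial_function q \<and> L2_norm (\<lambda>x. f x - q x) < e" using q by blast
qed

text \<open>The indicator is the pointwise limit of the continuous cutoffs
  \<open>max 0 (1 - real n * infdist x K)\<close>, because the distance is positive off the closed
  set \<open>K\<close>.\<close>

lemma poly_approx_compact:
  fixes K :: "(real ^ 3) set"
  assumes K: "compact K"
  shows "poly_approx (indicator K)"
proof (cases "K = {}")
  \<comment> \<open>\<open>infdist x {}\<close> is 0, so all cutoffs would be 1 here.\<close>
  case True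
  then show ?thesis using poly_approx_zero by (simp add: indicator_def[abs_def])
next
  case False
  have cl: "closed K" using K by (rule compact_imp_closed)
  have mK: "(indicator K :: sphere_fun) \<in> borel_measurable S2"
    using cl by (intro borel_measurable_S2_borel) simp
  have iK: "indicator K \<in> L2"
    using mK by (rule L2_bounded[where K = 1]) (simp add: indicator_def)
  define s where "s n x = max 0 (1 - real n * infdist x K)" for n :: nat and x
  have cs: "continuous_on (sphere 0 1) (s n)" for n
    unfolding s_def[abs_def] by (intro continuous_intros continuous_on_infdist)
  have "(\<lambda>n. L2_norm (\<lambda>x. indicator K x - s n x)) \<longlonglongrightarrow> 0"
  proof (rule L2_dominated_convergence[where w = "\<lambda>x. 1"])
    show "s n \<in> borel_measurable S2" for n using cs by (rule borel_measurable_S2_continuous)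
    show "(\<lambda>x. 1) \<in> L2" by (rule L2_continuous) simp
    fix x :: "real ^ 3"
    show "(\<lambda>n. s n x) \<longlonglongrightarrow> indicator K x"
    proof (cases "x \<in> K")
      case True
      then show ?thesis by (simp add: s_def)
    next
      case xn: False
      then have pos: "infdist x K > 0"
        using in_closed_iff_infdist_zero[OF cl False] infdist_nonneg[of x K] by (simp add: order_less_le)
      obtain N :: nat where N: "1 / infdist x K < real N" using reals_Archimedean2 by blast
      have "s n x = 0" if "n \<ge> N" for n
      proof -
        have "1 / infdist x K \<le> real n" using N that by linarith
        then have "1 \<le> real n * infdist x K" using pos by (simp add: field_simps)
        then show ?thesis by (simp add: s_def)
      qed
      then have "eventually (\<lambda>n. s n x = indicator K x) sequentially"
        using xn by (intro eventually_sequentiallyI[of N]) simp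
      then show ?thesis by (rule tendsto_eventually)
    qed
    show "\<bar>indicator K x - s n x\<bar> \<le> 1" for n
      using infdist_nonneg[of x K] by (auto simp: s_def indicator_def)
  qed (rule mK)
  from LIMSEQ_0_less[OF this] have "\<exists>n. L2_norm (\<lambda>x. indicator K x - s n x) < e" if "e > 0" for e
    using that by blast
  then show ?thesis
    using cs by (intro poly_approx_closed iK) (blast intro: L2_continuous poly_approx_continuous)
qed

text \<open>Inner regularity reduces to compact subsets. It concerns Borel measures on the whole
  space, hence the pushforward \<open>M\<close>. For nested sets the squared distance of the
  indicators is the measure of the difference, which explains the tolerance
  \<open>e\<^sup>2\<close>.\<close>

lemma poly_approx_indicator:
  assumes A: "A \<in> sets S2"
  shows "poly_approx (indicator A)"
proof (rule poly_approx_closed)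
  have AB: "A \<in> sets borel" and As: "A \<subseteq> sphere 0 1"
    using A by (auto simp: sets_S2 sets_restrict_space)
  show "indicator A \<in> L2"
    using A by (rule L2_indicator)
  fix e :: real assume e: "e > 0"
  have id: "(\<lambda>x. x) \<in> S2 \<rightarrow>\<^sub>M borel"
    by (rule borel_measurable_S2_borel) simp
  define M where "M = distr S2 borel (\<lambda>x. x)"
  have sM: "sets M = sets borel" by (simp add: M_def)
  have eM: "emeasure M B = emeasure S2 (B \<inter> sphere 0 1)" if "B \<in> sets borel" for B
    using that id by (simp add: M_def emeasure_distr space_S2)
  have fin: "emeasure M (space M) \<noteq> \<infinity>"
    using eM[of UNIV] by (simp add: M_def emeasure_S2_sphere)
  have "emeasure M A = (SUP K \<in> {K. K \<subseteq> A \<and> compact K}. emeasure M K)"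
    using inner_regular[OF sM fin AB] .
  moreover have "emeasure M A \<noteq> \<infinity>" using eM[OF AB] As S2.emeasure_finite by simp
  ultimately obtain K where K: "K \<subseteq> A" "compact K" "emeasure M A < emeasure M K + ennreal (e\<^sup>2)"
    using SUP_approx_ennreal[of "e\<^sup>2" "{K. K \<subseteq> A \<and> compact K}" "emeasure M A" "emeasure M"] e
    by (metis (mono_tags, lifting) compact_empty empty_iff empty_subsetI mem_Collect_eq zero_less_power infinity_ennreal_def)
  have KB: "K \<in> sets borel" using K by (simp add: compact_imp_closed borel_closed)
  have Ks: "K \<in> sets S2" using KB K As by (auto simp: sets_S2 sets_restrict_space)
  have "ennreal (measure S2 A) < ennreal (measure S2 K + e\<^sup>2)"
    using K As KB AB by (simp add: eM Int_absorb2 S2.emeasure_eq_measure flip: ennreal_plus)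
  then have "measure S2 A < measure S2 K + e\<^sup>2" by (simp only: ennreal_less_iff measure_nonneg)
  then have "measure S2 (A - K) < e\<^sup>2"
    using A Ks K(1) by (simp add: S2.finite_measure_Diff)
  moreover have "(L2_norm (\<lambda>x. indicator A x - indicator K x))\<^sup>2 = measure S2 (A - K)"
  proof -
    have "(\<lambda>x. (indicator A x - indicator K x)\<^sup>2 :: real) = indicator (A - K)"
      using K(1) by (auto simp: fun_eq_iff indicator_def)
    then show ?thesis using A Ks by (simp add: L2_norm_def)
  qed
  ultimately have "L2_norm (\<lambda>x. indicator A x - indicator K x) < e"
    using e by (simp add: power2_less_imp_less)
  moreover have "indicator K \<in> L2"
    using Ks by (rule L2_indicator)
  ultimately show "\<exists>g. g \<in> L2 \<and> poly_approx g \<and> L2_norm (\<lambda>x. indicator A x - g x) < e"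
    using poly_approx_compact[OF K(2)] by blast
qed

lemma polynomials_dense_L2:
  assumes f: "f \<in> L2"
  shows "poly_approx f"
proof -
  obtain s where s: "\<And>n. simple_function S2 (s n)" "\<And>x. x \<in> space S2 \<Longrightarrow> (\<lambda>n. s n x) \<longlonglongrightarrow> f x"
    "\<And>n x. x \<in> space S2 \<Longrightarrow> dist (s n x) 0 \<le> 2 * dist (f x) 0"
    using borel_measurable_implies_sequence_metric[OF L2D(1)[OF f], of 0] by blast
  have ms: "s n \<in> borel_measurable S2" for n using s(1) by (rule borel_measurable_simple_function)
  \<comment> \<open>The simple functions satisfy
    \<open>\<bar>s n x\<bar> \<le> 2 * \<bar>f x\<bar>\<close>, so the error is at most
    \<open>3 * \<bar>f x\<bar>\<close>.\<close>
  have w: "(\<lambda>x. 3 * \<bar>f x\<bar>) \<in> L2"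
    using f by (auto simp: L2_def power_mult_distrib)
  have bd: "\<bar>s n x\<bar> \<le> 2 * \<bar>f x\<bar>" if "norm x = 1" for n x using s(3)[of x n] that by (simp add: space_S2)
  have "(\<lambda>n. L2_norm (\<lambda>x. f x - s n x)) \<longlonglongrightarrow> 0"
  proof (rule L2_dominated_convergence[OF ms L2D(1)[OF f] w])
    show "(\<lambda>n. s n x) \<longlonglongrightarrow> f x" if "norm x = 1" for x using s(2)[of x] that by (simp add: space_S2)
    show "\<bar>f x - s n x\<bar> \<le> 3 * \<bar>f x\<bar>" if "norm x = 1" for n x using bd[OF that, of n] by linarith
  qed
  from LIMSEQ_0_less[OF this] have ex: "\<exists>n. L2_norm (\<lambda>x. f x - s n x) < e" if "e > 0" for e
    using that by blast
  have sL: "s n \<in> L2" for n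
  proof -
    have 1: "(\<lambda>x. (s n x)\<^sup>2) \<in> borel_measurable S2" using ms[of n] by measurable
    have 2: "AE x in S2. norm ((s n x)\<^sup>2) \<le> norm ((2 * f x)\<^sup>2)"
    proof (rule AE_I2)
      fix x :: "real ^ 3" assume "x \<in> space S2"
      then have "\<bar>s n x\<bar> \<le> \<bar>2 * f x\<bar>" using bd[of x n] by (simp add: space_S2 abs_mult)
      then show "norm ((s n x)\<^sup>2) \<le> norm ((2 * f x)\<^sup>2)" by (simp add: abs_le_square_iff)
    qed
    have 3: "integrable S2 (\<lambda>x. (2 * f x)\<^sup>2)" using L2D(2)[OF L2_cmult[OF f]] .
    show ?thesis using ms Bochner_Integration.integrable_bound[OF 3 1 2] by (simp add: L2_def)
  qed
  have "poly_approx (s n)" for n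
  proof (rule poly_approx_cong)
    let ?I = "\<lambda>y. indicator (s n -` {y} \<inter> space S2) :: sphere_fun"
    have mI: "s n -` {y} \<inter> space S2 \<in> sets S2" for y using ms[of n] by measurable
    show "s n x = (\<Sum>y\<in>s n ` space S2. y * ?I y x)" if "norm x = 1" for x
    proof -
      have "x \<in> space S2" using that by (simp add: space_S2)
      from simple_function_indicator_representation_banach[OF s(1)[of n] this]
      show ?thesis by (simp only: real_scaleR_def mult.commute)
    qed
    show "poly_approx (\<lambda>x. \<Sum>y\<in>s n ` space S2. y * ?I y x)"
      by (intro poly_approx_sum conjI L2_cmult L2_indicator poly_approx_cmult poly_approx_indicator mI)
  qed
  then show ?thesis using ex sL by (intro poly_approx_closed f) blast
qed

section \<open>Finite-dimensional spaces of polynomials\<close>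

text \<open>This gives access to the bound of an independent set by the size of a spanning set;
  addition is the pointwise one.\<close>

interpretation fun_vs: vector_space "\<lambda>(c::real) (f::sphere_fun). (\<lambda>x. c * f x)"
  by standard (auto simp: fun_eq_iff algebra_simps)

lemma sum_fun_apply: "(\<Sum>i\<in>I. f i) x = (\<Sum>i\<in>I. f i x :: real)"
  by (induction I rule: infinite_finite_induct) auto

definition monomial :: "nat \<Rightarrow> nat \<Rightarrow> nat \<Rightarrow> sphere_fun" where
  "monomial a b c x = (x $ 1) ^ a * (x $ 2) ^ b * (x $ 3) ^ c"

definition monomials :: "nat \<Rightarrow> sphere_fun set" where
  "monomials m = {monomial a b c | a b c. a + b + c = m}"

lemma monomials_homogeneous: "u \<in> monomials m \<Longrightarrow> u (t *\<^sub>R x) = t ^ m * u x"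
  by (auto simp: monomials_def monomial_def power_mult_distrib power_add)

text \<open>The true number is \<open>(m + 1) * (m + 2) / 2\<close>. The cruder square is kept
  because its root is the factor \<open>m + 1\<close> in the uniform bound for
  \<open>hom_poly m\<close>.\<close>

lemma card_monomials: "finite (monomials m) \<and> card (monomials m) \<le> (m + 1)\<^sup>2"
proof -
  have sub: "monomials m \<subseteq> (\<lambda>(a, b). monomial a b (m - a - b)) ` ({..m} \<times> {..m})"
  proof
    fix u assume "u \<in> monomials m"
    then obtain a b c where u: "u = monomial a b c" "a + b + c = m" by (auto simp: monomials_def)
    then have "u = (\<lambda>(a, b). monomial a b (m - a - b)) (a, b)" "(a, b) \<in> {..m} \<times> {..m}" by auto
    then show "u \<in> (\<lambda>(a, b). monomial a b (m - a - b)) ` ({..m} \<times> {..m})" by blast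
  qed
  have "card (monomials m) \<le> card ((\<lambda>(a, b). monomial a b (m - a - b)) ` ({..m} \<times> {..m}))"
    using sub by (intro card_mono) auto
  also have "\<dots> \<le> card ({..m} \<times> {..m})" by (rule card_image_le) simp
  finally show ?thesis
    using finite_subset[OF sub] by (simp add: power2_eq_square)
qed

lemma monomials_mult:
  assumes "u \<in> monomials m" "v \<in> monomials n"
  shows "(\<lambda>x. u x * v x) \<in> monomials (m + n)"
proof -
  obtain a b c a' b' c' where "u = monomial a b c" "a + b + c = m" "v = monomial a' b' c'" "a' + b' + c' = n"
    using assms by (auto simp: monomials_def)
  then have "(\<lambda>x. u x * v x) = monomial (a + a') (b + b') (c + c')" "(a + a') + (b + b') + (c + c') = m + n"
    by (auto simp: monomial_def fun_eq_iff power_add)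
  then show ?thesis unfolding monomials_def by blast
qed

lemma span_monomials_mult:
  assumes f: "f \<in> fun_vs.span (\<Union>m. monomials m)" and g: "g \<in> fun_vs.span (\<Union>m. monomials m)"
  shows "(\<lambda>x. f x * g x) \<in> fun_vs.span (\<Union>m. monomials m)"
proof -
  let ?S = "fun_vs.span (\<Union>m. monomials m)"
  have add: "(\<lambda>x. p x + q x) \<in> ?S" if "p \<in> ?S" "q \<in> ?S" for p q
    using fun_vs.span_add[OF that] by (simp add: plus_fun_def)
  have zero: "(\<lambda>x. 0) \<in> ?S" using fun_vs.span_zero by (simp add: zero_fun_def)
  have scale: "(\<lambda>x. c * p x) \<in> ?S" if "p \<in> ?S" for p c
    using fun_vs.span_scale[OF that] .
  have 1: "(\<lambda>x. u x * g x) \<in> ?S" if u: "u \<in> monomials m" for u m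
    using g
  proof (induction g rule: fun_vs.span_induct_alt)
    case base
    then show ?case using zero by (simp add: zero_fun_def)
  next
    case (step c v h)
    then obtain n where "v \<in> monomials n" by blast
    then have "(\<lambda>x. u x * v x) \<in> ?S"
      using monomials_mult[OF u] by (intro fun_vs.span_base) blast
    from add[OF scale[OF this, of c] step(2)]
    show ?case by (simp add: plus_fun_def algebra_simps)
  qed
  show ?thesis using f
  proof (induction f rule: fun_vs.span_induct_alt)
    case base
    then show ?case using zero by (simp add: zero_fun_def)
  next
    case (step c u h)
    then obtain m where "u \<in> monomials m" by blast
    from add[OF scale[OF 1[OF this], of c] step(2)]
    show ?case by (simp add: plus_fun_def algebra_simps)
  qed
qed

lemma real_polynomial_function_span:
  fixes p :: sphere_fun
  assumes "real_polynomial_function p"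
  shows "p \<in> fun_vs.span (\<Union>m. monomials m)"
  using assms
proof (induction p rule: real_polynomial_function.induct)
  case (linear f)
  then interpret f: bounded_linear f .
  have coord: "f x = f (axis 1 1) * monomial 1 0 0 x + f (axis 2 1) * monomial 0 1 0 x + f (axis 3 1) * monomial 0 0 1 x" for x
  proof -
    have "f x = f (\<Sum>i\<in>UNIV. (x $ i) *\<^sub>R axis i 1)"
      using basis_expansion[of x] by (simp add: scalar_mult_eq_scaleR)
    also have "\<dots> = (x $ 1) * f (axis 1 1) + (x $ 2) * f (axis 2 1) + (x $ 3) * f (axis 3 1)"
      by (simp add: sum_3 f.add f.scaleR)
    finally show ?thesis by (simp add: monomial_def algebra_simps)
  qed
  have m: "monomial a b c \<in> fun_vs.span (\<Union>m. monomials m)" for a b c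
    by (rule fun_vs.span_base) (auto simp: monomials_def)
  have "(\<lambda>x. f (axis 1 1) * monomial 1 0 0 x) + (\<lambda>x. f (axis 2 1) * monomial 0 1 0 x)
      + (\<lambda>x. f (axis 3 1) * monomial 0 0 1 x) \<in> fun_vs.span (\<Union>m. monomials m)"
    using fun_vs.span_add[OF fun_vs.span_add] fun_vs.span_scale m by metis
  moreover have "f = (\<lambda>x. f (axis 1 1) * monomial 1 0 0 x) + (\<lambda>x. f (axis 2 1) * monomial 0 1 0 x)
      + (\<lambda>x. f (axis 3 1) * monomial 0 0 1 x)"
    by (rule ext) (unfold plus_fun_apply, rule coord)
  ultimately show ?case by simp
next
  case (const c)
  have "(\<lambda>x. c * monomial 0 0 0 x) \<in> fun_vs.span (\<Union>m. monomials m)"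
    by (intro fun_vs.span_scale fun_vs.span_base) (auto simp: monomials_def)
  then show ?case by (simp add: monomial_def)
next
  case (add f g)
  then show ?case using fun_vs.span_add by (fastforce simp: plus_fun_def)
next
  case (mult f g)
  then show ?case by (intro span_monomials_mult)
qed

lemma real_polynomial_function_decomp:
  fixes p :: sphere_fun
  assumes "real_polynomial_function p"
  obtains F c d where "finite F" "\<forall>u\<in>F. u \<in> monomials (d u)" "\<forall>x. p x = (\<Sum>u\<in>F. c u * u x)"
proof -
  obtain F c where F: "finite F" "F \<subseteq> (\<Union>m. monomials m)" "p = (\<Sum>u\<in>F. (\<lambda>x. c u * u x))"
    using real_polynomial_function_span[OF assms] unfolding fun_vs.span_explicit by blast
  define d where "d u = (SOME m. u \<in> monomials m)" for u
  have "u \<in> monomials (d u)" if u: "u \<in> F" for u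
  proof -
    have "\<exists>m. u \<in> monomials m" using F u by blast
    then show ?thesis unfolding d_def by (rule someI_ex)
  qed
  moreover have "p x = (\<Sum>u\<in>F. c u * u x)" for x
    unfolding F(3) by (simp add: sum_fun_apply)
  ultimately show ?thesis using F(1) that by blast
qed

text \<open>For fixed \<open>x\<close>, both sides of \<open>p (t *\<^sub>R x) = t ^ m * p x\<close>
  are polynomials in \<open>t\<close>. Comparing the coefficients of \<open>t ^ m\<close> leaves
  only the monomials of degree \<open>m\<close>.\<close>

lemma hom_poly_span:
  assumes p: "p \<in> hom_poly m"
  shows "p \<in> fun_vs.span (monomials m)"
proof -
  obtain F c d where F: "finite F" "\<forall>u\<in>F. u \<in> monomials (d u)" "\<forall>x. p x = (\<Sum>u\<in>F. c u * u x)"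
    by (rule real_polynomial_function_decomp[OF hom_polyD(1)[OF p]])
  let ?G = "{u \<in> F. d u = m}"
  have "p x = (\<Sum>u\<in>?G. c u * u x)" for x
  proof -
    have "poly (\<Sum>u\<in>F. monom (c u * u x) (d u)) t = poly (monom (p x) m) t" for t
    proof -
      have "poly (\<Sum>u\<in>F. monom (c u * u x) (d u)) t = (\<Sum>u\<in>F. c u * u (t *\<^sub>R x))"
        by (simp add: poly_sum poly_monom monomials_homogeneous[OF bspec[OF F(2)]] algebra_simps)
      also have "\<dots> = p (t *\<^sub>R x)" by (simp add: F(3))
      finally show ?thesis using hom_polyD(2)[OF p] by (simp add: poly_monom algebra_simps)
    qed
    then have "(\<Sum>u\<in>F. monom (c u * u x) (d u)) = monom (p x) m"
      by (simp add: poly_eq_poly_eq_iff[symmetric] fun_eq_iff)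
    then have "coeff (\<Sum>u\<in>F. monom (c u * u x) (d u)) m = p x" by simp
    then have "(\<Sum>u\<in>F. if d u = m then c u * u x else 0) = p x"
      by (simp add: coeff_sum)
    then show ?thesis using F(1) by (simp add: sum.inter_filter)
  qed
  then have "p = (\<Sum>u\<in>?G. (\<lambda>x. c u * u x))" by (simp add: fun_eq_iff sum_fun_apply)
  also have "\<dots> \<in> fun_vs.span (monomials m)"
    using F(2) by (intro fun_vs.span_sum fun_vs.span_scale fun_vs.span_base) auto
  finally show ?thesis .
qed

lemma L2_hom_poly: "p \<in> hom_poly m \<Longrightarrow> p \<in> L2"
  by (intro L2_polynomial hom_polyD)

text \<open>A zero norm yields vanishing almost everywhere only. But if \<open>v\<close> is nonzero
  at some unit vector, it is nonzero on a nonempty open part of the ball, and by the definition of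
  \<open>S2\<close> through cones that part would be a null set.\<close>

lemma L2_inner_self_eq_0:
  assumes v: "v \<in> hom_poly m" and z: "L2_inner v v = 0"
  shows "v x = 0"
proof (rule ccontr)
  assume "v x \<noteq> 0"
  then obtain y where y: "norm y = 1" "v y \<noteq> 0" using hom_poly_eq_0_if_sphere[OF v] by blast
  note rv = hom_polyD(1)[OF v]
  have mv: "v \<in> borel_measurable borel"
    using continuous_on_real_polynomial_function[OF rv] by (rule borel_measurable_continuous_onI)
  have "AE x in S2. v x * v x = 0"
    using z integral_nonneg_eq_0_iff_AE[OF integrable_mult_L2[OF L2_hom_poly[OF v] L2_hom_poly[OF v]]]
    by (simp add: L2_inner_def)
  then have AE: "AE x in S2. \<not> v x \<noteq> 0" by simp
  let ?A = "{x \<in> space S2. v x \<noteq> 0}"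
  have mA: "?A \<in> sets S2" using borel_measurable_S2_borel[OF mv] by measurable
  have "emeasure S2 ?A = 0" using AE mA by (simp add: AE_iff_measurable[OF _ refl])
  then have 0: "emeasure lborel {x \<in> cball 0 1 - {0}. sgn x \<in> ?A} = 0"
    using emeasure_S2[OF mA] by simp
  define U where "U = (ball 0 1 \<inter> {x. v x \<noteq> 0}) - {0}"
  have "open {x. v x \<noteq> 0}"
    using continuous_on_real_polynomial_function[OF rv, of UNIV]
    by (intro open_Collect_neq) auto
  then have "open U" unfolding U_def by (intro open_Diff open_Int) auto
  have vs: "v x = norm x ^ m * v (sgn x)" if "x \<noteq> 0" for x
    using hom_polyD(2)[OF v, of "norm x" "sgn x"] that by (simp add: sgn_div_norm)
  have US: "U \<subseteq> {x \<in> cball 0 1 - {0}. sgn x \<in> ?A}"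
    by (auto simp: U_def space_S2 norm_sgn vs)
  have Um: "{x \<in> cball 0 1 - {0}. sgn x \<in> ?A} \<in> sets lborel"
  proof -
    have [measurable]: "(sgn :: real ^ 3 \<Rightarrow> real ^ 3) \<in> borel_measurable borel"
      by (simp add: sgn_div_norm[abs_def])
    have "?A \<in> sets borel" using mA by (auto simp: sets_S2 sets_restrict_space)
    then show ?thesis by measurable
  qed
  have U0: "emeasure lborel U = 0" using emeasure_mono[OF US Um] unfolding 0 by simp
  \<comment> \<open>Halving moves \<open>y\<close> inside the open ball and keeps it away from 0; by
    homogeneity the value stays nonzero.\<close>
  have "(1 / 2) *\<^sub>R y \<in> U"
    using y hom_polyD(2)[OF v, of "1/2" y] by (auto simp: U_def)
  then obtain e where e: "e > 0" "ball ((1 / 2) *\<^sub>R y) e \<subseteq> U"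
    using \<open>open U\<close> open_contains_ball by blast
  have "emeasure lborel (ball ((1 / 2) *\<^sub>R y) e) \<le> emeasure lborel U"
    using e \<open>open U\<close> by (intro emeasure_mono) auto
  moreover have "emeasure lborel (ball ((1 / 2) *\<^sub>R y) e) = ennreal (unit_ball_vol 3 * e ^ 3)"
    using e by (simp add: emeasure_ball)
  ultimately show False using U0 e by (simp add: unit_ball_vol_3)
qed

section \<open>Orthonormal bases, projections and the uniform bound for homogeneous
  polynomials\<close>

definition orthonormal :: "sphere_fun set \<Rightarrow> bool" where
  "orthonormal B \<longleftrightarrow> (\<forall>e\<in>B. \<forall>e'\<in>B. L2_inner e e' = (if e = e' then 1 else 0))"

lemma card_orthonormal:
  assumes B: "finite B" "B \<subseteq> hom_poly m" "orthonormal B"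
  shows "card B \<le> (m + 1)\<^sup>2"
proof -
  have "\<not> fun_vs.dependent B"
  proof
    assume "fun_vs.dependent B"
    then obtain t u v where t: "finite t" "t \<subseteq> B" "(\<Sum>v\<in>t. (\<lambda>x. u v * v x)) = 0" "v \<in> t" "u v \<noteq> 0"
      unfolding fun_vs.dependent_explicit by blast
    have tL: "w \<in> L2" if "w \<in> t" for w using that t(2) B(2) by (auto intro: L2_hom_poly)
    have "(\<lambda>x. \<Sum>w\<in>t. u w * w x) = (\<lambda>x. 0)"
      using t(3) by (simp add: fun_eq_iff sum_fun_apply) 
    \<comment> \<open>Pairing the vanishing combination with \<open>v\<close> isolates the
      coefficient \<open>u v\<close>.\<close>
    then have "0 = L2_inner (\<lambda>x. \<Sum>w\<in>t. u w * w x) v" by simp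
    also have "\<dots> = (\<Sum>w\<in>t. u w * L2_inner w v)"
      using tL t(4) by (simp add: L2_inner_sum_left L2_cmult L2_inner_cmult_left)
    also have "\<dots> = (\<Sum>w\<in>t. if w = v then u v else 0)"
      using B(3) t(2,4) by (intro sum.cong) (auto simp: orthonormal_def subset_iff)
    also have "\<dots> = u v" using t by simp
    finally show False using t by simp
  qed
  moreover have "B \<subseteq> fun_vs.span (monomials m)" using B hom_poly_span by blast
  ultimately have "card B \<le> card (monomials m)"
    using fun_vs.independent_span_bound[of "monomials m" B] card_monomials by blast
  then show ?thesis using card_monomials[of m] by linarith
qed

text \<open>A form with pointwise operations that fits both \<open>hom_poly m\<close> and
  \<open>harmonic_poly m\<close>, so that bases and projections are constructed once for
  both.\<close>

definition fun_subspace :: "sphere_fun set \<Rightarrow> bool" where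
  "fun_subspace V \<longleftrightarrow> (\<lambda>x. 0) \<in> V \<and> (\<forall>f\<in>V. \<forall>g\<in>V. (\<lambda>x. f x + g x) \<in> V) \<and> (\<forall>c. \<forall>f\<in>V. (\<lambda>x. c * f x) \<in> V)"

lemma fun_subspace_add: "fun_subspace V \<Longrightarrow> f \<in> V \<Longrightarrow> g \<in> V \<Longrightarrow> (\<lambda>x. f x + g x) \<in> V"
  by (simp add: fun_subspace_def)

lemma fun_subspace_cmult: "fun_subspace V \<Longrightarrow> f \<in> V \<Longrightarrow> (\<lambda>x. c * f x) \<in> V"
  by (simp add: fun_subspace_def)

lemma fun_subspace_sum:
  assumes "fun_subspace V"
  shows "(\<And>i. i \<in> I \<Longrightarrow> f i \<in> V) \<Longrightarrow> (\<lambda>x. \<Sum>i\<in>I. c i * f i x) \<in> V"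
  by (induction I rule: infinite_finite_induct) (use assms in \<open>auto simp: fun_subspace_def\<close>)

lemma fun_subspace_diff:
  assumes "fun_subspace V" "f \<in> V" "g \<in> V"
  shows "(\<lambda>x. f x - g x) \<in> V"
proof -
  have "(\<lambda>x. f x + (- 1) * g x) \<in> V" by (intro fun_subspace_add fun_subspace_cmult assms)
  then show ?thesis by simp
qed

lemma fun_subspace_hom_poly: "fun_subspace (hom_poly m)"
  by (simp add: fun_subspace_def hom_poly_add hom_poly_cmult)

lemma L2_inner_orthonormal_sum:
  assumes B: "finite B" "B \<subseteq> L2" "orthonormal B" and e: "e \<in> B"
  shows "L2_inner (\<lambda>x. \<Sum>e\<in>B. c e * e x) e = c e"
proof -
  have "L2_inner (\<lambda>x. \<Sum>e\<in>B. c e * e x) e = (\<Sum>w\<in>B. c w * L2_inner w e)"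
    using B e by (subst L2_inner_sum_left) (auto simp: L2_cmult L2_inner_cmult_left)
  also have "\<dots> = (\<Sum>w\<in>B. if w = e then c e else 0)"
    using B(3) e by (intro sum.cong) (auto simp: orthonormal_def)
  finally show ?thesis using B e by simp
qed

text \<open>A maximal orthonormal system spans, since otherwise the normalized residual of some element
  would enlarge it.\<close>

lemma orthonormal_basis_exists:
  assumes V: "fun_subspace V" "V \<subseteq> hom_poly m"
  obtains B where "finite B" "B \<subseteq> V" "orthonormal B" "card B \<le> (m + 1)\<^sup>2"
    "\<forall>v\<in>V. \<forall>x. v x = (\<Sum>e\<in>B. L2_inner v e * e x)"
proof -
  define P where "P B \<longleftrightarrow> finite B \<and> B \<subseteq> V \<and> orthonormal B" for B
  have bnd: "\<forall>B. P B \<longrightarrow> card B < (m + 1)\<^sup>2 + 1"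
    using card_orthonormal V(2) unfolding P_def by (metis add.commute le_imp_less_Suc plus_1_eq_Suc subset_trans)
  have "P {}" by (simp add: P_def orthonormal_def)
  from ex_has_greatest_nat[OF this bnd]
  obtain B where B: "P B" "\<And>B'. P B' \<Longrightarrow> card B' \<le> card B" by blast
  then have fB: "finite B" "B \<subseteq> V" "orthonormal B" by (auto simp: P_def)
  have BL: "B \<subseteq> L2" using fB V L2_hom_poly by blast
  have rep: "v x = (\<Sum>e\<in>B. L2_inner v e * e x)" if v: "v \<in> V" for v x
  proof (rule ccontr)
    assume ne: "v x \<noteq> (\<Sum>e\<in>B. L2_inner v e * e x)"
    define s where "s = (\<lambda>x. \<Sum>e\<in>B. L2_inner v e * e x)"
    define w where "w = (\<lambda>x. v x - s x)"
    have sV: "s \<in> V" unfolding s_def using fB by (intro fun_subspace_sum V) auto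
    have wV: "w \<in> V" unfolding w_def using fun_subspace_diff[OF V(1) v sV] .
    have wx: "w x \<noteq> 0" using ne by (simp add: w_def s_def)
    have L: "v \<in> L2" "s \<in> L2" "w \<in> L2" using v sV wV V(2) L2_hom_poly by blast+
    have orth: "L2_inner w e = 0" if "e \<in> B" for e
    proof -
      have "L2_inner w e = L2_inner v e - L2_inner s e"
        unfolding w_def using L that BL by (intro L2_inner_diff_left) auto
      then show ?thesis using L2_inner_orthonormal_sum[OF fB(1) BL fB(3) that] by (simp add: s_def)
    qed
    have pos: "L2_norm w > 0"
    proof (rule ccontr)
      assume "\<not> L2_norm w > 0"
      then have "L2_norm w = 0" using L2_norm_nonneg[of w] by linarith
      then have "L2_inner w w = 0" using L2_norm_sq[of w] by simp
      then show False using L2_inner_self_eq_0 wV V(2) wx by blast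
    qed
    define n where "n = (\<lambda>x. (1 / L2_norm w) * w x)"
    have nV: "n \<in> V" unfolding n_def using V(1) wV by (rule fun_subspace_cmult)
    have nn: "L2_inner n n = 1"
    proof -
      have "L2_inner n n = 1 / L2_norm w * (1 / L2_norm w * (L2_norm w)\<^sup>2)"
        unfolding n_def by (simp only: L2_inner_cmult_left L2_inner_cmult_right L2_norm_sq)
      then show ?thesis using pos by (simp add: power2_eq_square)
    qed
    have ne0: "L2_inner n e = 0" "L2_inner e n = 0" if "e \<in> B" for e
    proof -
      show "L2_inner n e = 0" unfolding n_def by (simp only: L2_inner_cmult_left orth[OF that] mult_zero_right)
      then show "L2_inner e n = 0" by (simp only: L2_inner_commute[of e])
    qed
    have "n \<notin> B" using nn ne0 by fastforce
    moreover have "P (insert n B)"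
      using fB nV nn ne0 by (auto simp: P_def orthonormal_def)
    ultimately show False using B(2)[of "insert n B"] fB(1) by simp
  qed
  have "card B \<le> (m + 1)\<^sup>2" using card_orthonormal fB V(2) by blast
  then show ?thesis using that fB rep by blast
qed

lemma orthogonal_projection_exists:
  assumes V: "fun_subspace V" "V \<subseteq> hom_poly m" and f: "f \<in> L2"
  obtains P where "P \<in> V" "\<And>g. g \<in> V \<Longrightarrow> L2_inner (\<lambda>x. f x - P x) g = 0"
proof -
  obtain B where B: "finite B" "B \<subseteq> V" "orthonormal B" "card B \<le> (m + 1)\<^sup>2"
    "\<forall>v\<in>V. \<forall>x. v x = (\<Sum>e\<in>B. L2_inner v e * e x)"
    by (rule orthonormal_basis_exists[OF V])
  have BL: "B \<subseteq> L2" using B V L2_hom_poly by blast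
  define P where "P = (\<lambda>x. \<Sum>e\<in>B. L2_inner f e * e x)"
  have PV: "P \<in> V" unfolding P_def using B by (intro fun_subspace_sum V) auto
  have dL: "(\<lambda>x. f x - P x) \<in> L2" using f PV V(2) L2_hom_poly by (intro L2_diff) auto
  have e: "L2_inner (\<lambda>x. f x - P x) e = 0" if "e \<in> B" for e
  proof -
    have "L2_inner (\<lambda>x. f x - P x) e = L2_inner f e - L2_inner P e"
      using f PV V(2) L2_hom_poly BL that by (intro L2_inner_diff_left) auto
    then show ?thesis using L2_inner_orthonormal_sum[OF B(1) BL B(3) that] by (simp add: P_def)
  qed
  have "L2_inner (\<lambda>x. f x - P x) g = 0" if "g \<in> V" for g
  proof -
    have "L2_inner (\<lambda>x. f x - P x) g = L2_inner (\<lambda>x. f x - P x) (\<lambda>x. \<Sum>e\<in>B. L2_inner g e * e x)"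
      using bspec[OF B(5) that] by (intro L2_inner_cong) auto
    also have "\<dots> = 0"
      using BL dL e by (subst L2_inner_sum_right) (auto simp: L2_cmult L2_inner_cmult_right)
    finally show ?thesis .
  qed
  then show ?thesis using that PV by blast
qed

text \<open>The reproducing kernel of \<open>hom_poly m\<close> is constant on the diagonal of the sphere by rotation
  invariance, hence equal to the dimension divided by \<open>4 * pi\<close>.\<close>

lemma hom_poly_sup_bound:
  fixes v :: sphere_fun
  assumes v: "v \<in> hom_poly m" and x: "norm x = 1"
  shows "\<bar>v x\<bar> \<le> (real m + 1) * L2_norm v"
proof -
  let ?V = "hom_poly m :: sphere_fun set"
  obtain B where B: "finite B" "B \<subseteq> ?V" "orthonormal B" "card B \<le> (m + 1)\<^sup>2"
     "\<forall>v\<in>?V. \<forall>x. v x = (\<Sum>e\<in>B. L2_inner v e * e x)"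
    by (rule orthonormal_basis_exists[OF fun_subspace_hom_poly[of m] order_refl])
  have BL: "B \<subseteq> L2" using B L2_hom_poly by blast
  define K where "K x = (\<Sum>e\<in>B. (e x)\<^sup>2)" for x
  have K0: "K x \<ge> 0" for x by (simp add: K_def sum_nonneg)
  have vK: "(u x)\<^sup>2 \<le> K x * (L2_norm u)\<^sup>2" if u: "u \<in> ?V" for u x
  proof -
    have "(L2_norm u)\<^sup>2 = L2_inner u (\<lambda>x. \<Sum>e\<in>B. L2_inner u e * e x)"
      unfolding L2_norm_sq using B(5)[rule_format, OF u] by (intro L2_inner_cong) auto
    also have "\<dots> = (\<Sum>e\<in>B. (L2_inner u e)\<^sup>2)"
      using BL L2_hom_poly[OF u]
      by (subst L2_inner_sum_right) (auto simp: L2_cmult L2_inner_cmult_right power2_eq_square)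
    finally have n: "(L2_norm u)\<^sup>2 = (\<Sum>e\<in>B. (L2_inner u e)\<^sup>2)" .
    show ?thesis
      using Cauchy_Schwarz_ineq_sum[of "L2_inner u" "\<lambda>e. e x" B]
      unfolding n K_def B(5)[rule_format, OF u, of x] by (simp add: mult.commute)
  qed
  \<comment> \<open>The kernel function \<open>u\<close> at \<open>a\<close> satisfies
    \<open>u a = K a\<close> and has squared norm \<open>K a\<close>. Composed with an isometry
    sending \<open>b\<close> to \<open>a\<close>, it takes this value at \<open>b\<close>, and the
    bound \<open>vK\<close> at \<open>b\<close> gives
    \<open>(K a)\<^sup>2 \<le> K b * K a\<close>.\<close>
  have K_le: "K a \<le> K b" if ab: "norm a = 1" "norm b = 1" for a b
  proof -
    obtain A where A: "orthogonal_transformation A" "A b = a"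
      using orthogonal_transformation_exists[of b a] ab by auto
    define u where "u = (\<lambda>x. \<Sum>e\<in>B. e a * e x)"
    have uV: "u \<in> ?V" unfolding u_def using B by (intro fun_subspace_sum fun_subspace_hom_poly) auto
    have ua: "u a = K a" by (simp add: u_def K_def power2_eq_square)
    have "(L2_norm u)\<^sup>2 = (\<Sum>e\<in>B. e a * L2_inner e u)"
      unfolding L2_norm_sq using BL L2_hom_poly[OF uV]
      by (subst (1) u_def, subst L2_inner_sum_left) (auto simp: L2_cmult L2_inner_cmult_left)
    also have "\<dots> = (\<Sum>e\<in>B. e a * e a)"
      using L2_inner_orthonormal_sum[OF B(1) BL B(3)]
      by (intro sum.cong) (auto simp: u_def L2_inner_commute[of _ "\<lambda>x. _ x"])
    finally have un: "(L2_norm u)\<^sup>2 = K a" by (simp add: K_def power2_eq_square)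
    have "L2_norm (\<lambda>x. u (A x)) = L2_norm u"
      unfolding L2_norm_def using integral_S2_orthogonal[OF A(1), of "\<lambda>x. (u x)\<^sup>2"] L2D(1)[OF L2_hom_poly[OF uV]]
      by simp
    then have "(K a)\<^sup>2 \<le> K b * K a"
      using vK[OF hom_poly_orthogonal[OF uV A(1)], of b] by (simp add: A(2) ua un)
    then show ?thesis using K0[of a] K0[of b]
      by (cases "K a = 0") (auto simp: power2_eq_square mult_le_cancel_right)
  qed
  have iK: "integrable S2 (\<lambda>x. (e x)\<^sup>2)" if "e \<in> B" for e using that BL by (auto dest: L2D(2))
  \<comment> \<open>A trace computation: integrating the constant \<open>K x\<close> counts the
    members of the basis, since each has norm 1.\<close>
  have "(LINT y|S2. K y) = (LINT y|S2. K x)"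
    using K_le[OF _ x] K_le[OF x] by (intro Bochner_Integration.integral_cong) (auto simp: space_S2 intro: antisym)
  also have "\<dots> = 4 * pi * K x" using measure_S2_sphere by (simp add: space_S2)
  finally have "4 * pi * K x = (\<Sum>e\<in>B. (LINT y|S2. (e y)\<^sup>2))"
    unfolding K_def using iK by (simp add: Bochner_Integration.integral_sum)
  also have "\<dots> = (\<Sum>e\<in>B. 1)"
    using B(3) by (intro sum.cong) (auto simp: orthonormal_def L2_inner_def power2_eq_square)
  also have "\<dots> = real (card B)" by simp
  also have "\<dots> \<le> (real m + 1)\<^sup>2"
    using B(4) by (metis of_nat_1 of_nat_add of_nat_le_iff of_nat_power)
  finally have "4 * pi * K x \<le> (real m + 1)\<^sup>2" .
  \<comment> \<open>The gain of \<open>4 * pi\<close> is given up for a simpler constant.\<close>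
  moreover have "1 * K x \<le> (4 * pi) * K x" using K0[of x] pi_gt3 by (intro mult_right_mono) auto
  ultimately have "K x \<le> (real m + 1)\<^sup>2" by simp
  then have "(v x)\<^sup>2 \<le> (real m + 1)\<^sup>2 * (L2_norm v)\<^sup>2"
    using vK[OF v, of x] by (meson mult_right_mono order_trans zero_le_power2)
  then have "\<bar>v x\<bar>\<^sup>2 \<le> ((real m + 1) * L2_norm v)\<^sup>2" by (simp add: power_mult_distrib)
  then show ?thesis by (rule power2_le_imp_le) simp
qed

section \<open>Spherical harmonics\<close>

definition harmonic_poly :: "nat \<Rightarrow> sphere_fun set" where
  "harmonic_poly m = {p \<in> hom_poly m. \<forall>x. lap p x = 0}"

lemma harmonic_polyD: "p \<in> harmonic_poly m \<Longrightarrow> p \<in> hom_poly m" "p \<in> harmonic_poly m \<Longrightarrow> lap p x = 0"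
  by (auto simp: harmonic_poly_def)

lemma harm_subset: "harmonic_poly m \<subseteq> hom_poly m"
  by (auto simp: harmonic_poly_def)

lemma L2_harm: "p \<in> harmonic_poly m \<Longrightarrow> p \<in> L2"
  using L2_hom_poly harmonic_polyD(1) by blast

lemma fun_subspace_harm: "fun_subspace (harmonic_poly m)"
proof -
  have "lap (\<lambda>x. 0) x = 0" for x :: "real ^ 3"
    using lap_cmult[OF real_polynomial_function.intros(2)[of 0], of 0 x] by simp
  then show ?thesis
    by (auto simp: fun_subspace_def harmonic_poly_def hom_poly_add hom_poly_cmult lap_add lap_cmult hom_polyD(1))
qed

lemma spherical_harmonics_eq: "spherical_harmonics m = (\<lambda>p. restrict p (sphere 0 1)) ` harmonic_poly m"
  by (auto simp: spherical_harmonics_def harmonic_poly_def hom_poly_def laplacian_eq_lap)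

lemma harm_orthogonal:
  assumes F: "F \<in> harmonic_poly a" and G: "G \<in> harmonic_poly b" and "a \<noteq> b"
  shows "L2_inner F G = 0"
proof -
  have "(real a - real b) * (real a + real b + 1) * L2_inner F G = 0"
    using green_S2[OF harmonic_polyD(1)[OF F] harmonic_polyD(1)[OF G]] harmonic_polyD(2)[OF F] harmonic_polyD(2)[OF G]
    by (simp add: L2_inner_def)
  moreover have "real a + real b + 1 \<noteq> 0" by linarith
  ultimately show ?thesis using \<open>a \<noteq> b\<close> by simp
qed

text \<open>The projection as a polynomial on the whole space, so that homogeneity and harmonicity
  remain available; \<open>harmonic_proj\<close> is its restriction, which is
  \<open>undefined\<close> off the sphere.\<close>

definition hproj :: "nat \<Rightarrow> sphere_fun \<Rightarrow> sphere_fun" where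
  "hproj m f = (SOME P. P \<in> harmonic_poly m \<and> (\<forall>g\<in>harmonic_poly m. L2_inner (\<lambda>x. f x - P x) g = 0))"

lemma
  assumes f: "f \<in> L2"
  shows hproj_harm: "hproj m f \<in> harmonic_poly m"
    and hproj_orthogonal: "g \<in> harmonic_poly m \<Longrightarrow> L2_inner (\<lambda>x. f x - hproj m f x) g = 0"
proof -
  have "\<exists>P. P \<in> harmonic_poly m \<and> (\<forall>g\<in>harmonic_poly m. L2_inner (\<lambda>x. f x - P x) g = 0)"
    using orthogonal_projection_exists[OF fun_subspace_harm harm_subset f] by metis
  from someI_ex[OF this]
  show "hproj m f \<in> harmonic_poly m" "g \<in> harmonic_poly m \<Longrightarrow> L2_inner (\<lambda>x. f x - hproj m f x) g = 0"
    unfolding hproj_def by blast+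
qed

lemma L2_hproj: "f \<in> L2 \<Longrightarrow> hproj m f \<in> L2"
  using hproj_harm L2_harm by blast

text \<open>The difference of two candidates is orthogonal to itself, which for homogeneous
  polynomials forces equality at every point. So the description in \<open>harmonic_proj\<close>
  determines exactly one function.\<close>

lemma hproj_unique:
  assumes f: "f \<in> L2" and P: "P \<in> harmonic_poly m" "\<And>g. g \<in> harmonic_poly m \<Longrightarrow> L2_inner (\<lambda>x. f x - P x) g = 0"
  shows "P = hproj m f"
proof
  fix x
  let ?d = "\<lambda>x. P x - hproj m f x"
  have d: "?d \<in> harmonic_poly m" using fun_subspace_diff[OF fun_subspace_harm P(1) hproj_harm[OF f]] .
  have "L2_inner ?d ?d = L2_inner (\<lambda>x. (f x - hproj m f x) - (f x - P x)) ?d" by simp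
  also have "\<dots> = L2_inner (\<lambda>x. f x - hproj m f x) ?d - L2_inner (\<lambda>x. f x - P x) ?d"
    using f P(1) L2_harm d L2_hproj[OF f] by (intro L2_inner_diff_left L2_diff) auto
  also have "\<dots> = 0" using hproj_orthogonal[OF f d] P(2)[OF d] by simp
  finally have "L2_inner ?d ?d = 0" .
  from L2_inner_self_eq_0[OF harmonic_polyD(1)[OF d] this, of x] show "P x = hproj m f x" by simp
qed

lemma hproj_diff:
  assumes f: "f \<in> L2" and g: "g \<in> L2"
  shows "hproj m (\<lambda>x. f x - g x) x = hproj m f x - hproj m g x"
proof -
  have "(\<lambda>x. hproj m f x - hproj m g x) = hproj m (\<lambda>x. f x - g x)"
  proof (rule hproj_unique[OF L2_diff[OF f g]])
    show "(\<lambda>x. hproj m f x - hproj m g x) \<in> harmonic_poly m"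
      using fun_subspace_diff[OF fun_subspace_harm hproj_harm[OF f] hproj_harm[OF g]] .
    fix h assume h: "h \<in> harmonic_poly m"
    have "L2_inner (\<lambda>x. f x - g x - (hproj m f x - hproj m g x)) h
        = L2_inner (\<lambda>x. (f x - hproj m f x) - (g x - hproj m g x)) h"
      by (simp add: algebra_simps)
    also have "\<dots> = L2_inner (\<lambda>x. f x - hproj m f x) h - L2_inner (\<lambda>x. g x - hproj m g x) h"
      using f g L2_hproj L2_harm[OF h] by (intro L2_inner_diff_left L2_diff) auto
    also have "\<dots> = 0" using hproj_orthogonal[OF f h] hproj_orthogonal[OF g h] by simp
    finally show "L2_inner (\<lambda>x. f x - g x - (hproj m f x - hproj m g x)) h = 0" .
  qed
  from fun_cong[OF this, of x] show ?thesis by simp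
qed

lemma L2_inner_hproj:
  assumes f: "f \<in> L2" and g: "g \<in> harmonic_poly m"
  shows "L2_inner f g = L2_inner (hproj m f) g"
  using hproj_orthogonal[OF f g] L2_inner_diff_left[OF f L2_hproj[OF f] L2_harm[OF g]] by simp

lemma L2_norm_hproj_le:
  assumes f: "f \<in> L2"
  shows "L2_norm (hproj m f) \<le> L2_norm f"
proof -
  have "L2_norm (hproj m f) * L2_norm (hproj m f) = L2_inner f (hproj m f)"
    using L2_norm_sq[of "hproj m f"] L2_inner_hproj[OF f hproj_harm[OF f]] by (simp add: power2_eq_square)
  also have "\<dots> \<le> L2_norm f * L2_norm (hproj m f)"
    using L2_Cauchy_Schwarz[OF f L2_hproj[OF f]] by (rule order_trans[OF abs_ge_self])
  finally have le: "L2_norm (hproj m f) * L2_norm (hproj m f) \<le> L2_norm f * L2_norm (hproj m f)" .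
  show ?thesis
  proof (cases "L2_norm (hproj m f) = 0")
    case False
    then have "L2_norm (hproj m f) > 0" using L2_norm_nonneg[of "hproj m f"] by linarith
    with le show ?thesis by (rule mult_right_le_imp_le)
  qed simp
qed

lemma harmonic_proj_eq:
  assumes f: "f \<in> L2"
  shows "harmonic_proj m f = restrict (hproj m f) (sphere 0 1)"
proof -
  have orth_iff: "(\<forall>g\<in>spherical_harmonics m. (LINT x|S2. (f x - restrict P (sphere 0 1) x) * g x) = 0)
     \<longleftrightarrow> (\<forall>g\<in>harmonic_poly m. L2_inner (\<lambda>x. f x - P x) g = 0)" for P
  proof -
    have "(LINT x|S2. (f x - restrict P (sphere 0 1) x) * restrict g (sphere 0 1) x)
        = L2_inner (\<lambda>x. f x - P x) g" for g
      unfolding L2_inner_def by (rule Bochner_Integration.integral_cong) (auto simp: space_S2)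
    then show ?thesis by (auto simp: spherical_harmonics_eq)
  qed
  show ?thesis
    unfolding harmonic_proj_def
  proof (rule the_equality)
    show "restrict (hproj m f) (sphere 0 1) \<in> spherical_harmonics m \<and>
        (\<forall>g\<in>spherical_harmonics m. (LINT x|S2. (f x - restrict (hproj m f) (sphere 0 1) x) * g x) = 0)"
      unfolding orth_iff using hproj_harm[OF f] hproj_orthogonal[OF f]
      by (auto simp: spherical_harmonics_eq)
  next
    fix h assume h: "h \<in> spherical_harmonics m \<and> (\<forall>g\<in>spherical_harmonics m. (LINT x|S2. (f x - h x) * g x) = 0)"
    then obtain P where P: "h = restrict P (sphere 0 1)" "P \<in> harmonic_poly m"
      by (auto simp: spherical_harmonics_eq)
    then have "\<forall>g\<in>harmonic_poly m. L2_inner (\<lambda>x. f x - P x) g = 0" using h orth_iff[of P] by simp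
    then have "P = hproj m f" using hproj_unique[OF f P(2)] by blast
    then show "h = restrict (hproj m f) (sphere 0 1)" using P by simp
  qed
qed

lemma L2_norm_harmonic_proj: "f \<in> L2 \<Longrightarrow> L2_norm (harmonic_proj m f) = L2_norm (hproj m f)"
  by (rule L2_norm_cong) (simp add: harmonic_proj_eq)

text \<open>With \<open>W\<close> the part of \<open>P\<close> orthogonal to \<open>hom_poly (m - 2)\<close>, Green's formula shows that \<open>lap W\<close> is
  orthogonal to \<open>hom_poly (m - 2)\<close>, hence to itself.\<close>

lemma hom_poly_sphere_decomposition:
  assumes "P \<in> hom_poly m" "m < N"
  shows "\<exists>Y. (\<forall>j. Y j \<in> harmonic_poly j) \<and> (\<forall>x. norm x = 1 \<longrightarrow> P x = (\<Sum>j<N. Y j x))"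
  using assms
proof (induction m arbitrary: P N rule: less_induct)
  case (less m)
  note P = less.prems(1)
  have zero: "(\<lambda>x. 0) \<in> harmonic_poly j" for j using fun_subspace_harm by (simp add: fun_subspace_def)
  have single: "\<exists>Y. (\<forall>j. Y j \<in> harmonic_poly j) \<and> (\<forall>x. norm x = 1 \<longrightarrow> W x = (\<Sum>j<N. Y j x))"
    if W: "W \<in> harmonic_poly m" for W
  proof (intro exI conjI allI impI)
    show "(if j = m then W else (\<lambda>x. 0)) \<in> harmonic_poly j" for j using W zero by simp
    show "W x = (\<Sum>j<N. (if j = m then W else (\<lambda>x. 0)) x)" for x
      using less.prems(2) by (simp add: if_distrib[of "\<lambda>f. f x"] sum.delta cong: if_cong)
  qed
  show ?case
  proof (cases "m < 2")
    case True
    then have "P \<in> harmonic_poly m" using P lap_eq_0[OF P True] by (simp add: harmonic_poly_def)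
    then show ?thesis by (rule single)
  next
    case False
    let ?V = "hom_poly (m - 2) :: sphere_fun set"
    obtain Q where Q: "Q \<in> ?V" "\<And>g. g \<in> ?V \<Longrightarrow> L2_inner (\<lambda>x. P x - Q x) g = 0"
      using orthogonal_projection_exists[OF fun_subspace_hom_poly[of "m - 2"] order_refl L2_hom_poly[OF P]] by metis
    have r2: "(\<lambda>x. x \<bullet> x) \<in> (hom_poly 2 :: sphere_fun set)"
    proof -
      have "(\<lambda>x. \<Sum>b\<in>Basis. (x \<bullet> b) * (x \<bullet> b)) \<in> (hom_poly (1 + 1) :: sphere_fun set)"
        by (intro hom_poly_sum hom_poly_mult hom_poly_inner)
      then show ?thesis by (simp add: euclidean_inner[symmetric] numeral_2_eq_2)
    qed
    \<comment> \<open>The factor \<open>x \<bullet> x\<close> lifts \<open>Q\<close> to degree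
      \<open>m\<close> without changing it on the sphere.\<close>
    define W where "W x = P x - (x \<bullet> x) * Q x" for x
    have "(\<lambda>x. (x \<bullet> x) * Q x) \<in> hom_poly m"
      using hom_poly_mult[OF r2 Q(1)] le_add_diff_inverse[of 2 m] False by (simp only: not_less)
    then have W: "W \<in> hom_poly m" unfolding W_def[abs_def] using P by (intro hom_poly_diff)
    have Wo: "L2_inner W g = 0" if "g \<in> ?V" for g
    proof -
      have "L2_inner W g = L2_inner (\<lambda>x. P x - Q x) g"
        by (rule L2_inner_cong) (auto simp: W_def norm_eq_1)
      then show ?thesis using Q(2)[OF that] by simp
    qed
    define U where "U = lap W"
    have U: "U \<in> ?V" unfolding U_def using W by (rule hom_poly_lap)
    have "L2_inner W (lap U) = 0"
    proof (cases "m - 2 < 2")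
      case True
      then have "lap U = (\<lambda>x. 0)" using lap_eq_0[OF U] by blast
      then show ?thesis by (simp add: L2_inner_def)
    next
      case f2: False
      \<comment> \<open>\<open>lap U\<close> has degree \<open>m - 4\<close>. The factor
        \<open>x \<bullet> x\<close>, equal to 1 on the sphere, raises it to degree
        \<open>m - 2\<close>, where \<open>W\<close> is known to be orthogonal.\<close>
      have "(\<lambda>x. (x \<bullet> x) * lap U x) \<in> ?V"
        using hom_poly_mult[OF r2 hom_poly_lap[OF U]] le_add_diff_inverse[of 2 "m - 2"] f2 by (simp only: not_less)
      from Wo[OF this] show ?thesis
        by (subst L2_inner_cong[of W W "lap U" "\<lambda>x. (x \<bullet> x) * lap U x"]) (auto simp: norm_eq_1)
    qed
    then have "L2_inner U U = 0"
      using green_S2[OF W U] Wo[OF U] by (simp add: U_def L2_inner_def)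
    then have "U x = 0" for x using L2_inner_self_eq_0[OF U] by blast
    then have "W \<in> harmonic_poly m" using W by (simp add: harmonic_poly_def U_def)
    from single[OF this] obtain Y1 where Y1: "\<forall>j. Y1 j \<in> harmonic_poly j" "\<forall>x. norm x = 1 \<longrightarrow> W x = (\<Sum>j<N. Y1 j x)"
      by blast
    have "m - 2 < m" "m - 2 < N" using False less.prems(2) by auto
    from less.IH[OF this(1) Q(1) this(2)]
    obtain Y2 where Y2: "\<forall>j. Y2 j \<in> harmonic_poly j" "\<forall>x. norm x = 1 \<longrightarrow> Q x = (\<Sum>j<N. Y2 j x)" by blast
    show ?thesis
    proof (intro exI conjI allI impI)
      show "(\<lambda>x. Y1 j x + Y2 j x) \<in> harmonic_poly j" for j
        using fun_subspace_add[OF fun_subspace_harm] Y1(1) Y2(1) by blast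
      fix x :: "real ^ 3" assume x: "norm x = 1"
      then have "P x = W x + Q x" by (simp add: W_def norm_eq_1)
      then show "P x = (\<Sum>j<N. Y1 j x + Y2 j x)" using Y1(2) Y2(2) x by (simp add: sum.distrib)
    qed
  qed
qed

lemma monomials_hom_poly: "u \<in> monomials m \<Longrightarrow> u \<in> hom_poly m"
proof -
  assume u: "u \<in> monomials m"
  have "real_polynomial_function (\<lambda>x :: real ^ 3. x $ i)" for i
    by (intro real_polynomial_function.intros(1) bounded_linear_vec_nth)
  then have "real_polynomial_function u"
    using u by (auto simp: monomials_def monomial_def[abs_def]
        intro!: real_polynomial_function.intros(4) real_polynomial_function_power)
  then show ?thesis using monomials_homogeneous[OF u] by (simp add: hom_poly_def)
qed

text \<open>All lengths \<open>n \<ge> N\<close> are covered, so that the decomposition can be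
  compared with every sufficiently long partial sum of the harmonic expansion.\<close>

lemma polynomial_sphere_decomposition:
  fixes q :: sphere_fun
  assumes "real_polynomial_function q"
  obtains N where "\<forall>n\<ge>N. \<exists>Y. (\<forall>j. Y j \<in> harmonic_poly j) \<and> (\<forall>x. norm x = 1 \<longrightarrow> q x = (\<Sum>j<n. Y j x))"
proof -
  obtain F c d where F: "finite F" "\<forall>u\<in>F. u \<in> monomials (d u)" "\<forall>x. q x = (\<Sum>u\<in>F. c u * u x)"
    by (rule real_polynomial_function_decomp[OF assms])
  define N where "N = Suc (\<Sum>u\<in>F. d u)"
  have dN: "d u < N" if "u \<in> F" for u
    using member_le_sum[of u F d] that F(1) by (simp add: N_def less_Suc_eq_le)
  have "\<exists>Y. (\<forall>j. Y j \<in> harmonic_poly j) \<and> (\<forall>x. norm x = 1 \<longrightarrow> q x = (\<Sum>j<n. Y j x))" if "n \<ge> N" for n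
  proof -
    have "\<forall>u\<in>F. \<exists>Y. (\<forall>j. Y j \<in> harmonic_poly j) \<and> (\<forall>x. norm x = 1 \<longrightarrow> u x = (\<Sum>j<n. Y j x))"
    proof
      fix u assume u: "u \<in> F"
      have "u \<in> hom_poly (d u)" using F(2) u monomials_hom_poly by blast
      moreover have "d u < n" using dN[OF u] that by simp
      ultimately show "\<exists>Y. (\<forall>j. Y j \<in> harmonic_poly j) \<and> (\<forall>x. norm x = 1 \<longrightarrow> u x = (\<Sum>j<n. Y j x))"
        by (rule hom_poly_sphere_decomposition)
    qed
    from bchoice[OF this] obtain Y where Y: "\<forall>u\<in>F. (\<forall>j. Y u j \<in> harmonic_poly j) \<and> (\<forall>x. norm x = 1 \<longrightarrow> u x = (\<Sum>j<n. Y u j x))"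
      by blast
    show ?thesis
    proof (intro exI conjI allI impI)
      show "(\<lambda>x. \<Sum>u\<in>F. c u * Y u j x) \<in> harmonic_poly j" for j
        using Y by (intro fun_subspace_sum fun_subspace_harm) blast
      fix x :: "real ^ 3" assume x: "norm x = 1"
      have "q x = (\<Sum>u\<in>F. c u * u x)" using F(3) by blast
      also have "\<dots> = (\<Sum>u\<in>F. \<Sum>j<n. c u * Y u j x)"
      proof (rule sum.cong[OF refl])
        fix u assume "u \<in> F"
        then have "u x = (\<Sum>j<n. Y u j x)" using Y x by blast
        then show "c u * u x = (\<Sum>j<n. c u * Y u j x)" by (metis sum_distrib_left)
      qed
      also have "\<dots> = (\<Sum>j<n. \<Sum>u\<in>F. c u * Y u j x)" by (rule sum.swap)
      finally show "q x = (\<Sum>j<n. \<Sum>u\<in>F. c u * Y u j x)" .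
    qed
  qed
  then show ?thesis using that by blast
qed

section \<open>Expansion in spherical harmonics: completeness, Parseval's identity and the Sobolev
  tail\<close>

definition harm_partial :: "nat \<Rightarrow> sphere_fun \<Rightarrow> sphere_fun" where
  "harm_partial n f x = (\<Sum>m<n. hproj m f x)"

lemma L2_harm_partial: "f \<in> L2 \<Longrightarrow> harm_partial n f \<in> L2"
  unfolding harm_partial_def[abs_def] by (intro L2_sum L2_hproj)

lemma L2_inner_harm_partial:
  assumes f: "f \<in> L2" and g: "g \<in> harmonic_poly j" and "j < n"
  shows "L2_inner (\<lambda>x. f x - harm_partial n f x) g = 0"
proof -
  have "L2_inner (harm_partial n f) g = (\<Sum>m<n. L2_inner (hproj m f) g)"
    unfolding harm_partial_def[abs_def] using L2_hproj[OF f] L2_harm[OF g] by (intro L2_inner_sum_left)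
  also have "\<dots> = (\<Sum>m<n. if m = j then L2_inner (hproj j f) g else 0)"
    using harm_orthogonal[OF hproj_harm[OF f] g] by (intro sum.cong) auto
  also have "\<dots> = L2_inner f g" using \<open>j < n\<close> L2_inner_hproj[OF f g] by simp
  finally show ?thesis
    using L2_inner_diff_left[OF f L2_harm_partial[OF f] L2_harm[OF g]] by simp
qed

text \<open>The error of the partial sum is orthogonal to all harmonics of degree below
  \<open>n\<close>, so Pythagoras compares it with the error of any other combination.\<close>

lemma harm_partial_best:
  assumes f: "f \<in> L2" and Y: "\<And>j. Y j \<in> harmonic_poly j"
  shows "L2_norm (\<lambda>x. f x - harm_partial n f x) \<le> L2_norm (\<lambda>x. f x - (\<Sum>j<n. Y j x))"
proof -
  let ?d = "\<lambda>x. f x - harm_partial n f x"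
  let ?e = "\<lambda>x. \<Sum>j<n. hproj j f x - Y j x"
  have h: "(\<lambda>x. hproj j f x - Y j x) \<in> harmonic_poly j" for j
    using fun_subspace_diff[OF fun_subspace_harm hproj_harm[OF f] Y] .
  have L: "?d \<in> L2" "?e \<in> L2"
    using f h by (auto intro!: L2_diff L2_harm_partial L2_sum L2_hproj L2_harm[OF Y])
  have "L2_inner ?d ?e = (\<Sum>j<n. L2_inner ?d (\<lambda>x. hproj j f x - Y j x))"
    using L(1) L2_harm[OF h] by (intro L2_inner_sum_right) auto
  also have "\<dots> = 0" using L2_inner_harm_partial[OF f h] by (intro sum.neutral) auto
  finally have "(L2_norm (\<lambda>x. ?d x + ?e x))\<^sup>2 = (L2_norm ?d)\<^sup>2 + (L2_norm ?e)\<^sup>2"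
    using L2_norm_sq_add[OF L] by simp
  moreover have "(\<lambda>x. ?d x + ?e x) = (\<lambda>x. f x - (\<Sum>j<n. Y j x))"
    by (auto simp: harm_partial_def sum_subtractf)
  ultimately have "(L2_norm ?d)\<^sup>2 \<le> (L2_norm (\<lambda>x. f x - (\<Sum>j<n. Y j x)))\<^sup>2" by simp
  then show ?thesis by (rule power2_le_imp_le) simp
qed

text \<open>Best approximation transfers the density of polynomials to the partial sums.\<close>

lemma harm_partial_tendsto:
  assumes f: "f \<in> L2"
  shows "(\<lambda>n. L2_norm (\<lambda>x. f x - harm_partial n f x)) \<longlonglongrightarrow> 0"
proof (rule LIMSEQ_I)
  fix e :: real assume "e > 0"
  then obtain q where q: "real_polynomial_function q" "L2_norm (\<lambda>x. f x - q x) < e"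
    using polynomials_dense_L2[OF f] unfolding poly_approx_def by blast
  obtain N where N: "\<forall>n\<ge>N. \<exists>Y. (\<forall>j. Y j \<in> harmonic_poly j) \<and> (\<forall>x. norm x = 1 \<longrightarrow> q x = (\<Sum>j<n. Y j x))"
    by (rule polynomial_sphere_decomposition[OF q(1)])
  have "L2_norm (\<lambda>x. f x - harm_partial n f x) < e" if nN: "n \<ge> N" for n
  proof -
    obtain Y where Y: "\<forall>j. Y j \<in> harmonic_poly j" "\<forall>x. norm x = 1 \<longrightarrow> q x = (\<Sum>j<n. Y j x)" 
      using mp[OF spec[OF N] nN] by blast
    have "L2_norm (\<lambda>x. f x - harm_partial n f x) \<le> L2_norm (\<lambda>x. f x - (\<Sum>j<n. Y j x))"
      using harm_partial_best[OF f, of Y] Y(1) by blast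
    also have "\<dots> = L2_norm (\<lambda>x. f x - q x)" using Y(2) by (intro L2_norm_cong) simp
    finally show ?thesis using q(2) by simp
  qed
  then show "\<exists>no. \<forall>n\<ge>no. norm (L2_norm (\<lambda>x. f x - harm_partial n f x) - 0) < e" by auto
qed

lemma L2_norm_sub_harm_partial:
  assumes f: "f \<in> L2"
  shows "(L2_norm (\<lambda>x. f x - harm_partial n f x))\<^sup>2 = (L2_norm f)\<^sup>2 - (\<Sum>m<n. (L2_norm (hproj m f))\<^sup>2)"
proof -
  let ?p = "harm_partial n f"
  let ?d = "\<lambda>x. f x - ?p x"
  note L = L2_diff[OF f L2_harm_partial[OF f, of n]] L2_harm_partial[OF f, of n]
  have "L2_inner ?d ?p = (\<Sum>m<n. L2_inner ?d (hproj m f))"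
    by (subst (2) harm_partial_def[abs_def], rule L2_inner_sum_right) (use L(1) L2_hproj[OF f] in auto)
  also have "\<dots> = 0" using L2_inner_harm_partial[OF f hproj_harm[OF f]] by (intro sum.neutral) auto
  finally have "(L2_norm (\<lambda>x. ?d x + ?p x))\<^sup>2 = (L2_norm ?d)\<^sup>2 + (L2_norm ?p)\<^sup>2"
    and dp: "L2_inner ?d ?p = 0"
    using L2_norm_sq_add[OF L] by simp_all
  moreover have "(L2_norm ?p)\<^sup>2 = (\<Sum>m<n. (L2_norm (hproj m f))\<^sup>2)"
  proof -
    have "(L2_norm ?p)\<^sup>2 = L2_inner f ?p"
      using dp L2_inner_diff_left[OF f L(2) L(2)] by (simp add: L2_norm_sq)
    also have "\<dots> = (\<Sum>m<n. L2_inner f (hproj m f))"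
      unfolding harm_partial_def[abs_def] using f L2_hproj[OF f] by (intro L2_inner_sum_right)
    also have "\<dots> = (\<Sum>m<n. (L2_norm (hproj m f))\<^sup>2)"
      by (simp add: L2_norm_sq L2_inner_hproj[OF f hproj_harm[OF f]])
    finally show ?thesis .
  qed
  ultimately show ?thesis by simp
qed

lemma Parseval_harm:
  assumes f: "f \<in> L2"
  shows "(\<lambda>m. (L2_norm (hproj m f))\<^sup>2) sums (L2_norm f)\<^sup>2"
proof -
  have "(\<lambda>n. (L2_norm f)\<^sup>2 - (L2_norm (\<lambda>x. f x - harm_partial n f x))\<^sup>2) \<longlonglongrightarrow> (L2_norm f)\<^sup>2 - 0\<^sup>2"
    by (intro tendsto_intros harm_partial_tendsto f)
  then show ?thesis unfolding sums_def L2_norm_sub_harm_partial[OF f] by simp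
qed

text \<open>By Parseval the squared error is the sum over the degrees \<open>m \<ge> n\<close>,
  where the Sobolev weight is at least \<open>(1 + real n) powr (2 * p)\<close>.\<close>

lemma sobolev_tail:
  assumes f: "f \<in> sobolev p" and "p > 0"
  defines "D \<equiv> (\<Sum>m. (1 + real m) powr (2 * p) * (L2_norm (hproj m f))\<^sup>2)"
  shows "0 \<le> D" and "(L2_norm (\<lambda>x. f x - harm_partial n f x))\<^sup>2 \<le> (1 + real n) powr (- 2 * p) * D"
proof -
  have fL: "f \<in> L2" using f by (simp add: sobolev_def)
  let ?a = "\<lambda>m. (L2_norm (hproj m f))\<^sup>2"
  let ?b = "\<lambda>m. (1 + real m) powr (2 * p) * ?a m"
  have sb: "summable ?b" using f by (simp add: sobolev_def L2_norm_harmonic_proj[OF fL])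
  show D0: "0 \<le> D" unfolding D_def using sb by (intro suminf_nonneg) auto
  have sa: "summable ?a" using Parseval_harm[OF fL] by (rule sums_summable)
  have "(L2_norm f)\<^sup>2 = suminf ?a" using Parseval_harm[OF fL] by (rule sums_unique)
  then have "(L2_norm (\<lambda>x. f x - harm_partial n f x))\<^sup>2 = (\<Sum>m. ?a (m + n))"
    using suminf_split_initial_segment[OF sa, of n] by (simp add: L2_norm_sub_harm_partial[OF fL])
  also have "\<dots> \<le> (\<Sum>m. (1 + real n) powr (- 2 * p) * ?b (m + n))"
  proof (rule suminf_le)
    show "?a (m + n) \<le> (1 + real n) powr (- 2 * p) * ?b (m + n)" for m
    proof -
      have "1 = (1 + real n) powr (- 2 * p) * (1 + real n) powr (2 * p)"
        by (simp add: powr_add[symmetric])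
      also have "\<dots> \<le> (1 + real n) powr (- 2 * p) * (1 + real (m + n)) powr (2 * p)"
        using \<open>p > 0\<close> by (intro mult_left_mono powr_mono2) auto
      finally have "1 * ?a (m + n) \<le> ((1 + real n) powr (- 2 * p) * (1 + real (m + n)) powr (2 * p)) * ?a (m + n)"
        by (rule mult_right_mono) simp
      then show ?thesis by (simp add: mult.assoc)
    qed
    show "summable (\<lambda>m. ?a (m + n))" using sa by (rule summable_ignore_initial_segment)
    show "summable (\<lambda>m. (1 + real n) powr (- 2 * p) * ?b (m + n))"
      using sb by (intro summable_mult summable_ignore_initial_segment)
  qed
  also have "\<dots> = (1 + real n) powr (- 2 * p) * (\<Sum>m. ?b (m + n))"
    using sb by (intro suminf_mult summable_ignore_initial_segment)
  also have "(\<Sum>m. ?b (m + n)) \<le> D"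
    unfolding D_def using suminf_split_initial_segment[OF sb, of n] by (simp add: sum_nonneg)
  finally show "(L2_norm (\<lambda>x. f x - harm_partial n f x))\<^sup>2 \<le> (1 + real n) powr (- 2 * p) * D"
    by (simp add: mult_left_mono)
qed

section \<open>The forward operator\<close>

definition symbol :: "real \<Rightarrow> nat \<Rightarrow> real" where
  "symbol R m = (real m + 1) * (real m + 2) / R ^ (m + 3)"

lemma symbol_pos: "R > 1 \<Longrightarrow> symbol R m > 0"
  by (simp add: symbol_def)

text \<open>The extra \<open>m + 1\<close> anticipates the uniform bound for harmonics of degree
  \<open>m\<close>. Quotients of consecutive terms tend to \<open>1 / R\<close>, and
  \<open>c\<close> is the midpoint between \<open>1 / R\<close> and 1.\<close>

lemma summable_symbol:
  assumes R: "R > 1"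
  shows "summable (\<lambda>m. symbol R m * (real m + 1))"
proof -
  define c where "c = (1 + 1 / R) / 2"
  have c: "1 / R < c" "c < 1" using R by (auto simp: c_def field_simps)
  have lim: "(\<lambda>m. (real m + 2) * (real m + 3) * (real m + 2) / ((real m + 1) * (real m + 2) * (real m + 1)) / R) \<longlonglongrightarrow> 1 / R"
  proof -
    have "(\<lambda>m. (real m + 2) * (real m + 3) * (real m + 2) / ((real m + 1) * (real m + 2) * (real m + 1))) \<longlonglongrightarrow> 1"
      by real_asymp
    from tendsto_divide[OF this tendsto_const[of R]] R show ?thesis by simp
  qed
  then obtain N where N: "\<And>m. m \<ge> N \<Longrightarrow>
      (real m + 2) * (real m + 3) * (real m + 2) / ((real m + 1) * (real m + 2) * (real m + 1)) / R < c"
    using order_tendstoD(2)[OF lim c(1)] unfolding eventually_sequentially by blast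
  show ?thesis
  proof (rule summable_ratio_test[OF c(2), of N])
    fix m assume "m \<ge> N"
    let ?q = "(real m + 2) * (real m + 3) * (real m + 2) / ((real m + 1) * (real m + 2) * (real m + 1)) / R"
    have "norm (symbol R (Suc m) * (real (Suc m) + 1)) = ?q * norm (symbol R m * (real m + 1))"
    proof -
      have P: "R ^ (Suc m + 3) = R * R ^ (m + 3)" "R ^ (m + 3) > 0"
        using R by (simp_all only: add_Suc power_Suc zero_less_power order.strict_trans[OF zero_less_one])
      show ?thesis unfolding symbol_def P(1) using P(2) R
        by (simp add: abs_mult abs_of_pos divide_simps) (simp add: algebra_simps)
    qed
    also have "\<dots> \<le> c * norm (symbol R m * (real m + 1))"
      using N[OF \<open>m \<ge> N\<close>] by (intro mult_right_mono) auto
    finally show "norm (symbol R (Suc m) * (real (Suc m) + 1)) \<le> c * norm (symbol R m * (real m + 1))" .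
  qed
qed

lemma gradiometry_bounds:
  assumes R: "R > 1" and f: "f \<in> L2" and x: "norm x = 1"
  shows "\<bar>symbol R m * hproj m f x\<bar> \<le> L2_norm f * (symbol R m * (real m + 1))"
    and "summable (\<lambda>m. \<bar>symbol R m * hproj m f x\<bar>)"
    and "(\<lambda>m. symbol R m * hproj m f x) sums gradiometry R f x"
proof -
  show b: "\<bar>symbol R m * hproj m f x\<bar> \<le> L2_norm f * (symbol R m * (real m + 1))" for m
  proof -
    have "\<bar>hproj m f x\<bar> \<le> (real m + 1) * L2_norm (hproj m f)"
      using hom_poly_sup_bound[OF harmonic_polyD(1)[OF hproj_harm[OF f]] x] .
    also have "\<dots> \<le> (real m + 1) * L2_norm f"
      using L2_norm_hproj_le[OF f] by (intro mult_left_mono) auto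
    finally have "symbol R m * \<bar>hproj m f x\<bar> \<le> symbol R m * ((real m + 1) * L2_norm f)"
      using symbol_pos[OF R, of m] by (intro mult_left_mono) auto
    then show ?thesis using symbol_pos[OF R, of m] by (simp add: abs_mult mult_ac)
  qed
  show s: "summable (\<lambda>m. \<bar>symbol R m * hproj m f x\<bar>)"
    by (rule summable_comparison_test'[OF summable_mult[OF summable_symbol[OF R], of "L2_norm f"], of 0])
      (use b in simp)
  have "(\<lambda>m. symbol R m * hproj m f x) sums (\<Sum>m. symbol R m * hproj m f x)"
    using summable_rabs_cancel[OF s] by (rule summable_sums)
  also have "(\<Sum>m. symbol R m * hproj m f x) = gradiometry R f x"
    unfolding gradiometry_def symbol_def using x by (simp add: harmonic_proj_eq[OF f])
  finally show "(\<lambda>m. symbol R m * hproj m f x) sums gradiometry R f x" .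
qed

lemma gradiometry_diff:
  assumes R: "R > 1" and f: "f \<in> L2" and g: "g \<in> L2" and x: "norm x = 1"
  shows "gradiometry R (\<lambda>x. f x - g x) x = gradiometry R f x - gradiometry R g x"
proof -
  have "(\<lambda>m. symbol R m * hproj m f x - symbol R m * hproj m g x) sums (gradiometry R f x - gradiometry R g x)"
    using gradiometry_bounds(3)[OF R f x] gradiometry_bounds(3)[OF R g x] by (rule sums_diff)
  then have "(\<lambda>m. symbol R m * hproj m (\<lambda>x. f x - g x) x) sums (gradiometry R f x - gradiometry R g x)"
    by (simp add: hproj_diff[OF f g] right_diff_distrib)
  then show ?thesis
    using gradiometry_bounds(3)[OF R L2_diff[OF f g] x] sums_unique2 by blast
qed

lemma borel_measurable_hproj: "f \<in> L2 \<Longrightarrow> hproj m f \<in> borel_measurable S2"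
  using L2D(1) L2_hproj by blast

text \<open>With \<open>n = 0\<close> this bounds \<open>gradiometry R f\<close> uniformly on the
  sphere; for general \<open>n\<close> it is the dominating constant in the convergence of the
  partial sums.\<close>

lemma gradiometry_bounded:
  assumes R: "R > 1" and f: "f \<in> L2" and x: "norm x = 1"
  shows "\<bar>gradiometry R f x - (\<Sum>m<n. symbol R m * hproj m f x)\<bar> \<le> L2_norm f * (\<Sum>m. symbol R m * (real m + 1))"
proof -
  let ?a = "\<lambda>m. symbol R m * hproj m f x"
  note s = gradiometry_bounds(2)[OF R f x]
  note ss = summable_symbol[OF R]
  have sum_abs: "summable ?a" using s by (rule summable_rabs_cancel)
  have "gradiometry R f x - (\<Sum>m<n. ?a m) = (\<Sum>m. ?a (m + n))"
    using suminf_split_initial_segment[OF sum_abs, of n] sums_unique[OF gradiometry_bounds(3)[OF R f x]] by simp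
  also have "\<bar>\<dots>\<bar> \<le> (\<Sum>m. \<bar>?a (m + n)\<bar>)"
    using summable_ignore_initial_segment[OF s] by (rule summable_rabs)
  also have "\<dots> \<le> (\<Sum>m. \<bar>?a m\<bar>)"
    using suminf_split_initial_segment[OF s, of n] by (simp add: sum_nonneg)
  also have "\<dots> \<le> (\<Sum>m. L2_norm f * (symbol R m * (real m + 1)))"
    using s ss gradiometry_bounds(1)[OF R f x] by (intro suminf_le summable_mult) auto
  also have "\<dots> = L2_norm f * (\<Sum>m. symbol R m * (real m + 1))" using ss by (rule suminf_mult)
  finally show ?thesis .
qed

lemma borel_measurable_gradiometry:
  assumes R: "R > 1" and f: "f \<in> L2"
  shows "gradiometry R f \<in> borel_measurable S2"
proof -
  have "(\<lambda>x. \<Sum>m. symbol R m * hproj m f x) \<in> borel_measurable S2"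
    using borel_measurable_hproj[OF f] by measurable
  moreover have "gradiometry R f x = (\<Sum>m. symbol R m * hproj m f x)" if "x \<in> space S2" for x
    using sums_unique[OF gradiometry_bounds(3)[OF R f, of x]] that by (simp add: space_S2)
  ultimately show ?thesis by (simp cong: measurable_cong)
qed

lemma L2_gradiometry:
  assumes R: "R > 1" and f: "f \<in> L2"
  shows "gradiometry R f \<in> L2"
  using gradiometry_bounded[OF R f, of _ 0]
  by (intro L2_bounded[OF borel_measurable_gradiometry[OF R f]]) simp

lemma integrable_gradiometry:
  assumes R: "R > 1" and f: "f \<in> L2"
  shows "integrable S2 (gradiometry R f)"
  using integrable_mult_L2[OF L2_gradiometry[OF R f] L2_continuous[of "\<lambda>x. 1"]] by simp

text \<open>By orthogonality the pairing with a harmonic of degree \<open>m\<close> is the same for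
  all partial sums longer than \<open>m\<close>; their convergence in norm passes it to the
  limit.\<close>

lemma L2_inner_gradiometry:
  assumes R: "R > 1" and f: "f \<in> L2" and Y: "Y \<in> harmonic_poly m"
  shows "L2_inner (gradiometry R f) Y = symbol R m * L2_inner (hproj m f) Y"
proof -
  let ?s = "\<lambda>n x. \<Sum>k<n. symbol R k * hproj k f x"
  let ?T = "gradiometry R f"
  have sL: "?s n \<in> L2" for n using L2_hproj[OF f] by (intro L2_sum L2_cmult)
  note TL = L2_gradiometry[OF R f]
  note YL = L2_harm[OF Y]
  have lim: "(\<lambda>n. L2_norm (\<lambda>x. ?T x - ?s n x)) \<longlonglongrightarrow> 0"
  proof (rule L2_dominated_convergence)
    show "?s n \<in> borel_measurable S2" for n using L2D(1)[OF sL] .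
    show "?T \<in> borel_measurable S2" using L2D(1)[OF TL] .
    show "(\<lambda>x. L2_norm f * (\<Sum>m. symbol R m * (real m + 1))) \<in> L2" by (rule L2_continuous) simp
    show "(\<lambda>n. ?s n x) \<longlonglongrightarrow> ?T x" if "norm x = 1" for x
      using gradiometry_bounds(3)[OF R f that] by (simp add: sums_def)
    show "\<bar>?T x - ?s n x\<bar> \<le> L2_norm f * (\<Sum>m. symbol R m * (real m + 1))" if "norm x = 1" for n x
      using gradiometry_bounded[OF R f that] .
  qed
  have sY: "L2_inner (?s n) Y = symbol R m * L2_inner (hproj m f) Y" if "n > m" for n
  proof -
    have "L2_inner (?s n) Y = (\<Sum>k<n. symbol R k * L2_inner (hproj k f) Y)"
      using L2_hproj[OF f] YL by (subst L2_inner_sum_left) (auto simp: L2_cmult L2_inner_cmult_left)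
    also have "\<dots> = (\<Sum>k<n. if k = m then symbol R m * L2_inner (hproj m f) Y else 0)"
      using harm_orthogonal[OF hproj_harm[OF f] Y] by (intro sum.cong) auto
    finally show ?thesis using that by simp
  qed
  have "(\<lambda>n. L2_norm (\<lambda>x. ?T x - ?s n x) * L2_norm Y) \<longlonglongrightarrow> 0 * L2_norm Y"
    by (intro tendsto_intros lim)
  moreover have "eventually (\<lambda>n. \<bar>L2_inner ?T Y - symbol R m * L2_inner (hproj m f) Y\<bar>
      \<le> L2_norm (\<lambda>x. ?T x - ?s n x) * L2_norm Y) sequentially"
  proof (rule eventually_sequentiallyI[of "Suc m"])
    fix n assume "n \<ge> Suc m"
    then have "L2_inner ?T Y - symbol R m * L2_inner (hproj m f) Y = L2_inner (\<lambda>x. ?T x - ?s n x) Y"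
      using L2_inner_diff_left[OF TL sL YL, of n] sY[of n] by simp
    then show "\<bar>L2_inner ?T Y - symbol R m * L2_inner (hproj m f) Y\<bar>
      \<le> L2_norm (\<lambda>x. ?T x - ?s n x) * L2_norm Y"
      using L2_Cauchy_Schwarz[OF L2_diff[OF TL sL] YL, of n] by simp
  qed
  ultimately have "\<bar>L2_inner ?T Y - symbol R m * L2_inner (hproj m f) Y\<bar> \<le> 0 * L2_norm Y"
    by (rule tendsto_lowerbound) simp
  then show ?thesis by simp
qed

lemma L1_norm_on_eq: "A \<in> sets S2 \<Longrightarrow> L1_norm_on A f = (LINT x|S2. indicator A x * \<bar>f x\<bar>)"
  by (simp add: L1_norm_on_def set_lebesgue_integral_def)

lemma L1_norm_eq: "L1_norm f = (LINT x|S2. \<bar>f x\<bar>)"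
  unfolding L1_norm_on_def set_lebesgue_integral_def
  by (rule Bochner_Integration.integral_cong) (auto simp: space_S2)

lemma L1_norm_nonneg [simp]: "0 \<le> L1_norm f"
  by (simp add: L1_norm_eq)

text \<open>Pairing \<open>gradiometry R f\<close> with \<open>hproj m f\<close> gives
  \<open>symbol R m\<close> times a squared norm, and is at most the \<open>L1_norm\<close> times
  the maximum of \<open>hproj m f\<close>. The \<open>m + 1\<close> in the bound of that maximum
  cancels against the symbol.\<close>

lemma L2_norm_hproj_le_L1_gradiometry:
  assumes R: "R > 1" and f: "f \<in> L2"
  shows "L2_norm (hproj m f) \<le> R ^ (m + 3) * L1_norm (gradiometry R f)"
proof -
  let ?Q = "hproj m f" and ?T = "gradiometry R f"
  have Q: "?Q \<in> harmonic_poly m" using hproj_harm[OF f] .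
  have "symbol R m * (L2_norm ?Q)\<^sup>2 = L2_inner ?T ?Q"
    using L2_inner_gradiometry[OF R f Q] by (simp add: L2_norm_sq)
  also have "\<dots> \<le> (LINT x|S2. \<bar>?T x\<bar> * ((real m + 1) * L2_norm ?Q))"
    unfolding L2_inner_def
  proof (rule integral_mono)
    show "integrable S2 (\<lambda>x. ?T x * ?Q x)" using integrable_mult_L2[OF L2_gradiometry[OF R f] L2_hproj[OF f]] .
    show "integrable S2 (\<lambda>x. \<bar>?T x\<bar> * ((real m + 1) * L2_norm ?Q))"
      using integrable_gradiometry[OF R f] by simp
    fix x assume "x \<in> space S2"
    then have "\<bar>?Q x\<bar> \<le> (real m + 1) * L2_norm ?Q"
      using hom_poly_sup_bound[OF harmonic_polyD(1)[OF Q], of x] by (simp add: space_S2)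
    then have "\<bar>?T x\<bar> * \<bar>?Q x\<bar> \<le> \<bar>?T x\<bar> * ((real m + 1) * L2_norm ?Q)" by (rule mult_left_mono) simp
    then show "?T x * ?Q x \<le> \<bar>?T x\<bar> * ((real m + 1) * L2_norm ?Q)"
      using abs_ge_self[of "?T x * ?Q x"] by (simp add: abs_mult)
  qed
  also have "\<dots> = L1_norm ?T * ((real m + 1) * L2_norm ?Q)" by (simp add: L1_norm_eq)
  finally have le: "symbol R m * L2_norm ?Q * L2_norm ?Q \<le> L1_norm ?T * (real m + 1) * L2_norm ?Q"
    by (simp add: power2_eq_square mult_ac)
  show ?thesis
  proof (cases "L2_norm ?Q = 0")
    case True
    then show ?thesis using R by simp
  next
    case False
    then have "L2_norm ?Q > 0" using L2_norm_nonneg[of ?Q] by linarith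
    with le have "symbol R m * L2_norm ?Q \<le> L1_norm ?T * (real m + 1)"
      by (simp add: mult_le_cancel_right)
    then have "(real m + 1) * ((real m + 2) * L2_norm ?Q) \<le> (real m + 1) * (R ^ (m + 3) * L1_norm ?T)"
      using R by (simp add: symbol_def field_simps)
    then have "(real m + 2) * L2_norm ?Q \<le> R ^ (m + 3) * L1_norm ?T"
      by (simp add: mult_le_cancel_left)
    moreover have "1 * L2_norm ?Q \<le> (real m + 2) * L2_norm ?Q" by (intro mult_right_mono) auto
    ultimately show ?thesis by simp
  qed
qed

text \<open>A variational source condition with free cutoff \<open>n\<close>. The exponential loss
  in the low degrees sums to a geometric series, whence \<open>R ^ n - 1\<close>. At
  \<open>n = 0\<close> the first term disappears, which later gives a bound for arbitrary
  \<open>\<alpha>\<close>.\<close>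

lemma source_condition:
  assumes R: "R > 1" and f: "f \<in> sobolev p" and "p > 0"
  obtains A D where "A \<ge> 0" "D \<ge> 0"
    "\<And>h n. h \<in> L2 \<Longrightarrow> - 2 * L2_inner f h
      \<le> A * (R ^ n - 1) * L1_norm (gradiometry R h) + 2 * (D * (1 + real n) powr (- p)) * L2_norm h"
proof -
  have fL: "f \<in> L2" using f by (simp add: sobolev_def)
  define D2 where "D2 = (\<Sum>m. (1 + real m) powr (2 * p) * (L2_norm (hproj m f))\<^sup>2)"
  define A where "A = 2 * L2_norm f * R ^ 3 / (R - 1)"
  have D2: "0 \<le> D2" "\<And>n. (L2_norm (\<lambda>x. f x - harm_partial n f x))\<^sup>2 \<le> (1 + real n) powr (- 2 * p) * D2"
    using sobolev_tail[OF f \<open>p > 0\<close>] unfolding D2_def by auto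
  have "- 2 * L2_inner f h \<le> A * (R ^ n - 1) * L1_norm (gradiometry R h)
      + 2 * (sqrt D2 * (1 + real n) powr (- p)) * L2_norm h" if h: "h \<in> L2" for h n
  proof -
    let ?t = "L1_norm (gradiometry R h)"
    have "L2_inner f h = L2_inner (\<lambda>x. f x - harm_partial n f x) h + L2_inner (harm_partial n f) h"
      using L2_inner_diff_left[OF fL L2_harm_partial[OF fL] h] by simp
    moreover have "\<bar>L2_inner (\<lambda>x. f x - harm_partial n f x) h\<bar> \<le> (sqrt D2 * (1 + real n) powr (- p)) * L2_norm h"
    proof -
      have "(L2_norm (\<lambda>x. f x - harm_partial n f x))\<^sup>2 \<le> (sqrt D2 * (1 + real n) powr (- p))\<^sup>2"
        using D2(2)[of n] D2(1)
        by (simp add: power_mult_distrib powr_power mult.commute)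
      then have "L2_norm (\<lambda>x. f x - harm_partial n f x) \<le> sqrt D2 * (1 + real n) powr (- p)"
        by (rule power2_le_imp_le) (simp add: D2(1))
      then have "L2_norm (\<lambda>x. f x - harm_partial n f x) * L2_norm h \<le> (sqrt D2 * (1 + real n) powr (- p)) * L2_norm h"
        by (rule mult_right_mono) simp
      then show ?thesis
        using L2_Cauchy_Schwarz[OF L2_diff[OF fL L2_harm_partial[OF fL, of n]] h] by linarith
    qed
    moreover have "2 * \<bar>L2_inner (harm_partial n f) h\<bar> \<le> A * (R ^ n - 1) * ?t"
    proof -
      have "L2_inner (harm_partial n f) h = (\<Sum>m<n. L2_inner (hproj m f) h)"
        unfolding harm_partial_def[abs_def] using L2_hproj[OF fL] h by (intro L2_inner_sum_left)
      also have "\<bar>\<dots>\<bar> \<le> (\<Sum>m<n. \<bar>L2_inner (hproj m f) h\<bar>)" by (rule sum_abs)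
      also have "\<dots> \<le> (\<Sum>m<n. L2_norm f * (R ^ 3 * ?t) * R ^ m)"
      proof (rule sum_mono)
        fix m
        have "L2_inner (hproj m f) h = L2_inner (hproj m f) (hproj m h)"
          using L2_inner_hproj[OF h hproj_harm[OF fL, of m]] by (simp add: L2_inner_commute[of "hproj m f"])
        also have "\<bar>\<dots>\<bar> \<le> L2_norm (hproj m f) * L2_norm (hproj m h)"
          using L2_Cauchy_Schwarz[OF L2_hproj[OF fL] L2_hproj[OF h]] .
        also have "\<dots> \<le> L2_norm f * (R ^ (m + 3) * ?t)"
          using L2_norm_hproj_le[OF fL] L2_norm_hproj_le_L1_gradiometry[OF R h] by (intro mult_mono) auto
        finally show "\<bar>L2_inner (hproj m f) h\<bar> \<le> L2_norm f * (R ^ 3 * ?t) * R ^ m"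
          by (simp add: power_add mult_ac)
      qed
      also have "\<dots> = L2_norm f * (R ^ 3 * ?t) * (\<Sum>m<n. R ^ m)" by (simp add: sum_distrib_left)
      also have "(\<Sum>m<n. R ^ m) = (R ^ n - 1) / (R - 1)" using R by (simp add: geometric_sum)
      finally have "2 * \<bar>L2_inner (harm_partial n f) h\<bar> \<le> 2 * (L2_norm f * (R ^ 3 * ?t) * ((R ^ n - 1) / (R - 1)))"
        by linarith
      also have "\<dots> = A * (R ^ n - 1) * ?t" by (simp add: A_def)
      finally show ?thesis .
    qed
    ultimately show ?thesis by linarith
  qed
  moreover have "A \<ge> 0" "sqrt D2 \<ge> 0" using R D2(1) by (simp_all add: A_def)
  ultimately show ?thesis using that by blast
qed

section \<open>Error estimates\<close>

lemma L1_norm_cong: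
  assumes "\<And>x. norm x = 1 \<Longrightarrow> f x = g x"
  shows "L1_norm f = L1_norm g"
  unfolding L1_norm_eq by (rule Bochner_Integration.integral_cong) (auto simp: space_S2 assms)

lemma basic_inequality:
  assumes R: "R > 1" and fd: "fd \<in> L2" and "\<alpha> > 0" "\<eta> > 0" and noise: "impulsive_noise \<epsilon> \<eta> \<xi>"
    and min: "is_minimizer R \<alpha> (\<lambda>x. gradiometry R fd x + \<xi> x) f"
    and G: "G \<ge> 0" and Linf: "Linf_norm (gradiometry R (\<lambda>x. f x - fd x))
      \<le> ereal (G * L2_norm (\<lambda>x. f x - fd x) + 1 / (3 * \<eta>) * L1_norm (gradiometry R (\<lambda>x. f x - fd x)))"
  shows "f \<in> L2"
    and "1 / 3 * L1_norm (gradiometry R (\<lambda>x. f x - fd x)) + \<alpha> * ((L2_norm f)\<^sup>2 - (L2_norm fd)\<^sup>2)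
      \<le> 2 * (\<eta> * G) * L2_norm (\<lambda>x. f x - fd x) + 2 * \<epsilon>"
proof -
  show f: "f \<in> L2" using min by (simp add: is_minimizer_def is_arg_min_def)
  let ?h = "\<lambda>x. f x - fd x"
  let ?u = "gradiometry R ?h"
  let ?g = "\<lambda>x. gradiometry R fd x + \<xi> x"
  define B where "B = G * L2_norm ?h + 1 / (3 * \<eta>) * L1_norm ?u"
  have hL: "?h \<in> L2" using f fd by (rule L2_diff)
  have iu: "integrable S2 ?u" using integrable_gradiometry[OF R hL] .
  have ixi: "integrable S2 \<xi>" using noise by (simp add: impulsive_noise_def)
  obtain P where P: "P \<in> sets S2" "L1_norm_on (sphere 0 1 - P) \<xi> \<le> \<epsilon>" "measure S2 P \<le> \<eta>"
    using noise by (auto simp: impulsive_noise_def)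
  have Pc: "sphere 0 1 - P \<in> sets S2" using P(1) sets.compl_sets[of P S2] by (simp add: space_S2)
  have "tikhonov R \<alpha> ?g f \<le> tikhonov R \<alpha> ?g fd"
    using min fd by (auto simp: is_minimizer_def is_arg_min_def not_less)
  moreover have "L1_norm (\<lambda>x. gradiometry R f x - ?g x) = (LINT x|S2. \<bar>?u x - \<xi> x\<bar>)"
    unfolding L1_norm_eq[symmetric] by (rule L1_norm_cong) (simp add: gradiometry_diff[OF R f fd])
  moreover have "L1_norm (\<lambda>x. gradiometry R fd x - ?g x) = (LINT x|S2. \<bar>\<xi> x\<bar>)"
    by (simp add: L1_norm_eq)
  ultimately have 0: "(LINT x|S2. \<bar>?u x - \<xi> x\<bar>) / \<alpha> + (L2_norm f)\<^sup>2 \<le> (LINT x|S2. \<bar>\<xi> x\<bar>) / \<alpha> + (L2_norm fd)\<^sup>2"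
    by (simp add: tikhonov_def)
  have 1: "(LINT x|S2. \<bar>?u x - \<xi> x\<bar>) + \<alpha> * (L2_norm f)\<^sup>2 \<le> (LINT x|S2. \<bar>\<xi> x\<bar>) + \<alpha> * (L2_norm fd)\<^sup>2"
    using mult_left_mono[OF 0, of \<alpha>] \<open>\<alpha> > 0\<close> by (simp add: distrib_left)
  have iP: "integrable S2 (\<lambda>x. indicator P x * \<bar>?u x\<bar>)"
    using integrable_mult_indicator[OF P(1) integrable_abs[OF iu]] by simp
  have iPc: "integrable S2 (\<lambda>x. indicator (sphere 0 1 - P) x * \<bar>\<xi> x\<bar>)"
    using integrable_mult_indicator[OF Pc integrable_abs[OF ixi]] by simp
  \<comment> \<open>The reverse triangle inequality is used in the form
    \<open>\<bar>\<xi>\<bar> - \<bar>u\<bar>\<close> on \<open>P\<close> and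
    \<open>\<bar>u\<bar> - \<bar>\<xi>\<bar>\<close> off \<open>P\<close>; the two subtracted
    indicator terms express both cases at once.\<close>
  have "(LINT x|S2. \<bar>\<xi> x\<bar> + \<bar>?u x\<bar> - 2 * (indicator P x * \<bar>?u x\<bar>)
      - 2 * (indicator (sphere 0 1 - P) x * \<bar>\<xi> x\<bar>)) \<le> (LINT x|S2. \<bar>?u x - \<xi> x\<bar>)"
    using iu ixi iP iPc by (intro integral_mono) (auto simp: space_S2 indicator_def)
  then have 2: "(LINT x|S2. \<bar>\<xi> x\<bar>) + L1_norm ?u - 2 * (LINT x|S2. indicator P x * \<bar>?u x\<bar>)
      - 2 * L1_norm_on (sphere 0 1 - P) \<xi> \<le> (LINT x|S2. \<bar>?u x - \<xi> x\<bar>)"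
    using iu ixi iP iPc by (simp add: L1_norm_eq L1_norm_on_eq[OF Pc])
  have B0: "B \<ge> 0" using G \<open>\<eta> > 0\<close> by (simp add: B_def)
  have "AE x in S2. ereal \<bar>?u x\<bar> \<le> Linf_norm ?u" unfolding Linf_norm_def by (rule esssup_AE)
  then have "AE x in S2. indicator P x * \<bar>?u x\<bar> \<le> indicator P x * B"
  proof eventually_elim
    case (elim x)
    then have "ereal \<bar>?u x\<bar> \<le> ereal B" using Linf unfolding B_def by (rule order_trans)
    then show ?case by (intro mult_left_mono) auto
  qed
  moreover have iI: "integrable S2 (indicator P :: _ \<Rightarrow> real)"
    using P(1) S2.emeasure_finite[of P] by (intro integrable_real_indicator) (simp_all only: less_top infinity_ennreal_def)
  ultimately have "(LINT x|S2. indicator P x * \<bar>?u x\<bar>) \<le> (LINT x|S2. indicator P x * B)"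
    using iP iI by (intro integral_mono_AE) simp_all
  also have "\<dots> = measure S2 P * B" using P(1) by simp
  also have "\<dots> \<le> \<eta> * B" using P(3) B0 by (rule mult_right_mono)
  \<comment> \<open>This integral enters doubled, so its last term uses up 2/3 of
    \<open>L1_norm ?u\<close> and leaves the coefficient \<open>1 / 3\<close>.\<close>
  also have "\<dots> = \<eta> * G * L2_norm ?h + L1_norm ?u / 3"
    using \<open>\<eta> > 0\<close> by (simp add: B_def field_simps)
  finally show "1 / 3 * L1_norm ?u + \<alpha> * ((L2_norm f)\<^sup>2 - (L2_norm fd)\<^sup>2)
      \<le> 2 * (\<eta> * G) * L2_norm ?h + 2 * \<epsilon>"
    using 1 2 P(2) by (simp add: right_diff_distrib)
qed

text \<open>Here \<open>H\<close> and \<open>t\<close> stand for the error norms in domain and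
  image, and \<open>I\<close> for the inner product of the exact solution with the error. The
  condition \<open>\<alpha> * A \<le> 1 / 6\<close> lets half of \<open>t / 3\<close> absorb the low
  degrees. The two terms linear in \<open>H\<close> cost \<open>\<alpha> * H\<^sup>2 / 4\<close>
  each, so half of \<open>\<alpha> * H\<^sup>2\<close> survives.\<close>

lemma young_absorption:
  fixes t H \<alpha> g \<epsilon> I A d :: real
  assumes "\<alpha> > 0" "t \<ge> 0"
    and b: "1 / 3 * t + \<alpha> * (H\<^sup>2 + 2 * I) \<le> 2 * g * H + 2 * \<epsilon>"
    and s: "- 2 * I \<le> A * t + 2 * d * H" and A: "\<alpha> * A \<le> 1 / 6"
  shows "H\<^sup>2 \<le> 8 * d\<^sup>2 + 8 * (g\<^sup>2 / \<alpha>\<^sup>2) + 4 * (\<epsilon> / \<alpha>)"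
    and "t \<le> 24 * \<alpha> * d\<^sup>2 + 24 * (g\<^sup>2 / \<alpha>) + 12 * \<epsilon>"
proof -
  have "\<alpha> * (- 2 * I) \<le> \<alpha> * (A * t + 2 * d * H)" using s \<open>\<alpha> > 0\<close> by (intro mult_left_mono) auto
  moreover have "\<alpha> * A * t \<le> 1 / 6 * t" using A \<open>t \<ge> 0\<close> by (rule mult_right_mono)
  ultimately have 1: "1 / 6 * t + \<alpha> * H\<^sup>2 \<le> 2 * \<alpha> * d * H + 2 * g * H + 2 * \<epsilon>"
    using b by (simp add: algebra_simps)
  have "0 \<le> \<alpha> * (H / 2 - 2 * d)\<^sup>2" using \<open>\<alpha> > 0\<close> by simp
  then have 2: "2 * \<alpha> * d * H \<le> \<alpha> * H\<^sup>2 / 4 + 4 * \<alpha> * d\<^sup>2"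
    by (simp add: power2_eq_square algebra_simps)
  have "0 \<le> \<alpha> * (H / 2 - 2 * (g / \<alpha>))\<^sup>2" using \<open>\<alpha> > 0\<close> by simp
  also have "\<dots> = \<alpha> * H\<^sup>2 / 4 + 4 * (g\<^sup>2 / \<alpha>) - 2 * g * H"
    using \<open>\<alpha> > 0\<close> by (simp add: power2_eq_square field_simps)
  finally have 3: "1 / 6 * t + \<alpha> * H\<^sup>2 / 2 \<le> 4 * \<alpha> * d\<^sup>2 + 4 * (g\<^sup>2 / \<alpha>) + 2 * \<epsilon>"
    using 1 2 by simp
  then show "t \<le> 24 * \<alpha> * d\<^sup>2 + 24 * (g\<^sup>2 / \<alpha>) + 12 * \<epsilon>"
    using mult_nonneg_nonneg[OF less_imp_le[OF \<open>\<alpha> > 0\<close>] zero_le_power2[of H]] by linarith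
  have "\<alpha> * (8 * d\<^sup>2 + 8 * (g\<^sup>2 / \<alpha>\<^sup>2) + 4 * (\<epsilon> / \<alpha>)) = 2 * (4 * \<alpha> * d\<^sup>2 + 4 * (g\<^sup>2 / \<alpha>) + 2 * \<epsilon>)"
    using \<open>\<alpha> > 0\<close> by (simp add: power2_eq_square distrib_left)
  moreover have "\<alpha> * H\<^sup>2 \<le> 2 * X" if "1 / 6 * t + \<alpha> * H\<^sup>2 / 2 \<le> X" for X
    using that \<open>t \<ge> 0\<close> by linarith
  ultimately have "\<alpha> * H\<^sup>2 \<le> \<alpha> * (8 * d\<^sup>2 + 8 * (g\<^sup>2 / \<alpha>\<^sup>2) + 4 * (\<epsilon> / \<alpha>))"
    using 3 by metis
  then show "H\<^sup>2 \<le> 8 * d\<^sup>2 + 8 * (g\<^sup>2 / \<alpha>\<^sup>2) + 4 * (\<epsilon> / \<alpha>)"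
    using \<open>\<alpha> > 0\<close> by simp
qed

text \<open>Splitting the source condition at degree \<open>n \<approx> - ln \<alpha> / (2 * ln R)\<close> keeps \<open>\<alpha> * R ^ n\<close> of order
  \<open>sqrt \<alpha>\<close>, while the tail is of order \<open>(- ln \<alpha>) powr (- p)\<close>.\<close>

lemma cutoff_degree:
  fixes R \<alpha> p A :: real
  assumes R: "R > 1" and "p > 0" "A \<ge> 0" and \<alpha>: "0 < \<alpha>" "\<alpha> < 1" "\<alpha> \<le> (1 / (6 * A + 1))\<^sup>2"
  obtains n :: nat where "\<alpha> * (A * (R ^ n - 1)) \<le> 1 / 6"
    "((1 + real n) powr (- p))\<^sup>2 \<le> (2 * ln R) powr (2 * p) * (- ln \<alpha>) powr (- 2 * p)"
proof
  define L where "L = - ln \<alpha> / (2 * ln R)"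
  define n where "n = nat \<lfloor>L\<rfloor>"
  have lR: "ln R > 0" using R by simp
  have la: "- ln \<alpha> > 0" using \<alpha> by simp
  have L: "L > 0" unfolding L_def using lR la by (intro divide_pos_pos) auto
  have n: "real n \<le> L" "L \<le> 1 + real n"
    using L real_of_int_floor_add_one_ge[of L] unfolding n_def by (simp_all add: add.commute)
  have "R ^ n = R powr real n" using R by (simp add: powr_realpow)
  also have "\<dots> \<le> R powr L" using R n by (intro powr_mono) auto
  also have "\<dots> = exp (- ln \<alpha> / 2)" using R lR by (simp add: powr_def L_def)
  finally have Rn: "R ^ n \<le> exp (- ln \<alpha> / 2)" .
  have sq: "\<alpha> * exp (- ln \<alpha> / 2) = sqrt \<alpha>"
  proof -
    have "\<alpha> * exp (- ln \<alpha> / 2) = exp (ln \<alpha>) * exp (- ln \<alpha> / 2)" using \<alpha> by simp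
    also have "\<dots> = exp (ln \<alpha> / 2)" by (simp add: exp_add[symmetric])
    also have "\<dots> = sqrt \<alpha>" using \<alpha> by (simp add: powr_half_sqrt[symmetric] powr_def)
    finally show ?thesis .
  qed
  have "sqrt \<alpha> \<le> 1 / (6 * A + 1)"
    using real_sqrt_le_mono[OF \<alpha>(3)] \<open>A \<ge> 0\<close> by simp
  then have sA: "sqrt \<alpha> * (6 * A + 1) \<le> 1" using \<open>A \<ge> 0\<close> by (simp add: field_simps)
  have "\<alpha> * (A * (R ^ n - 1)) \<le> \<alpha> * (A * exp (- ln \<alpha> / 2))"
    using Rn \<alpha> \<open>A \<ge> 0\<close> by (intro mult_left_mono) auto
  also have "\<dots> = A * sqrt \<alpha>" using sq by (simp add: mult_ac)
  also have "\<dots> \<le> 1 / 6"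
  proof -
    have "6 * (A * sqrt \<alpha>) + sqrt \<alpha> \<le> 1" using sA by (simp add: algebra_simps)
    moreover have "sqrt \<alpha> \<ge> 0" using \<alpha> by simp
    ultimately show ?thesis by linarith
  qed
  finally show "\<alpha> * (A * (R ^ n - 1)) \<le> 1 / 6" .
  have "((1 + real n) powr (- p))\<^sup>2 = (1 + real n) powr (- 2 * p)"
    by (simp add: powr_power)
  also have "\<dots> \<le> L powr (- 2 * p)" using n L \<open>p > 0\<close> by (intro powr_mono2') auto
  also have "\<dots> = (- ln \<alpha>) powr (- 2 * p) / (2 * ln R) powr (- 2 * p)"
    unfolding L_def by (rule powr_divide)
  also have "\<dots> = (2 * ln R) powr (2 * p) * (- ln \<alpha>) powr (- 2 * p)"
    by (simp add: powr_minus_divide)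
  finally show "((1 + real n) powr (- p))\<^sup>2 \<le> (2 * ln R) powr (2 * p) * (- ln \<alpha>) powr (- 2 * p)" .
qed

text \<open>The bounds with the constant \<open>D\<close> hold for every
  \<open>\<alpha> > 0\<close>, those with \<open>log_rate\<close> for small \<open>\<alpha>\<close>.
  The former serve noise levels at which the parameter is not small.\<close>

lemma error_estimate:
  assumes R: "R > 1" and fd: "fd \<in> sobolev p" and "p > 0"
  obtains C \<alpha>\<^sub>0 D :: real where "C > 0" "0 < \<alpha>\<^sub>0" "\<alpha>\<^sub>0 < 1" "D \<ge> 0"
    "\<forall>f \<alpha> g \<epsilon>. f \<in> L2 \<longrightarrow> \<alpha> > 0 \<longrightarrow> \<epsilon> \<ge> 0 \<longrightarrow>
      1 / 3 * L1_norm (gradiometry R (\<lambda>x. f x - fd x)) + \<alpha> * ((L2_norm f)\<^sup>2 - (L2_norm fd)\<^sup>2)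
        \<le> 2 * g * L2_norm (\<lambda>x. f x - fd x) + 2 * \<epsilon> \<longrightarrow>
      (L2_norm (\<lambda>x. f x - fd x))\<^sup>2 \<le> 8 * D + 8 * (g\<^sup>2 / \<alpha>\<^sup>2) + 4 * (\<epsilon> / \<alpha>) \<and>
      L1_norm (\<lambda>x. gradiometry R f x - gradiometry R fd x) \<le> 24 * \<alpha> * D + 24 * (g\<^sup>2 / \<alpha>) + 12 * \<epsilon> \<and>
      (\<alpha> < \<alpha>\<^sub>0 \<longrightarrow>
        (L2_norm (\<lambda>x. f x - fd x))\<^sup>2 \<le> C * (\<epsilon> / \<alpha> + g\<^sup>2 / \<alpha>\<^sup>2 + log_rate p \<alpha>) \<and>
        L1_norm (\<lambda>x. gradiometry R f x - gradiometry R fd x) \<le> C * (\<epsilon> + g\<^sup>2 / \<alpha> + \<alpha> * log_rate p \<alpha>))"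
proof -
  have fdL: "fd \<in> L2" using fd by (simp add: sobolev_def)
  obtain A D where A: "A \<ge> 0" "D \<ge> 0" and src: "\<And>h n. h \<in> L2 \<Longrightarrow> - 2 * L2_inner fd h
      \<le> A * (R ^ n - 1) * L1_norm (gradiometry R h) + 2 * (D * (1 + real n) powr (- p)) * L2_norm h"
    using source_condition[OF R fd \<open>p > 0\<close>] by metis
  define E where "E = D\<^sup>2 * (2 * ln R) powr (2 * p)"
  define C where "C = 24 * E + 24"
  \<comment> \<open>The first entry keeps \<open>ln \<alpha>\<close> negative, the second is the
    smallness required by \<open>cutoff_degree\<close>.\<close>
  define \<alpha>\<^sub>0 where "\<alpha>\<^sub>0 = min (1 / 2) ((1 / (6 * A + 1))\<^sup>2)"
  have E: "E \<ge> 0" by (simp add: E_def)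
  have a0: "0 < \<alpha>\<^sub>0" "\<alpha>\<^sub>0 < 1" using A by (auto simp: \<alpha>\<^sub>0_def)
  have main: "(L2_norm (\<lambda>x. f x - fd x))\<^sup>2 \<le> 8 * D\<^sup>2 + 8 * (g\<^sup>2 / \<alpha>\<^sup>2) + 4 * (\<epsilon> / \<alpha>) \<and>
      L1_norm (\<lambda>x. gradiometry R f x - gradiometry R fd x) \<le> 24 * \<alpha> * D\<^sup>2 + 24 * (g\<^sup>2 / \<alpha>) + 12 * \<epsilon> \<and>
      (\<alpha> < \<alpha>\<^sub>0 \<longrightarrow>
        (L2_norm (\<lambda>x. f x - fd x))\<^sup>2 \<le> C * (\<epsilon> / \<alpha> + g\<^sup>2 / \<alpha>\<^sup>2 + log_rate p \<alpha>) \<and>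
        L1_norm (\<lambda>x. gradiometry R f x - gradiometry R fd x) \<le> C * (\<epsilon> + g\<^sup>2 / \<alpha> + \<alpha> * log_rate p \<alpha>))"
    if f: "f \<in> L2" and \<alpha>: "\<alpha> > 0" and \<epsilon>: "\<epsilon> \<ge> 0"
    and b: "1 / 3 * L1_norm (gradiometry R (\<lambda>x. f x - fd x)) + \<alpha> * ((L2_norm f)\<^sup>2 - (L2_norm fd)\<^sup>2)
        \<le> 2 * g * L2_norm (\<lambda>x. f x - fd x) + 2 * \<epsilon>" for f \<alpha> g \<epsilon>
  proof -
    let ?h = "\<lambda>x. f x - fd x"
    define H t I where "H = L2_norm ?h" and "t = L1_norm (gradiometry R ?h)" and "I = L2_inner fd ?h"
    have hL: "?h \<in> L2" using f fdL by (rule L2_diff)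
    have t0: "t \<ge> 0" by (simp add: t_def)
    have tt: "L1_norm (\<lambda>x. gradiometry R f x - gradiometry R fd x) = t"
      unfolding t_def by (rule L1_norm_cong) (simp add: gradiometry_diff[OF R f fdL])
    have "(L2_norm (\<lambda>x. fd x + ?h x))\<^sup>2 = (L2_norm fd)\<^sup>2 + 2 * I + H\<^sup>2"
      unfolding I_def H_def by (rule L2_norm_sq_add[OF fdL hL])
    then have "(L2_norm f)\<^sup>2 - (L2_norm fd)\<^sup>2 = H\<^sup>2 + 2 * I" by simp
    then have b': "1 / 3 * t + \<alpha> * (H\<^sup>2 + 2 * I) \<le> 2 * g * H + 2 * \<epsilon>"
      using b by (simp add: H_def t_def)
    have s: "- 2 * I \<le> (A * (R ^ n - 1)) * t + 2 * (D * (1 + real n) powr (- p)) * H" for n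
      using src[OF hL, of n] by (simp add: H_def t_def I_def)
    \<comment> \<open>At cutoff degree 0 the coefficient of \<open>t\<close> vanishes, so
      \<open>\<alpha>\<close> may have any size.\<close>
    have "H\<^sup>2 \<le> 8 * D\<^sup>2 + 8 * (g\<^sup>2 / \<alpha>\<^sup>2) + 4 * (\<epsilon> / \<alpha>)"
      and "t \<le> 24 * \<alpha> * D\<^sup>2 + 24 * (g\<^sup>2 / \<alpha>) + 12 * \<epsilon>"
      using young_absorption[OF \<alpha> t0 b' s[of 0]] by simp_all
    moreover have "H\<^sup>2 \<le> C * (\<epsilon> / \<alpha> + g\<^sup>2 / \<alpha>\<^sup>2 + log_rate p \<alpha>) \<and> t \<le> C * (\<epsilon> + g\<^sup>2 / \<alpha> + \<alpha> * log_rate p \<alpha>)"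
      if small: "\<alpha> < \<alpha>\<^sub>0"
    proof -
      define l where "l = log_rate p \<alpha>"
      have l: "l = (- ln \<alpha>) powr (- 2 * p)" "l \<ge> 0" using \<alpha> by (simp_all add: l_def log_rate_def)
      have sm: "\<alpha> < 1" "\<alpha> \<le> (1 / (6 * A + 1))\<^sup>2" using small by (simp_all add: \<alpha>\<^sub>0_def)
      obtain n where n: "\<alpha> * (A * (R ^ n - 1)) \<le> 1 / 6"
          "((1 + real n) powr (- p))\<^sup>2 \<le> (2 * ln R) powr (2 * p) * (- ln \<alpha>) powr (- 2 * p)"
        by (rule cutoff_degree[OF R \<open>p > 0\<close> A(1) \<alpha> sm])
      let ?d = "D * (1 + real n) powr (- p)"
      have d: "?d\<^sup>2 \<le> E * l"
        using mult_left_mono[OF n(2), of "D\<^sup>2"] by (simp add: E_def l power_mult_distrib mult.assoc)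
      have nn: "0 \<le> \<epsilon> / \<alpha>" "0 \<le> g\<^sup>2 / \<alpha>\<^sup>2" "0 \<le> g\<^sup>2 / \<alpha>" using \<alpha> \<epsilon> by auto
      have El: "0 \<le> E * l" using E l by simp
      have "H\<^sup>2 \<le> 8 * (E * l) + 8 * (g\<^sup>2 / \<alpha>\<^sup>2) + 4 * (\<epsilon> / \<alpha>)"
        using young_absorption(1)[OF \<alpha> t0 b' s n(1)] d by linarith
      also have "\<dots> \<le> C * (\<epsilon> / \<alpha> + g\<^sup>2 / \<alpha>\<^sup>2 + l)"
        using mult_nonneg_nonneg[OF E nn(1)] mult_nonneg_nonneg[OF E nn(2)] nn El l(2)
        unfolding C_def distrib_left distrib_right mult.assoc by linarith
      finally have 1: "H\<^sup>2 \<le> C * (\<epsilon> / \<alpha> + g\<^sup>2 / \<alpha>\<^sup>2 + l)" .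
      have ad: "\<alpha> * ?d\<^sup>2 \<le> E * (\<alpha> * l)" using mult_left_mono[OF d, of \<alpha>] \<alpha> by (simp add: mult_ac)
      have al: "0 \<le> \<alpha> * l" "0 \<le> E * (\<alpha> * l)" using \<alpha> l(2) E by auto
      have "t \<le> 24 * (E * (\<alpha> * l)) + 24 * (g\<^sup>2 / \<alpha>) + 12 * \<epsilon>"
        using young_absorption(2)[OF \<alpha> t0 b' s n(1)] ad by linarith
      also have "\<dots> \<le> C * (\<epsilon> + g\<^sup>2 / \<alpha> + \<alpha> * l)"
        using mult_nonneg_nonneg[OF E \<epsilon>] mult_nonneg_nonneg[OF E nn(3)] nn al \<epsilon>
        unfolding C_def distrib_left distrib_right mult.assoc by linarith
      finally show ?thesis using 1 by (simp add: l_def)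
    qed
    ultimately show ?thesis unfolding tt H_def by blast
  qed
  show ?thesis
    by (rule that[of C \<alpha>\<^sub>0 "D\<^sup>2"]) (use E a0 main in \<open>auto simp: C_def\<close>)
qed

section \<open>Asymptotics of the noise scale and the a priori parameter choice\<close>

definition noise_scale :: "real \<Rightarrow> real \<Rightarrow> real" where
  "noise_scale R \<eta> = \<eta> powr (- 3 / 2) * R powr (- sqrt (pi / \<eta>))"

lemma noise_scale_pos: "R > 1 \<Longrightarrow> \<eta> > 0 \<Longrightarrow> noise_scale R \<eta> > 0"
  by (simp add: noise_scale_def)

text \<open>The spare factor 11/10 in the exponent, available since \<open>sqrt (4 / \<kappa>) > 11 / 10\<close> for \<open>\<kappa> \<le> 3\<close>, absorbs
  every power of \<open>\<eta>\<close>. This is why the basic inequality is used with \<open>\<delta> = 3 * \<eta>\<close> rather than \<open>4 * \<eta>\<close>.\<close>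

lemma gamma_le_noise_scale:
  assumes R: "R > 1" and \<eta>: "\<eta> > 0" and "C > 0" and \<kappa>: "2 \<le> \<kappa>" "\<kappa> \<le> 3"
  shows "\<eta> * gamma_fun C R (\<kappa> * \<eta>) \<le> C * R powr (- (1 / 10) * sqrt (pi / \<eta>)) * noise_scale R \<eta>"
proof -
  let ?x = "sqrt (pi / \<eta>)"
  have k: "\<kappa> powr (- 5 / 2) \<le> 1" using powr_mono2'[of "- 5 / 2" 1 \<kappa>] \<kappa> by simp
  have "11 / 10 * ?x \<le> sqrt (4 / \<kappa>) * ?x"
  proof (rule mult_right_mono)
    show "11 / 10 \<le> sqrt (4 / \<kappa>)"
      using \<kappa> by (intro real_le_rsqrt) (simp add: field_simps power2_eq_square)
  qed (use \<eta> in simp)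
  also have "\<dots> = sqrt (4 * pi / (\<kappa> * \<eta>))" by (simp add: real_sqrt_mult[symmetric])
  finally have "R powr (- sqrt (4 * pi / (\<kappa> * \<eta>)) - 4) \<le> R powr (- (1 / 10) * ?x + - ?x)"
    using R by (intro powr_mono) auto
  then have e: "R powr (- sqrt (4 * pi / (\<kappa> * \<eta>)) - 4) \<le> R powr (- (1 / 10) * ?x) * R powr (- ?x)"
    by (simp only: powr_add)
  have n: "\<eta> * \<eta> powr (- 5 / 2) = \<eta> powr (- 3 / 2)"
    using \<eta> powr_add[of \<eta> 1 "- 5 / 2"] by simp
  have "\<eta> * gamma_fun C R (\<kappa> * \<eta>)
      = C * (\<eta> * \<eta> powr (- 5 / 2)) * (\<kappa> powr (- 5 / 2) * R powr (- sqrt (4 * pi / (\<kappa> * \<eta>)) - 4))"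
    using \<eta> \<kappa> by (simp add: gamma_fun_def powr_mult)
  also have "\<dots> \<le> C * \<eta> powr (- 3 / 2) * (1 * (R powr (- (1 / 10) * ?x) * R powr (- ?x)))"
    unfolding n using k e \<open>C > 0\<close> by (intro mult_left_mono mult_mono) auto
  finally show ?thesis by (simp add: noise_scale_def mult_ac)
qed

text \<open>The admissibility condition involves \<open>gamma_fun\<close> at
  \<open>2 * \<eta>\<close>, the error bound at \<open>3 * \<eta>\<close>. In both cases the spare
  factor \<open>exp (- (c / 10) * sqrt (pi / \<eta>))\<close> falls below every positive constant
  and every power of \<open>\<eta>\<close>.\<close>

lemma eventually_gamma_le:
  assumes R: "R > 1" and "C > 0" and "p > 0" and "e > 0"
  shows "\<forall>\<^sub>F \<eta> in at_right 0. 2 * \<eta> * gamma_fun C R (2 * \<eta>) \<le> e * noise_scale R \<eta> \<and>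
     \<eta> * gamma_fun C R (3 * \<eta>) \<le> \<eta> powr p * noise_scale R \<eta>"
proof -
  define c where "c = ln R"
  have c: "c > 0" using R by (simp add: c_def)
  have Rc: "R powr (- (1 / 10) * sqrt (pi / \<eta>)) = exp (- (c / 10) * sqrt (pi / \<eta>))" for \<eta>
    using R by (simp add: powr_def c_def)
  have "((\<lambda>\<eta>. C * exp (- (c / 10) * sqrt (pi / \<eta>))) \<longlongrightarrow> 0) (at_right 0)"
    using c by real_asymp
  then have 1: "\<forall>\<^sub>F \<eta> in at_right 0. C * exp (- (c / 10) * sqrt (pi / \<eta>)) < e / 2"
    using \<open>e > 0\<close> by (intro order_tendstoD) auto
  have "((\<lambda>\<eta>. C * exp (- (c / 10) * sqrt (pi / \<eta>)) / \<eta> powr p) \<longlongrightarrow> 0) (at_right 0)"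
    using c \<open>p > 0\<close> by real_asymp
  then have 2: "\<forall>\<^sub>F \<eta> in at_right 0. C * exp (- (c / 10) * sqrt (pi / \<eta>)) / \<eta> powr p < 1"
    by (intro order_tendstoD) auto
  have 3: "\<forall>\<^sub>F \<eta> :: real in at_right 0. \<eta> > 0" by (rule eventually_at_right_less)
  show ?thesis
    using 1 2 3
  proof eventually_elim
    case (elim \<eta>)
    have s: "noise_scale R \<eta> > 0" using R elim by (intro noise_scale_pos)
    have "\<eta> * gamma_fun C R (2 * \<eta>) \<le> (e / 2) * noise_scale R \<eta>"
      using gamma_le_noise_scale[OF R elim(3) \<open>C > 0\<close>, of 2] elim(1) s
      unfolding Rc by (smt (verit, best) mult_right_mono)
    moreover have "C * exp (- (c / 10) * sqrt (pi / \<eta>)) \<le> \<eta> powr p"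
      using elim(2,3) by (simp add: divide_less_eq)
    then have "\<eta> * gamma_fun C R (3 * \<eta>) \<le> \<eta> powr p * noise_scale R \<eta>"
      using gamma_le_noise_scale[OF R elim(3) \<open>C > 0\<close>, of 3] s
      unfolding Rc by (smt (verit, best) mult_right_mono)
    ultimately show ?case by simp
  qed
qed

lemma noise_scale_tendsto:
  assumes R: "R > 1"
  shows "(noise_scale R \<longlongrightarrow> 0) (at_right 0)"
proof -
  define c where "c = ln R"
  have c: "c > 0" using R by (simp add: c_def)
  have "((\<lambda>\<eta>. \<eta> powr (- 3 / 2) * exp (- c * sqrt (pi / \<eta>))) \<longlongrightarrow> 0) (at_right 0)"
    using c by real_asymp
  then show ?thesis using R by (simp add: noise_scale_def[abs_def] powr_def c_def mult.commute)
qed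

text \<open>The negative logarithm of the noise scale is \<open>ln R * sqrt (pi / \<eta>)\<close> up
  to a term of lower order, hence eventually at least half of it; the exponent
  \<open>- 2 * p\<close> turns this into a multiple of \<open>\<eta> powr p\<close>.\<close>

lemma log_rate_noise_scale:
  assumes R: "R > 1" and "p > 0"
  obtains K where "K > 0" "\<forall>\<^sub>F \<eta> in at_right 0. log_rate p (noise_scale R \<eta>) \<le> K * \<eta> powr p"
proof
  define c where "c = ln R"
  have c: "c > 0" using R by (simp add: c_def)
  define K where "K = (c / 2 * sqrt pi) powr (- 2 * p)"
  show "K > 0" using c by (simp add: K_def)
  have 1: "\<forall>\<^sub>F \<eta> in at_right 0. 3 / 2 * ln \<eta> + c * sqrt (pi / \<eta>) \<ge> c / 2 * sqrt (pi / \<eta>)"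
    using c by real_asymp
  have 2: "\<forall>\<^sub>F \<eta> :: real in at_right 0. \<eta> > 0" by (rule eventually_at_right_less)
  show "\<forall>\<^sub>F \<eta> in at_right 0. log_rate p (noise_scale R \<eta>) \<le> K * \<eta> powr p"
    using 1 2
  proof eventually_elim
    case (elim \<eta>)
    have s: "noise_scale R \<eta> > 0" using R elim by (intro noise_scale_pos)
    have "- ln (noise_scale R \<eta>) = 3 / 2 * ln \<eta> + c * sqrt (pi / \<eta>)"
      using R elim(2) by (simp add: noise_scale_def ln_mult ln_powr c_def)
    then have ge: "c / 2 * sqrt (pi / \<eta>) \<le> - ln (noise_scale R \<eta>)" using elim(1) by simp
    have pos: "c / 2 * sqrt (pi / \<eta>) > 0" using c elim(2) by simp
    have "log_rate p (noise_scale R \<eta>) \<le> (c / 2 * sqrt (pi / \<eta>)) powr (- 2 * p)"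
      using s ge pos \<open>p > 0\<close> by (simp add: log_rate_def) (intro powr_mono2', auto)
    also have "\<dots> = (c / 2 * sqrt pi * \<eta> powr (- 1 / 2)) powr (- 2 * p)"
      using elim(2) by (simp add: real_sqrt_divide powr_minus_divide powr_half_sqrt)
    also have "\<dots> = K * \<eta> powr p"
      unfolding K_def powr_mult[of "c / 2 * sqrt pi"] powr_powr by simp
    finally show ?case .
  qed
qed

text \<open>These are the properties of small \<open>\<epsilon>\<close> on which the parameter
  choice relies. The last one holds since \<open>ln (- ln \<epsilon>)\<close> is negligible against
  \<open>- ln \<epsilon>\<close>.\<close>

lemma eventually_noise_level:
  fixes p c \<beta> :: real
  assumes "p > 0" "c > 0" "\<beta> > 0"
  shows "\<forall>\<^sub>F \<epsilon> in at_right 0. \<epsilon> < 1 \<and> \<epsilon> * (- ln \<epsilon>) powr (2 * p) < \<beta> \<and>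
      (- ln \<epsilon>) powr (- 2 * p) \<le> c \<and> - ln (\<epsilon> * (- ln \<epsilon>) powr (2 * p)) \<ge> - ln \<epsilon> / 2"
proof (intro eventually_conj)
  show "\<forall>\<^sub>F \<epsilon> :: real in at_right 0. \<epsilon> < 1" by real_asymp
  have "((\<lambda>\<epsilon>. \<epsilon> * (- ln \<epsilon>) powr (2 * p)) \<longlongrightarrow> 0) (at_right 0)" using assms by real_asymp
  then show "\<forall>\<^sub>F \<epsilon> in at_right 0. \<epsilon> * (- ln \<epsilon>) powr (2 * p) < \<beta>" using assms by (intro order_tendstoD) auto
  have "((\<lambda>\<epsilon>. (- ln \<epsilon>) powr (- 2 * p)) \<longlongrightarrow> 0) (at_right 0)" using assms by real_asymp
  from order_tendstoD(2)[OF this \<open>c > 0\<close>]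
  show "\<forall>\<^sub>F \<epsilon> in at_right 0. (- ln \<epsilon>) powr (- 2 * p) \<le> c"
    by (rule eventually_mono) simp
  show "\<forall>\<^sub>F \<epsilon> in at_right 0. - ln (\<epsilon> * (- ln \<epsilon>) powr (2 * p)) \<ge> - ln \<epsilon> / 2"
    using assms by real_asymp
qed

text \<open>Reduces the limit in two variables to one-sided limits in each. The value
  \<open>\<epsilon> = 0\<close> is a separate alternative because \<open>noise_limit\<close> admits
  it.\<close>

lemma eventually_noise_limit:
  assumes P: "\<forall>\<^sub>F \<eta> in at_right 0. P \<eta>" and Q: "\<forall>\<^sub>F \<epsilon> in at_right 0. Q \<epsilon>"
  shows "\<forall>\<^sub>F (\<eta>, \<epsilon>) in noise_limit. 0 < \<eta> \<and> P \<eta> \<and> 0 \<le> \<epsilon> \<and> (\<epsilon> = 0 \<or> Q \<epsilon>)"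
proof -
  obtain a where a: "a > 0" "\<And>\<eta>. 0 < \<eta> \<Longrightarrow> \<eta> < a \<Longrightarrow> P \<eta>"
    using P unfolding eventually_at_right_field by auto
  obtain b where b: "b > 0" "\<And>\<epsilon>. 0 < \<epsilon> \<Longrightarrow> \<epsilon> < b \<Longrightarrow> Q \<epsilon>"
    using Q unfolding eventually_at_right_field by auto
  show ?thesis
    unfolding noise_limit_def eventually_at
  proof (intro exI[of _ "min a b"] conjI ballI impI)
    show "min a b > 0" using a b by simp
    fix z :: "real \<times> real" assume z: "z \<in> {0<..} \<times> {0..}" "z \<noteq> (0, 0) \<and> dist z (0, 0) < min a b"
    obtain \<eta> \<epsilon> where ze: "z = (\<eta>, \<epsilon>)" by (cases z)
    have "dist \<eta> 0 \<le> dist z (0, 0)" "dist \<epsilon> 0 \<le> dist z (0, 0)"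
      using dist_fst_le[of z "(0, 0)"] dist_snd_le[of z "(0, 0)"] by (simp_all add: ze)
    then have "\<eta> < a" "\<epsilon> < b" using z by (auto simp: dist_real_def)
    then show "case z of (\<eta>, \<epsilon>) \<Rightarrow> 0 < \<eta> \<and> P \<eta> \<and> 0 \<le> \<epsilon> \<and> (\<epsilon> = 0 \<or> Q \<epsilon>)"
      using z a(2)[of \<eta>] b(2)[of \<epsilon>] by (auto simp: ze order_le_less)
  qed
qed

lemma gamma_fun_nonneg: "C \<ge> 0 \<Longrightarrow> gamma_fun C R \<delta> \<ge> 0"
  by (simp add: gamma_fun_def)

text \<open>This square is the \<open>\<eta>\<close>-dependent factor of the noise terms in the
  error bounds.\<close>

lemma noise_scale_sq: "\<eta> > 0 \<Longrightarrow> (noise_scale R \<eta>)\<^sup>2 = \<eta> powr (- 3) * R powr (- 2 * sqrt (pi / \<eta>))"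
  using powr_add[of R "- sqrt (pi / \<eta>)" "- sqrt (pi / \<eta>)"]
  by (simp add: noise_scale_def power_mult_distrib powr_power) (simp add: power2_eq_square)

text \<open>The first entry controls the noise term relative to \<open>\<alpha>\<close>, the second
  bounds \<open>\<epsilon> / \<alpha>\<close> by \<open>(- ln \<epsilon>) powr (- 2 * p)\<close>.
  Neither is so large that it spoils the logarithmic rate. At \<open>\<epsilon> = 0\<close> the
  second entry is 0.\<close>

definition param_choice :: "real \<Rightarrow> real \<Rightarrow> real \<Rightarrow> real \<Rightarrow> real" where
  "param_choice R p \<eta> \<epsilon> = max (noise_scale R \<eta>) (\<epsilon> * (- ln \<epsilon>) powr (2 * p))"

lemma param_choice_pos: "R > 1 \<Longrightarrow> \<eta> > 0 \<Longrightarrow> param_choice R p \<eta> \<epsilon> > 0"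
  using noise_scale_pos[of R \<eta>] by (simp add: param_choice_def)

lemma param_choice_ratio:
  assumes R: "R > 1" and "\<eta> > 0" "0 \<le> \<epsilon>" "\<epsilon> < 1"
  shows "\<epsilon> / param_choice R p \<eta> \<epsilon> \<le> log_rate p \<epsilon>"
proof (cases "\<epsilon> = 0")
  case False
  then have \<epsilon>: "\<epsilon> > 0" "- ln \<epsilon> > 0" using assms by auto
  have "\<epsilon> / param_choice R p \<eta> \<epsilon> \<le> \<epsilon> / (\<epsilon> * (- ln \<epsilon>) powr (2 * p))"
    using \<epsilon> by (intro divide_left_mono mult_pos_pos param_choice_pos R \<open>\<eta> > 0\<close>) (auto simp: param_choice_def)
  also have "\<dots> = log_rate p \<epsilon>" using \<epsilon> by (simp add: log_rate_def powr_minus_divide)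
  finally show ?thesis .
qed (simp add: log_rate_def)

text \<open>The constant \<open>L\<close> covers both cases of the maximum. If the second entry is
  the larger one, then \<open>\<alpha> = \<epsilon> * X\<close> with
  \<open>log_rate p \<epsilon> = 1 / X\<close>, so \<open>X\<close> cancels in
  \<open>\<alpha> * log_rate p \<alpha>\<close> and a multiple of \<open>\<epsilon>\<close>
  remains.\<close>

lemma log_rate_param_choice:
  assumes R: "R > 1" and "p > 0" "\<eta> > 0"
    and \<epsilon>: "\<epsilon> = 0 \<or> 0 < \<epsilon> \<and> \<epsilon> < 1 \<and> - ln \<epsilon> / 2 \<le> - ln (\<epsilon> * (- ln \<epsilon>) powr (2 * p))"
    and K: "log_rate p (noise_scale R \<eta>) \<le> K * \<eta> powr p" "K > 0"
  defines "\<alpha> \<equiv> param_choice R p \<eta> \<epsilon>" and "L \<equiv> max K (2 powr (2 * p))"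
  shows "log_rate p \<alpha> \<le> L * max (log_rate p \<epsilon>) (\<eta> powr p)"
    and "\<alpha> * log_rate p \<alpha> \<le> L * max \<epsilon> (\<eta> powr p * noise_scale R \<eta>)"
proof -
  have L: "K \<le> L" "2 powr (2 * p) \<le> L" "L > 0" using K(2) by (auto simp: L_def)
  have s: "noise_scale R \<eta> > 0" using R \<open>\<eta> > 0\<close> by (rule noise_scale_pos)
  have "log_rate p \<alpha> \<le> L * max (log_rate p \<epsilon>) (\<eta> powr p) \<and> \<alpha> * log_rate p \<alpha> \<le> L * max \<epsilon> (\<eta> powr p * noise_scale R \<eta>)"
  proof (cases "\<alpha> = noise_scale R \<eta>")
    case True
    have "log_rate p \<alpha> \<le> L * \<eta> powr p"
      using K(1) mult_right_mono[OF L(1), of "\<eta> powr p"] True by simp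
    moreover have "noise_scale R \<eta> * log_rate p \<alpha> \<le> noise_scale R \<eta> * (L * \<eta> powr p)"
      using calculation s by (intro mult_left_mono) auto
    moreover have "L * \<eta> powr p \<le> L * max (log_rate p \<epsilon>) (\<eta> powr p)"
      "L * (\<eta> powr p * noise_scale R \<eta>) \<le> L * max \<epsilon> (\<eta> powr p * noise_scale R \<eta>)"
      using L by auto
    ultimately show ?thesis using True by (simp add: mult_ac)
  next
    case False
    define X where "X = (- ln \<epsilon>) powr (2 * p)"
    have a: "\<alpha> = \<epsilon> * X" using False by (auto simp: \<alpha>_def param_choice_def X_def max_def split: if_splits)
    have "\<epsilon> \<noteq> 0" using False s by (auto simp: \<alpha>_def param_choice_def)
    then have e: "0 < \<epsilon>" "\<epsilon> < 1" "- ln \<epsilon> / 2 \<le> - ln \<alpha>" using \<epsilon> by (auto simp: a X_def)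
    have ln: "- ln \<epsilon> > 0" using e by simp
    have X: "X > 0" using ln by (simp add: X_def)
    have "log_rate p \<alpha> \<le> (- ln \<epsilon> / 2) powr (- 2 * p)"
      using e X ln \<open>p > 0\<close> by (simp add: log_rate_def a) (intro powr_mono2', auto simp: a)
    also have "\<dots> = (- ln \<epsilon>) powr (- 2 * p) / 2 powr (- 2 * p)" by (rule powr_divide)
    also have "\<dots> = 2 powr (2 * p) * log_rate p \<epsilon>" using e by (simp add: log_rate_def powr_minus_divide)
    finally have 1: "log_rate p \<alpha> \<le> 2 powr (2 * p) * log_rate p \<epsilon>" .
    have lr: "log_rate p \<epsilon> = 1 / X" using e by (simp add: log_rate_def X_def powr_minus_divide)
    have "\<alpha> * log_rate p \<alpha> \<le> \<epsilon> * X * (2 powr (2 * p) * (1 / X))"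
      using 1 e X unfolding a lr by (intro mult_left_mono) auto
    then have 2: "\<alpha> * log_rate p \<alpha> \<le> 2 powr (2 * p) * \<epsilon>" using X by (simp add: mult_ac)
    have max: "2 powr (2 * p) * u \<le> L * max u v" if "u \<ge> 0" for u v :: real
      using L that by (intro mult_mono) auto
    have "log_rate p \<epsilon> \<ge> 0" by (simp add: log_rate_def)
    from max[OF this, of "\<eta> powr p"] max[OF less_imp_le[OF e(1)], of "\<eta> powr p * noise_scale R \<eta>"]
    show ?thesis using 1 2 by linarith
  qed
  then show "log_rate p \<alpha> \<le> L * max (log_rate p \<epsilon>) (\<eta> powr p)"
    "\<alpha> * log_rate p \<alpha> \<le> L * max \<epsilon> (\<eta> powr p * noise_scale R \<eta>)" by auto
qed

lemma admissible_param_choice: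
  assumes R: "R > 1" and "p > 0" and "C\<^sub>e > 0" and "C\<^sub>\<gamma> > 0"
  shows "admissible_choice (gamma_fun C\<^sub>\<gamma> R) C\<^sub>e (param_choice R p)"
  unfolding admissible_choice_def
proof (intro conjI allI impI)
  show "param_choice R p \<eta> \<epsilon> > 0" if "\<eta> > 0" for \<eta> \<epsilon> using param_choice_pos[OF R that] .
  show "((\<lambda>(\<eta>, \<epsilon>). param_choice R p \<eta> \<epsilon>) \<longlongrightarrow> 0) noise_limit"
  proof (rule tendstoI)
    fix e :: real assume e: "e > 0"
    have "\<forall>\<^sub>F \<eta> in at_right 0. noise_scale R \<eta> < e"
      using order_tendstoD(2)[OF noise_scale_tendsto[OF R] e] .
    from eventually_noise_limit[OF this eventually_noise_level[OF \<open>p > 0\<close> e e]]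
    show "\<forall>\<^sub>F z in noise_limit. dist (case z of (\<eta>, \<epsilon>) \<Rightarrow> param_choice R p \<eta> \<epsilon>) 0 < e"
    proof eventually_elim
      case (elim z)
      obtain \<eta> \<epsilon> where z: "z = (\<eta>, \<epsilon>)" by (cases z)
      have "param_choice R p \<eta> \<epsilon> > 0" using elim param_choice_pos[OF R] by (simp add: z)
      then show ?case using elim e by (auto simp: z param_choice_def)
    qed
  qed
  \<comment> \<open>Each summand gets half of \<open>C\<^sub>e\<close>; for the square root this
    means \<open>\<epsilon> / \<alpha> \<le> C\<^sub>e\<^sup>2 / 8\<close>.\<close>
  have "C\<^sub>e / 2 > 0" "C\<^sub>e\<^sup>2 / 8 > 0" using \<open>C\<^sub>e > 0\<close> by auto
  from eventually_noise_limit[OF eventually_gamma_le[OF R \<open>C\<^sub>\<gamma> > 0\<close> \<open>p > 0\<close> this(1)]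
      eventually_noise_level[OF \<open>p > 0\<close> this(2) zero_less_one]]
  show "\<forall>\<^sub>F (\<eta>, \<epsilon>) in noise_limit. sqrt (2 * \<epsilon> / param_choice R p \<eta> \<epsilon>)
      + 2 * \<eta> * gamma_fun C\<^sub>\<gamma> R (2 * \<eta>) / param_choice R p \<eta> \<epsilon> \<le> C\<^sub>e"
  proof eventually_elim
    case (elim z)
    obtain \<eta> \<epsilon> where z: "z = (\<eta>, \<epsilon>)" by (cases z)
    let ?a = "param_choice R p \<eta> \<epsilon>"
    have \<eta>: "\<eta> > 0" "0 \<le> \<epsilon>" using elim by (auto simp: z)
    have a: "?a > 0" "noise_scale R \<eta> \<le> ?a" using param_choice_pos[OF R \<eta>(1)] by (auto simp: param_choice_def)
    have "\<epsilon> / ?a \<le> C\<^sub>e\<^sup>2 / 8"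
    proof (cases "\<epsilon> = 0")
      case False
      then have "\<epsilon> < 1" "log_rate p \<epsilon> \<le> C\<^sub>e\<^sup>2 / 8" using elim by (auto simp: z log_rate_def)
      then show ?thesis using param_choice_ratio[OF R \<eta>, of p] by linarith
    qed (use \<open>C\<^sub>e > 0\<close> in simp)
    then have "sqrt (2 * \<epsilon> / ?a) \<le> sqrt ((C\<^sub>e / 2)\<^sup>2)"
      by (intro real_sqrt_le_mono) (simp add: power2_eq_square mult.commute)
    then have 1: "sqrt (2 * \<epsilon> / ?a) \<le> C\<^sub>e / 2" using \<open>C\<^sub>e > 0\<close> by (simp add: real_sqrt_abs)
    have "2 * \<eta> * gamma_fun C\<^sub>\<gamma> R (2 * \<eta>) \<le> C\<^sub>e / 2 * noise_scale R \<eta>" using elim by (simp add: z)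
    also have "\<dots> \<le> C\<^sub>e / 2 * ?a" using a \<open>C\<^sub>e > 0\<close> by (intro mult_left_mono) auto
    finally have "2 * \<eta> * gamma_fun C\<^sub>\<gamma> R (2 * \<eta>) / ?a \<le> C\<^sub>e / 2" using a(1) by (simp add: divide_le_eq)
    then show ?case using 1 by (simp add: z)
  qed
qed

text \<open>Writes a bound \<open>X\<close> of any size as a relative correction of
  \<open>Y\<close>; it supplies the correction factors where the parameter is not small.\<close>

lemma le_mult_one_plus:
  fixes H X Y :: real
  assumes "H \<le> X" "Y > 0"
  shows "H \<le> Y * (1 + X / Y)"
  using assms by (simp add: distrib_left)

theorem theorem4p4:
  fixes R p C\<^sub>\<gamma> C\<^sub>e :: real and f\<^sub>d :: "real ^ 3 \<Rightarrow> real"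
  assumes "R > 1" and "p > 0" and "f\<^sub>d \<in> sobolev p" and "C\<^sub>e > 0" and "C\<^sub>\<gamma> > 0"
    and gamma: "\<exists>\<delta>\<^sub>0>0. \<forall>\<delta> f. 0 < \<delta> \<longrightarrow> \<delta> \<le> \<delta>\<^sub>0 \<longrightarrow> f \<in> L2 \<longrightarrow>
      Linf_norm (gradiometry R (\<lambda>x. f x - f\<^sub>d x))
      \<le> ereal (gamma_fun C\<^sub>\<gamma> R \<delta> * L2_norm (\<lambda>x. f x - f\<^sub>d x)
               + 1 / \<delta> * L1_norm (gradiometry R (\<lambda>x. f x - f\<^sub>d x)))"
  shows
    "(\<exists>C>0. \<forall>\<alpha>. admissible_choice (gamma_fun C\<^sub>\<gamma> R) C\<^sub>e \<alpha> \<longrightarrow>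
       (\<exists>\<eta>\<^sub>0>0. \<exists>\<omega>\<^sub>1 \<omega>\<^sub>2 :: real \<times> real \<Rightarrow> real.
         (\<omega>\<^sub>1 \<longlongrightarrow> 0) noise_limit \<and> (\<omega>\<^sub>2 \<longlongrightarrow> 0) noise_limit \<and>
         (\<forall>\<eta> \<epsilon> \<xi> f. 0 < \<eta> \<longrightarrow> \<eta> \<le> \<eta>\<^sub>0 \<longrightarrow> \<epsilon> \<ge> 0 \<longrightarrow> impulsive_noise \<epsilon> \<eta> \<xi> \<longrightarrow>
           is_minimizer R (\<alpha> \<eta> \<epsilon>) (\<lambda>x. gradiometry R f\<^sub>d x + \<xi> x) f \<longrightarrow>
           (L2_norm (\<lambda>x. f x - f\<^sub>d x))\<^sup>2
             \<le> C * (\<epsilon> / \<alpha> \<eta> \<epsilon>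
                    + 1 / (\<alpha> \<eta> \<epsilon>)\<^sup>2 * (1 / R ^ 6) * \<eta> powr (- 3) * R powr (- 2 * sqrt (pi / \<eta>))
                    + log_rate p (\<alpha> \<eta> \<epsilon>)) * (1 + \<omega>\<^sub>1 (\<eta>, \<epsilon>)) \<and>
           L1_norm (\<lambda>x. gradiometry R f x - gradiometry R f\<^sub>d x)
             \<le> C * (\<epsilon>
                    + 1 / \<alpha> \<eta> \<epsilon> * (1 / R ^ 6) * \<eta> powr (- 3) * R powr (- 2 * sqrt (pi / \<eta>))
                    + \<alpha> \<eta> \<epsilon> * log_rate p (\<alpha> \<eta> \<epsilon>)) * (1 + \<omega>\<^sub>2 (\<eta>, \<epsilon>))))) \<and>
     (\<exists>\<alpha>. admissible_choice (gamma_fun C\<^sub>\<gamma> R) C\<^sub>e \<alpha> \<and>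
       (\<exists>K. \<forall>\<^sub>F (\<eta>, \<epsilon>) in noise_limit. \<forall>\<xi> f. impulsive_noise \<epsilon> \<eta> \<xi> \<longrightarrow>
           is_minimizer R (\<alpha> \<eta> \<epsilon>) (\<lambda>x. gradiometry R f\<^sub>d x + \<xi> x) f \<longrightarrow>
           (L2_norm (\<lambda>x. f x - f\<^sub>d x))\<^sup>2 \<le> K * max (log_rate p \<epsilon>) (\<eta> powr p) \<and>
           L1_norm (\<lambda>x. gradiometry R f x - gradiometry R f\<^sub>d x)
             \<le> K * max \<epsilon> (\<eta> powr ((2 * p - 3) / 2) * R powr (- sqrt (pi / \<eta>)))))"
proof -
  have fdL: "f\<^sub>d \<in> L2" using assms(3) by (simp add: sobolev_def)
  note R = \<open>R > 1\<close>
  obtain \<delta>\<^sub>0 where \<delta>\<^sub>0: "\<delta>\<^sub>0 > 0" and gam: "\<And>\<delta> f. 0 < \<delta> \<Longrightarrow> \<delta> \<le> \<delta>\<^sub>0 \<Longrightarrow> f \<in> L2 \<Longrightarrow>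
      Linf_norm (gradiometry R (\<lambda>x. f x - f\<^sub>d x))
      \<le> ereal (gamma_fun C\<^sub>\<gamma> R \<delta> * L2_norm (\<lambda>x. f x - f\<^sub>d x)
               + 1 / \<delta> * L1_norm (gradiometry R (\<lambda>x. f x - f\<^sub>d x)))"
    using gamma by blast
  obtain C \<alpha>\<^sub>0 D :: real where C: "C > 0" "0 < \<alpha>\<^sub>0" "\<alpha>\<^sub>0 < 1" "D \<ge> 0" and est:
    "\<forall>f \<alpha> g \<epsilon>. f \<in> L2 \<longrightarrow> \<alpha> > 0 \<longrightarrow> \<epsilon> \<ge> 0 \<longrightarrow>
      1 / 3 * L1_norm (gradiometry R (\<lambda>x. f x - f\<^sub>d x)) + \<alpha> * ((L2_norm f)\<^sup>2 - (L2_norm f\<^sub>d)\<^sup>2)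
        \<le> 2 * g * L2_norm (\<lambda>x. f x - f\<^sub>d x) + 2 * \<epsilon> \<longrightarrow>
      (L2_norm (\<lambda>x. f x - f\<^sub>d x))\<^sup>2 \<le> 8 * D + 8 * (g\<^sup>2 / \<alpha>\<^sup>2) + 4 * (\<epsilon> / \<alpha>) \<and>
      L1_norm (\<lambda>x. gradiometry R f x - gradiometry R f\<^sub>d x) \<le> 24 * \<alpha> * D + 24 * (g\<^sup>2 / \<alpha>) + 12 * \<epsilon> \<and>
      (\<alpha> < \<alpha>\<^sub>0 \<longrightarrow>
        (L2_norm (\<lambda>x. f x - f\<^sub>d x))\<^sup>2 \<le> C * (\<epsilon> / \<alpha> + g\<^sup>2 / \<alpha>\<^sup>2 + log_rate p \<alpha>) \<and>
        L1_norm (\<lambda>x. gradiometry R f x - gradiometry R f\<^sub>d x) \<le> C * (\<epsilon> + g\<^sup>2 / \<alpha> + \<alpha> * log_rate p \<alpha>))"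
    by (rule error_estimate[OF R assms(3) \<open>p > 0\<close>])
  define g where "g \<eta> = \<eta> * gamma_fun C\<^sub>\<gamma> R (3 * \<eta>)" for \<eta>
  have g0: "g \<eta> \<ge> 0" if "\<eta> > 0" for \<eta>
    using gamma_fun_nonneg[of C\<^sub>\<gamma> R] \<open>C\<^sub>\<gamma> > 0\<close> that by (simp add: g_def)
  have min_est: "(L2_norm (\<lambda>x. f x - f\<^sub>d x))\<^sup>2 \<le> 8 * D + 8 * ((g \<eta>)\<^sup>2 / \<alpha>\<^sup>2) + 4 * (\<epsilon> / \<alpha>) \<and>
      L1_norm (\<lambda>x. gradiometry R f x - gradiometry R f\<^sub>d x) \<le> 24 * \<alpha> * D + 24 * ((g \<eta>)\<^sup>2 / \<alpha>) + 12 * \<epsilon> \<and>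
      (\<alpha> < \<alpha>\<^sub>0 \<longrightarrow>
        (L2_norm (\<lambda>x. f x - f\<^sub>d x))\<^sup>2 \<le> C * (\<epsilon> / \<alpha> + (g \<eta>)\<^sup>2 / \<alpha>\<^sup>2 + log_rate p \<alpha>) \<and>
        L1_norm (\<lambda>x. gradiometry R f x - gradiometry R f\<^sub>d x) \<le> C * (\<epsilon> + (g \<eta>)\<^sup>2 / \<alpha> + \<alpha> * log_rate p \<alpha>))"
    if "\<eta> > 0" "3 * \<eta> \<le> \<delta>\<^sub>0" "\<epsilon> \<ge> 0" "\<alpha> > 0" "impulsive_noise \<epsilon> \<eta> \<xi>"
      and min: "is_minimizer R \<alpha> (\<lambda>x. gradiometry R f\<^sub>d x + \<xi> x) f" for \<eta> \<epsilon> \<alpha> \<xi> f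
  proof -
    have f: "f \<in> L2" using min by (simp add: is_minimizer_def is_arg_min_def)
    have G0: "gamma_fun C\<^sub>\<gamma> R (3 * \<eta>) \<ge> 0" using gamma_fun_nonneg \<open>C\<^sub>\<gamma> > 0\<close> by simp
    have \<delta>: "0 < 3 * \<eta>" using \<open>\<eta> > 0\<close> by simp
    from basic_inequality(2)[OF R fdL \<open>\<alpha> > 0\<close> \<open>\<eta> > 0\<close> \<open>impulsive_noise \<epsilon> \<eta> \<xi>\<close> min G0
        gam[OF \<delta> \<open>3 * \<eta> \<le> \<delta>\<^sub>0\<close> f]]
    show ?thesis
      unfolding g_def[symmetric] using est f \<open>\<alpha> > 0\<close> \<open>\<epsilon> \<ge> 0\<close> by blast
  qed
  obtain \<eta>\<^sub>1 where \<eta>\<^sub>1: "\<eta>\<^sub>1 > 0" "\<And>\<eta>. 0 < \<eta> \<Longrightarrow> \<eta> < \<eta>\<^sub>1 \<Longrightarrow> g \<eta> \<le> \<eta> powr p * noise_scale R \<eta>"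
    using eventually_gamma_le[OF R \<open>C\<^sub>\<gamma> > 0\<close> \<open>p > 0\<close> zero_less_one]
    unfolding eventually_at_right_field g_def by blast
  \<comment> \<open>The first entry allows \<open>\<delta> = 3 * \<eta>\<close> in the uniform
    estimate, half of \<open>\<eta>\<^sub>1\<close> turns a strict bound into a weak one, and 1
    ensures \<open>\<eta> powr p \<le> 1\<close>.\<close>
  define \<eta>\<^sub>0 where "\<eta>\<^sub>0 = Min {\<delta>\<^sub>0 / 3, \<eta>\<^sub>1 / 2, 1}"
  have \<eta>\<^sub>0: "\<eta>\<^sub>0 > 0" using \<delta>\<^sub>0 \<eta>\<^sub>1 by (simp add: \<eta>\<^sub>0_def)
  have small: "3 * \<eta> \<le> \<delta>\<^sub>0" "\<eta> \<le> 1" "g \<eta> \<le> \<eta> powr p * noise_scale R \<eta>" if "0 < \<eta>" "\<eta> \<le> \<eta>\<^sub>0" for \<eta>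
    using that \<eta>\<^sub>1 by (auto simp: \<eta>\<^sub>0_def)
  have g_le: "g \<eta> \<le> noise_scale R \<eta>" if "0 < \<eta>" "\<eta> \<le> \<eta>\<^sub>0" for \<eta>
  proof -
    have "\<eta> powr p \<le> 1" using that small(2)[OF that] \<open>p > 0\<close> powr_mono2[of p \<eta> 1] by simp
    then have "\<eta> powr p * noise_scale R \<eta> \<le> 1 * noise_scale R \<eta>"
      using noise_scale_pos[OF R that(1)] by (intro mult_right_mono) auto
    then show ?thesis using small(3)[OF that] by simp
  qed
  show ?thesis
  proof (rule conjI, goal_cases)
    case 1
    \<comment> \<open>The factor \<open>R ^ 6\<close> compensates the \<open>1 / R ^ 6\<close> in
      the noise terms; the constant may depend on \<open>R\<close>.\<close>
    define C' where "C' = C * R ^ 6"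
    have C': "C' > 0" using C R by (simp add: C'_def)
    have CC': "C \<le> C'" using C(1) one_le_power[of R 6] R by (simp add: C'_def)
    show ?case
    proof (rule exI[of _ C'], intro conjI C' allI impI, goal_cases)
      case adm: (1 \<alpha>)
      define B\<^sub>1 where "B\<^sub>1 \<eta> \<epsilon> = \<epsilon> / \<alpha> \<eta> \<epsilon>
         + 1 / (\<alpha> \<eta> \<epsilon>)\<^sup>2 * (1 / R ^ 6) * \<eta> powr (- 3) * R powr (- 2 * sqrt (pi / \<eta>)) + log_rate p (\<alpha> \<eta> \<epsilon>)" for \<eta> \<epsilon>
      define B\<^sub>2 where "B\<^sub>2 \<eta> \<epsilon> = \<epsilon> + 1 / \<alpha> \<eta> \<epsilon> * (1 / R ^ 6) * \<eta> powr (- 3) * R powr (- 2 * sqrt (pi / \<eta>))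
         + \<alpha> \<eta> \<epsilon> * log_rate p (\<alpha> \<eta> \<epsilon>)" for \<eta> \<epsilon>
      define X\<^sub>1 where "X\<^sub>1 \<eta> \<epsilon> = 8 * D + 8 * ((g \<eta>)\<^sup>2 / (\<alpha> \<eta> \<epsilon>)\<^sup>2) + 4 * (\<epsilon> / \<alpha> \<eta> \<epsilon>)" for \<eta> \<epsilon>
      define X\<^sub>2 where "X\<^sub>2 \<eta> \<epsilon> = 24 * \<alpha> \<eta> \<epsilon> * D + 24 * ((g \<eta>)\<^sup>2 / \<alpha> \<eta> \<epsilon>) + 12 * \<epsilon>" for \<eta> \<epsilon>
      \<comment> \<open>Since \<open>\<epsilon>\<close> is not restricted to small values, \<open>\<alpha> \<eta> \<epsilon>\<close> need not be small: there the \<open>o(1)\<close> factors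
        absorb the cruder bounds \<open>X\<^sub>1\<close> and \<open>X\<^sub>2\<close>.\<close>
      define \<omega>\<^sub>1 where "\<omega>\<^sub>1 = (\<lambda>(\<eta>, \<epsilon>). if \<alpha> \<eta> \<epsilon> < \<alpha>\<^sub>0 then 0 else X\<^sub>1 \<eta> \<epsilon> / (C' * B\<^sub>1 \<eta> \<epsilon>))"
      define \<omega>\<^sub>2 where "\<omega>\<^sub>2 = (\<lambda>(\<eta>, \<epsilon>). if \<alpha> \<eta> \<epsilon> < \<alpha>\<^sub>0 then 0 else X\<^sub>2 \<eta> \<epsilon> / (C' * B\<^sub>2 \<eta> \<epsilon>))"
      have "((\<lambda>(\<eta>, \<epsilon>). \<alpha> \<eta> \<epsilon>) \<longlongrightarrow> 0) noise_limit" using adm by (simp add: admissible_choice_def)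
      from order_tendstoD(2)[OF this C(2)]
      have ev: "\<forall>\<^sub>F z in noise_limit. (case z of (\<eta>, \<epsilon>) \<Rightarrow> \<alpha> \<eta> \<epsilon>) < \<alpha>\<^sub>0" .
      \<comment> \<open>Near the limit the parameter lies below \<open>\<alpha>\<^sub>0\<close>, so
        both corrections are identically 0 there.\<close>
      have \<omega>: "(\<omega>\<^sub>1 \<longlongrightarrow> 0) noise_limit" "(\<omega>\<^sub>2 \<longlongrightarrow> 0) noise_limit"
        by (rule tendsto_eventually, rule eventually_mono[OF ev], simp add: \<omega>\<^sub>1_def \<omega>\<^sub>2_def split: prod.splits)+
      have "(L2_norm (\<lambda>x. f x - f\<^sub>d x))\<^sup>2 \<le> C' * B\<^sub>1 \<eta> \<epsilon> * (1 + \<omega>\<^sub>1 (\<eta>, \<epsilon>)) \<and>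
          L1_norm (\<lambda>x. gradiometry R f x - gradiometry R f\<^sub>d x) \<le> C' * B\<^sub>2 \<eta> \<epsilon> * (1 + \<omega>\<^sub>2 (\<eta>, \<epsilon>))"
        if h: "0 < \<eta>" "\<eta> \<le> \<eta>\<^sub>0" "\<epsilon> \<ge> 0" "impulsive_noise \<epsilon> \<eta> \<xi>"
          "is_minimizer R (\<alpha> \<eta> \<epsilon>) (\<lambda>x. gradiometry R f\<^sub>d x + \<xi> x) f" for \<eta> \<epsilon> \<xi> f
      proof -
        have a: "\<alpha> \<eta> \<epsilon> > 0" using adm h by (simp add: admissible_choice_def)
        note m = min_est[OF h(1) small(1)[OF h(1,2)] h(3) a h(4,5)]
        have l0: "log_rate p (\<alpha> \<eta> \<epsilon>) \<ge> 0" by (simp add: log_rate_def)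
        have s2: "(noise_scale R \<eta>)\<^sup>2 > 0" using noise_scale_pos[OF R h(1)] by simp
        have B1: "B\<^sub>1 \<eta> \<epsilon> = \<epsilon> / \<alpha> \<eta> \<epsilon> + (noise_scale R \<eta>)\<^sup>2 / (\<alpha> \<eta> \<epsilon>)\<^sup>2 / R ^ 6 + log_rate p (\<alpha> \<eta> \<epsilon>)"
          and B2: "B\<^sub>2 \<eta> \<epsilon> = \<epsilon> + (noise_scale R \<eta>)\<^sup>2 / \<alpha> \<eta> \<epsilon> / R ^ 6 + \<alpha> \<eta> \<epsilon> * log_rate p (\<alpha> \<eta> \<epsilon>)"
          by (simp_all add: B\<^sub>1_def B\<^sub>2_def noise_scale_sq[OF h(1)])
        \<comment> \<open>\<open>\<epsilon>\<close> may be 0, and \<open>log_rate\<close> vanishes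
          at 1; the noise term keeps both denominators positive.\<close>
        have pos: "B\<^sub>1 \<eta> \<epsilon> > 0" "B\<^sub>2 \<eta> \<epsilon> > 0"
          unfolding B1 B2 using a h(3) s2 l0 R by (intro add_nonneg_pos add_pos_nonneg; simp)+
        show ?thesis
        proof (cases "\<alpha> \<eta> \<epsilon> < \<alpha>\<^sub>0")
          case False
          have "(L2_norm (\<lambda>x. f x - f\<^sub>d x))\<^sup>2 \<le> C' * B\<^sub>1 \<eta> \<epsilon> * (1 + X\<^sub>1 \<eta> \<epsilon> / (C' * B\<^sub>1 \<eta> \<epsilon>))"
            "L1_norm (\<lambda>x. gradiometry R f x - gradiometry R f\<^sub>d x)
              \<le> C' * B\<^sub>2 \<eta> \<epsilon> * (1 + X\<^sub>2 \<eta> \<epsilon> / (C' * B\<^sub>2 \<eta> \<epsilon>))"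
            using m C' pos unfolding X\<^sub>1_def X\<^sub>2_def by (intro le_mult_one_plus; simp)+
          then show ?thesis using False by (simp add: \<omega>\<^sub>1_def \<omega>\<^sub>2_def)
        next
          case True
          have gs: "(g \<eta>)\<^sup>2 \<le> (noise_scale R \<eta>)\<^sup>2"
            using g0[OF h(1)] g_le[OF h(1,2)] by (intro power_mono) auto
          have "C * (\<epsilon> / \<alpha> \<eta> \<epsilon> + (g \<eta>)\<^sup>2 / (\<alpha> \<eta> \<epsilon>)\<^sup>2 + log_rate p (\<alpha> \<eta> \<epsilon>))
              \<le> C' * (\<epsilon> / \<alpha> \<eta> \<epsilon>) + C * ((noise_scale R \<eta>)\<^sup>2 / (\<alpha> \<eta> \<epsilon>)\<^sup>2) + C' * log_rate p (\<alpha> \<eta> \<epsilon>)"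
            unfolding distrib_left using C(1) CC' a h(3) gs l0
            by (intro add_mono mult_right_mono mult_left_mono divide_right_mono) auto
          also have "\<dots> = C' * B\<^sub>1 \<eta> \<epsilon>" using R by (simp add: B1 C'_def distrib_left)
          finally have 1: "C * (\<epsilon> / \<alpha> \<eta> \<epsilon> + (g \<eta>)\<^sup>2 / (\<alpha> \<eta> \<epsilon>)\<^sup>2 + log_rate p (\<alpha> \<eta> \<epsilon>)) \<le> C' * B\<^sub>1 \<eta> \<epsilon>" .
          have "C * (\<epsilon> + (g \<eta>)\<^sup>2 / \<alpha> \<eta> \<epsilon> + \<alpha> \<eta> \<epsilon> * log_rate p (\<alpha> \<eta> \<epsilon>))
              \<le> C' * \<epsilon> + C * ((noise_scale R \<eta>)\<^sup>2 / \<alpha> \<eta> \<epsilon>) + C' * (\<alpha> \<eta> \<epsilon> * log_rate p (\<alpha> \<eta> \<epsilon>))"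
            unfolding distrib_left using C(1) CC' a h(3) gs l0
            by (intro add_mono mult_right_mono mult_left_mono divide_right_mono) auto
          also have "\<dots> = C' * B\<^sub>2 \<eta> \<epsilon>" using R by (simp add: B2 C'_def distrib_left)
          finally have "C * (\<epsilon> + (g \<eta>)\<^sup>2 / \<alpha> \<eta> \<epsilon> + \<alpha> \<eta> \<epsilon> * log_rate p (\<alpha> \<eta> \<epsilon>)) \<le> C' * B\<^sub>2 \<eta> \<epsilon>" .
          then show ?thesis using 1 m True by (auto simp: \<omega>\<^sub>1_def \<omega>\<^sub>2_def)
        qed
      qed
      then show ?case
        unfolding B\<^sub>1_def B\<^sub>2_def using \<eta>\<^sub>0 \<omega> by blast
    qed
  next
    case 2
    let ?\<alpha> = "param_choice R p"
    obtain K where K: "K > 0" "\<forall>\<^sub>F \<eta> in at_right 0. log_rate p (noise_scale R \<eta>) \<le> K * \<eta> powr p"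
      by (rule log_rate_noise_scale[OF R \<open>p > 0\<close>])
    define L where "L = max K (2 powr (2 * p))"
    have L: "L > 0" using K(1) by (simp add: L_def)
    have "\<forall>\<^sub>F \<eta> in at_right 0. \<eta> \<le> \<eta>\<^sub>0"
      using \<eta>\<^sub>0 unfolding eventually_at_right_field by (auto intro!: exI[of _ \<eta>\<^sub>0])
    then have "\<forall>\<^sub>F \<eta> in at_right 0. \<eta> \<le> \<eta>\<^sub>0 \<and> log_rate p (noise_scale R \<eta>) \<le> K * \<eta> powr p \<and> noise_scale R \<eta> < \<alpha>\<^sub>0"
      using K(2) order_tendstoD(2)[OF noise_scale_tendsto[OF R] C(2)] by (intro eventually_conj)
    from eventually_noise_limit[OF this eventually_noise_level[OF \<open>p > 0\<close> zero_less_one C(2)]]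
    have ev: "\<forall>\<^sub>F (\<eta>, \<epsilon>) in noise_limit. \<forall>\<xi> f. impulsive_noise \<epsilon> \<eta> \<xi> \<longrightarrow>
           is_minimizer R (?\<alpha> \<eta> \<epsilon>) (\<lambda>x. gradiometry R f\<^sub>d x + \<xi> x) f \<longrightarrow>
           (L2_norm (\<lambda>x. f x - f\<^sub>d x))\<^sup>2 \<le> C * (2 + L) * max (log_rate p \<epsilon>) (\<eta> powr p) \<and>
           L1_norm (\<lambda>x. gradiometry R f x - gradiometry R f\<^sub>d x)
             \<le> C * (2 + L) * max \<epsilon> (\<eta> powr ((2 * p - 3) / 2) * R powr (- sqrt (pi / \<eta>)))"
    proof eventually_elim
      case (elim z)
      obtain \<eta> \<epsilon> where z: "z = (\<eta>, \<epsilon>)" by (cases z)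
      let ?a = "?\<alpha> \<eta> \<epsilon>" and ?s = "noise_scale R \<eta>"
      have \<eta>: "0 < \<eta>" "\<eta> \<le> \<eta>\<^sub>0" "log_rate p ?s \<le> K * \<eta> powr p" and \<epsilon>0: "0 \<le> \<epsilon>"
        and \<epsilon>: "\<epsilon> = 0 \<or> 0 < \<epsilon> \<and> \<epsilon> < 1 \<and> - ln \<epsilon> / 2 \<le> - ln (\<epsilon> * (- ln \<epsilon>) powr (2 * p))"
        and \<epsilon>1: "\<epsilon> < 1" and a0: "?a < \<alpha>\<^sub>0"
        using elim C(2) by (auto simp: z param_choice_def)
      have s: "?s > 0" using noise_scale_pos[OF R \<eta>(1)] .
      have a: "?a > 0" "?s \<le> ?a" using param_choice_pos[OF R \<eta>(1)] by (auto simp: param_choice_def)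
      define M\<^sub>1 where "M\<^sub>1 = max (log_rate p \<epsilon>) (\<eta> powr p)"
      define M\<^sub>2 where "M\<^sub>2 = max \<epsilon> (\<eta> powr p * ?s)"
      \<comment> \<open>The prefactor \<open>\<eta> powr (- 3 / 2)\<close> of the noise scale
        combines with \<open>\<eta> powr p\<close> to the exponent
        \<open>(2 * p - 3) / 2\<close>.\<close>
      have M2: "M\<^sub>2 = max \<epsilon> (\<eta> powr ((2 * p - 3) / 2) * R powr (- sqrt (pi / \<eta>)))"
        using powr_add[of \<eta> p "- 3 / 2"] by (simp add: M\<^sub>2_def noise_scale_def diff_divide_distrib)
      have g: "0 \<le> g \<eta>" "g \<eta> \<le> \<eta> powr p * ?s" using g0 small(3) \<eta> by auto
      have "g \<eta> / ?a \<le> (\<eta> powr p * ?s) / ?s" using g a s by (intro frac_le) auto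
      then have ga: "g \<eta> / ?a \<le> \<eta> powr p" "0 \<le> g \<eta> / ?a" using s g a by auto
      have p1: "\<eta> powr p \<le> 1" using small(2)[OF \<eta>(1,2)] \<eta>(1) \<open>p > 0\<close> powr_mono2[of p \<eta> 1] by simp
      \<comment> \<open>One factor is bounded by \<open>\<eta> powr p\<close>, the other merely by
        1.\<close>
      have "(g \<eta> / ?a) * (g \<eta> / ?a) \<le> \<eta> powr p * 1" using ga p1 by (intro mult_mono) auto
      then have g1: "(g \<eta>)\<^sup>2 / ?a\<^sup>2 \<le> M\<^sub>1" by (simp add: M\<^sub>1_def power2_eq_square)
      have "g \<eta> * (g \<eta> / ?a) \<le> (\<eta> powr p * ?s) * 1" using ga p1 g s by (intro mult_mono) auto
      then have g2: "(g \<eta>)\<^sup>2 / ?a \<le> M\<^sub>2" by (simp add: M\<^sub>2_def power2_eq_square)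
      have e1: "\<epsilon> / ?a \<le> M\<^sub>1"
        using param_choice_ratio[OF R \<eta>(1) \<epsilon>0 \<epsilon>1, of p] by (simp add: M\<^sub>1_def)
      have e2: "\<epsilon> \<le> M\<^sub>2" by (simp add: M\<^sub>2_def)
      have l1: "log_rate p ?a \<le> L * M\<^sub>1" and l2: "?a * log_rate p ?a \<le> L * M\<^sub>2"
        using log_rate_param_choice[OF R \<open>p > 0\<close> \<eta>(1) \<epsilon> \<eta>(3) K(1)] by (simp_all add: L_def M\<^sub>1_def M\<^sub>2_def)
      have "(L2_norm (\<lambda>x. f x - f\<^sub>d x))\<^sup>2 \<le> C * (2 + L) * M\<^sub>1 \<and>
           L1_norm (\<lambda>x. gradiometry R f x - gradiometry R f\<^sub>d x) \<le> C * (2 + L) * M\<^sub>2"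
        if "impulsive_noise \<epsilon> \<eta> \<xi>" "is_minimizer R ?a (\<lambda>x. gradiometry R f\<^sub>d x + \<xi> x) f" for \<xi> f
      proof -
        have 1: "(L2_norm (\<lambda>x. f x - f\<^sub>d x))\<^sup>2 \<le> C * (\<epsilon> / ?a + (g \<eta>)\<^sup>2 / ?a\<^sup>2 + log_rate p ?a)"
          and 2: "L1_norm (\<lambda>x. gradiometry R f x - gradiometry R f\<^sub>d x) \<le> C * (\<epsilon> + (g \<eta>)\<^sup>2 / ?a + ?a * log_rate p ?a)"
          using min_est[OF \<eta>(1) small(1)[OF \<eta>(1,2)] \<epsilon>0 a(1) that] a0 by auto
        \<comment> \<open>The constant \<open>2 + L\<close> collects the three summands: 1 for the
          data term, 1 for the noise term and \<open>L\<close> for the logarithmic one.\<close>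
        have 3: "C * (\<epsilon> / ?a + (g \<eta>)\<^sup>2 / ?a\<^sup>2 + log_rate p ?a) \<le> C * (M\<^sub>1 + M\<^sub>1 + L * M\<^sub>1)"
          using e1 g1 l1 C(1) by (intro mult_left_mono add_mono) auto
        have 4: "C * (\<epsilon> + (g \<eta>)\<^sup>2 / ?a + ?a * log_rate p ?a) \<le> C * (M\<^sub>2 + M\<^sub>2 + L * M\<^sub>2)"
          using e2 g2 l2 C(1) by (intro mult_left_mono add_mono) auto
        have "C * (M + M + L * M) = C * (2 + L) * M" for M by (simp add: algebra_simps)
        then show ?thesis using order_trans[OF 1 3] order_trans[OF 2 4] by (simp only: simp_thms)
      qed
      then show ?case unfolding M2 M\<^sub>1_def by (simp add: z)
    qed
    show ?case
      using admissible_param_choice[OF R \<open>p > 0\<close> \<open>C\<^sub>e > 0\<close> \<open>C\<^sub>\<gamma> > 0\<close>] ev by blast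
  qed
qed

end
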